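(* Let $b=p_1^{l_1}\cdots p_s^{l_s}$ with $s\ge 2$, where $p_1,\ldots,p_s$ are distinct primes and $l_1,\ldots,l_s\geq1$ are integers, and put $b_i=p_i^{l_i}$. For each $i=1,\ldots,s$ let $f_i\colon\mathbb{Z}_{p_i}\to\mathbb{Q}_{p_i}$ be an analytic function that is not identically zero, and let $f=(f_1,\ldots,f_s)$. Let $\mathcal{R}_f=\mathcal{R}_{f_1}\times\cdots\times\mathcal{R}_{f_s}\subset\mathbb{Z}_b$, where $\mathcal{R}_{f_i}$ is the set of roots of $f_i$ in $\mathbb{Z}_{p_i}$. Let $d\ge1$ be an integer. Then the sequence $(\ell_{b,d}(f(n)))_{n\ge0}$ is (a) periodic if $\mathcal{R}_f=\varnothing$, and a power of $b$ can be chosen as a period; (b) strictly $k$-automatic if $\mathcal{R}_f=\{\theta\}$ for some $\theta\in\mathbb{Q}\cap\mathbb{Z}_b$, where $k=b_1^{w_1}\cdots b_s^{w_s}$ and $w_1,\ldots,w_s$ are positive integers satisfying $w_1m_{f_1}(\theta)=\cdots=w_sm_{f_s}(\theta)$; (c) not automatic otherwise. In particular, these conditions do not depend on $d$.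
   Context: $\mathbb{N}=\{0,1,2,\ldots\}$. A function $\mathbb{Z}_p\to\mathbb{Q}_p$ is analytic if it is given by a single Taylor (power) series convergent on all of $\mathbb{Z}_p$; $m_{f_i}(\theta)$ denotes the multiplicity of $\theta$ as a root of $f_i$. Put $\mathbb{Z}_b=\mathbb{Z}_{p_1}\times\cdots\times\mathbb{Z}_{p_s}$ and $\mathbb{Q}_b=\mathbb{Q}_{p_1}\times\cdots\times\mathbb{Q}_{p_s}$; $\mathbb{Q}$ is identified with its diagonal image in $\mathbb{Q}_b$ under $x\mapsto(x,\ldots,x)$. For $n\in\mathbb{N}$, $f(n)=(f_1(n),\ldots,f_s(n))\in\mathbb{Q}_b$. For $x=(x_1,\ldots,x_s)\in\mathbb{Q}_b$ put $\nu_b(x)=\min_{1\le i\le s}\lfloor\nu_{p_i}(x_i)/l_i\rfloor$ (with $\nu_{p_i}(0)=+\infty$), $\mathcal{L}_b(x)=b^{-\nu_b(x)}x\in\mathbb{Z}_b$ if $x\ne0$, and $\mathcal{L}_b(0)=0$. For $x\in\mathbb{Z}_b$, $x\bmod b^d$ is the unique $y\in\{0,\ldots,b^d-1\}$ with $y\equiv x_i\pmod{b_i^d}$ for all $i$. Put $\ell_{b,d}(x)=\mathcal{L}_b(x)\bmod b^d$. For an integer $k\ge2$, a sequence $(a_n)_{n\ge0}$ is $k$-automatic if its $k$-kernel $\{(a_{k^in+j})_{n\ge0}: i\ge0,\ 0\le j\le k^i-1\}$ is finite. It is automatic if it is $k$-automatic for some $k\ge2$. It is strictly $k$-automatic if it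 is $k$-automatic and is not $m$-automatic for any integer $m\ge2$ multiplicatively independent of $k$ (i.e. with $k^a\neq m^c$ for all integers $a,c\ge1$). A period need not be minimal. *)

theory Defs
  imports Complex_Main "HOL-Computational_Algebra.Computational_Algebra" "HOL-Algebra.QuotRing"
begin

section \<open>The field of p-adic numbers\<close>

text \<open>
  The prime varies inside the statement, so \<open>\<rat>\<^sub>p\<close> is a carrier-based ring: the completion of
  \<open>\<rat>\<close> with respect to the p-adic absolute value, i.e. the ring of Cauchy sequences
  of rationals modulo the ideal of null sequences.
\<close>

definition rat_val :: "nat \<Rightarrow> rat \<Rightarrow> int" where
  "rat_val p q = int (multiplicity (int p) (fst (quotient_of q)))
               - int (multiplicity (int p) (snd (quotient_of q)))"

definition rat_abs :: "nat \<Rightarrow> rat \<Rightarrow> real" where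
  "rat_abs p q = (if q = 0 then 0 else real p powi (- rat_val p q))"

definition padic_Cauchy :: "nat \<Rightarrow> (nat \<Rightarrow> rat) \<Rightarrow> bool" where
  "padic_Cauchy p X \<longleftrightarrow> (\<forall>e>0. \<exists>N. \<forall>m\<ge>N. \<forall>n\<ge>N. rat_abs p (X m - X n) < e)"

definition Cauchy_ring :: "nat \<Rightarrow> (nat \<Rightarrow> rat) ring" where
  "Cauchy_ring p = \<lparr>carrier = {X. padic_Cauchy p X},
     monoid.mult = (\<lambda>X Y n. X n * Y n), one = (\<lambda>n. 1),
     zero = (\<lambda>n. 0), add = (\<lambda>X Y n. X n + Y n)\<rparr>"

definition null_seqs :: "nat \<Rightarrow> (nat \<Rightarrow> rat) set" where
  "null_seqs p = {X. (\<lambda>n. rat_abs p (X n)) \<longlonglongrightarrow> 0}"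

definition Qp :: "nat \<Rightarrow> (nat \<Rightarrow> rat) set ring" where
  "Qp p = Cauchy_ring p Quot null_seqs p"

definition Qp_of_rat :: "nat \<Rightarrow> rat \<Rightarrow> (nat \<Rightarrow> rat) set" where
  "Qp_of_rat p q = null_seqs p +>\<^bsub>Cauchy_ring p\<^esub> (\<lambda>n. q)"

text \<open>An element of \<open>\<rat>\<^sub>p\<close> is a class of sequences, all of which have the same limit of absolute values.\<close>

definition Qp_norm :: "nat \<Rightarrow> (nat \<Rightarrow> rat) set \<Rightarrow> real" where
  "Qp_norm p x = (THE r. \<exists>X\<in>x. (\<lambda>n. rat_abs p (X n)) \<longlonglongrightarrow> r)"

text \<open>Only meaningful for \<open>x \<noteq> 0\<close>; the value \<open>+\<infinity>\<close> at \<open>0\<close> is dealt with where the valuation is used.\<close>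

definition Qp_val :: "nat \<Rightarrow> (nat \<Rightarrow> rat) set \<Rightarrow> int" where
  "Qp_val p x = (THE v. Qp_norm p x = real p powi (- v))"

definition Zp :: "nat \<Rightarrow> (nat \<Rightarrow> rat) set set" where
  "Zp p = {x \<in> carrier (Qp p). Qp_norm p x \<le> 1}"

definition Qp_tendsto :: "nat \<Rightarrow> (nat \<Rightarrow> (nat \<Rightarrow> rat) set) \<Rightarrow> (nat \<Rightarrow> rat) set \<Rightarrow> bool" where
  "Qp_tendsto p X x \<longleftrightarrow> (\<lambda>n. Qp_norm p (X n \<ominus>\<^bsub>Qp p\<^esub> x)) \<longlonglongrightarrow> 0"


section \<open>Analytic functions on the p-adic integers\<close>

definition Zp_analytic :: "nat \<Rightarrow> ((nat \<Rightarrow> rat) set \<Rightarrow> (nat \<Rightarrow> rat) set) \<Rightarrow> bool" where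
  "Zp_analytic p f \<longleftrightarrow> f \<in> Zp p \<rightarrow> carrier (Qp p) \<and>
     (\<exists>a. (\<forall>k. a k \<in> carrier (Qp p)) \<and>
       (\<forall>x\<in>Zp p. Qp_tendsto p
          (\<lambda>n. \<Oplus>\<^bsub>Qp p\<^esub>k\<in>{..<n}. a k \<otimes>\<^bsub>Qp p\<^esub> x [^]\<^bsub>Qp p\<^esub> (k::nat)) (f x)))"

definition Zp_roots :: "nat \<Rightarrow> ((nat \<Rightarrow> rat) set \<Rightarrow> (nat \<Rightarrow> rat) set) \<Rightarrow> (nat \<Rightarrow> rat) set set" where
  "Zp_roots p f = {x \<in> Zp p. f x = \<zero>\<^bsub>Qp p\<^esub>}"

text \<open>
  The largest \<open>m\<close> such that \<open>(x - \<theta>)\<^sup>m\<close> divides \<open>f\<close> in the ring of analytic functions on \<open>\<int>\<^sub>p\<close>;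
  meaningful for \<open>\<theta> \<in> \<int>\<^sub>p\<close> and analytic \<open>f\<close> that is not identically zero.
\<close>

definition root_mult ::
  "nat \<Rightarrow> ((nat \<Rightarrow> rat) set \<Rightarrow> (nat \<Rightarrow> rat) set) \<Rightarrow> (nat \<Rightarrow> rat) set \<Rightarrow> nat" where
  "root_mult p f \<theta> = (GREATEST m. \<exists>g. Zp_analytic p g \<and>
     (\<forall>x\<in>Zp p. f x = (x \<ominus>\<^bsub>Qp p\<^esub> \<theta>) [^]\<^bsub>Qp p\<^esub> m \<otimes>\<^bsub>Qp p\<^esub> g x))"


section \<open>The products \<open>\<rat>\<^sub>b\<close> and \<open>\<int>\<^sub>b\<close>, and last nonzero digits in base b\<close>

text \<open>
  Throughout, \<open>b = p\<^sub>1\<^bsup>l\<^sub>1\<^esup> \<cdots> p\<^sub>s\<^bsup>l\<^sub>s\<^esup>\<close>; tuples in \<open>\<rat>\<^sub>b\<close> are extensional functions on \<open>{1..s}\<close>.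
\<close>

definition base :: "nat \<Rightarrow> (nat \<Rightarrow> nat) \<Rightarrow> (nat \<Rightarrow> nat) \<Rightarrow> nat" where
  "base s p l = (\<Prod>i\<in>{1..s}. p i ^ l i)"

definition Zb :: "nat \<Rightarrow> (nat \<Rightarrow> nat) \<Rightarrow> (nat \<Rightarrow> (nat \<Rightarrow> rat) set) set" where
  "Zb s p = (\<Pi>\<^sub>E i\<in>{1..s}. Zp (p i))"

definition Qb_of_rat :: "nat \<Rightarrow> (nat \<Rightarrow> nat) \<Rightarrow> rat \<Rightarrow> nat \<Rightarrow> (nat \<Rightarrow> rat) set" where
  "Qb_of_rat s p q = (\<lambda>i\<in>{1..s}. Qp_of_rat (p i) q)"

text \<open>
  For \<open>x \<noteq> 0\<close>, the minimum of \<open>\<lfloor>\<nu>\<^bsub>p\<^sub>i\<^esub>(x\<^sub>i) / l\<^sub>i\<rfloor>\<close>. Zero components have valuation \<open>+\<infinity>\<close>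
  and hence do not contribute. Division on \<^typ>\<open>int\<close> rounds down.
\<close>

definition nu_b :: "nat \<Rightarrow> (nat \<Rightarrow> nat) \<Rightarrow> (nat \<Rightarrow> nat) \<Rightarrow> (nat \<Rightarrow> (nat \<Rightarrow> rat) set) \<Rightarrow> int" where
  "nu_b s p l x = Min ((\<lambda>i. Qp_val (p i) (x i) div int (l i)) ` {i\<in>{1..s}. x i \<noteq> \<zero>\<^bsub>Qp (p i)\<^esub>})"

definition L_b ::
  "nat \<Rightarrow> (nat \<Rightarrow> nat) \<Rightarrow> (nat \<Rightarrow> nat) \<Rightarrow> (nat \<Rightarrow> (nat \<Rightarrow> rat) set) \<Rightarrow> nat \<Rightarrow> (nat \<Rightarrow> rat) set" where
  "L_b s p l x =
     (if x = Qb_of_rat s p 0 then Qb_of_rat s p 0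
      else (\<lambda>i\<in>{1..s}. Qp_of_rat (p i) (of_nat (base s p l) powi (- nu_b s p l x)) \<otimes>\<^bsub>Qp (p i)\<^esub> x i))"

definition Zp_cong ::
  "nat \<Rightarrow> nat \<Rightarrow> (nat \<Rightarrow> rat) set \<Rightarrow> (nat \<Rightarrow> rat) set \<Rightarrow> bool" where
  "Zp_cong p N x y \<longleftrightarrow> (\<exists>z\<in>Zp p. x \<ominus>\<^bsub>Qp p\<^esub> y = Qp_of_rat p (of_nat N) \<otimes>\<^bsub>Qp p\<^esub> z)"

definition Zb_mod ::
  "nat \<Rightarrow> (nat \<Rightarrow> nat) \<Rightarrow> (nat \<Rightarrow> nat) \<Rightarrow> nat \<Rightarrow> (nat \<Rightarrow> (nat \<Rightarrow> rat) set) \<Rightarrow> nat" where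
  "Zb_mod s p l d x = (THE y. y < base s p l ^ d \<and>
     (\<forall>i\<in>{1..s}. Zp_cong (p i) ((p i ^ l i) ^ d) (Qp_of_rat (p i) (of_nat y)) (x i)))"

definition ell_b ::
  "nat \<Rightarrow> (nat \<Rightarrow> nat) \<Rightarrow> (nat \<Rightarrow> nat) \<Rightarrow> nat \<Rightarrow> (nat \<Rightarrow> (nat \<Rightarrow> rat) set) \<Rightarrow> nat" where
  "ell_b s p l d x = Zb_mod s p l d (L_b s p l x)"

definition eval_nat ::
  "nat \<Rightarrow> (nat \<Rightarrow> nat) \<Rightarrow> (nat \<Rightarrow> (nat \<Rightarrow> rat) set \<Rightarrow> (nat \<Rightarrow> rat) set) \<Rightarrow>
   nat \<Rightarrow> nat \<Rightarrow> (nat \<Rightarrow> rat) set" where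
  "eval_nat s p f n = (\<lambda>i\<in>{1..s}. f i (Qp_of_rat (p i) (of_nat n)))"

definition digit_seq ::
  "nat \<Rightarrow> (nat \<Rightarrow> nat) \<Rightarrow> (nat \<Rightarrow> nat) \<Rightarrow> nat \<Rightarrow>
   (nat \<Rightarrow> (nat \<Rightarrow> rat) set \<Rightarrow> (nat \<Rightarrow> rat) set) \<Rightarrow> nat \<Rightarrow> nat" where
  "digit_seq s p l d f n = ell_b s p l d (eval_nat s p f n)"

definition Zb_roots ::
  "nat \<Rightarrow> (nat \<Rightarrow> nat) \<Rightarrow> (nat \<Rightarrow> (nat \<Rightarrow> rat) set \<Rightarrow> (nat \<Rightarrow> rat) set) \<Rightarrow>
   (nat \<Rightarrow> (nat \<Rightarrow> rat) set) set" where
  "Zb_roots s p f = (\<Pi>\<^sub>E i\<in>{1..s}. Zp_roots (p i) (f i))"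


section \<open>Periodic and automatic sequences\<close>

definition has_period :: "(nat \<Rightarrow> 'a) \<Rightarrow> nat \<Rightarrow> bool" where
  "has_period a T \<longleftrightarrow> T \<ge> 1 \<and> (\<forall>n. a (n + T) = a n)"

definition periodic :: "(nat \<Rightarrow> 'a) \<Rightarrow> bool" where
  "periodic a \<longleftrightarrow> (\<exists>T. has_period a T)"

definition kernel :: "nat \<Rightarrow> (nat \<Rightarrow> 'a) \<Rightarrow> (nat \<Rightarrow> 'a) set" where
  "kernel k a = {(\<lambda>n. a (k ^ i * n + j)) | i j. j \<le> k ^ i - 1}"

definition k_automatic :: "nat \<Rightarrow> (nat \<Rightarrow> 'a) \<Rightarrow> bool" where
  "k_automatic k a \<longleftrightarrow> k \<ge> 2 \<and> finite (kernel k a)"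

definition automatic :: "(nat \<Rightarrow> 'a) \<Rightarrow> bool" where
  "automatic a \<longleftrightarrow> (\<exists>k\<ge>2. k_automatic k a)"

definition mult_indep :: "nat \<Rightarrow> nat \<Rightarrow> bool" where
  "mult_indep k m \<longleftrightarrow> (\<forall>a\<ge>1. \<forall>c\<ge>1. k ^ a \<noteq> m ^ c)"

definition strictly_automatic :: "nat \<Rightarrow> (nat \<Rightarrow> 'a) \<Rightarrow> bool" where
  "strictly_automatic k a \<longleftrightarrow>
     k_automatic k a \<and> (\<forall>m\<ge>2. mult_indep k m \<longrightarrow> \<not> k_automatic m a)"

end

theory Submission
  imports Defs "HOL-Library.Function_Algebras" "HOL-Number_Theory.Cong"
begin

text \<open>
  Everything is read off from the valuations \<open>\<nu>(f\<^sub>i(n))\<close>: near a root \<open>\<theta>\<^sub>i\<close> of multiplicity \<open>m\<^sub>i\<close>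
  one has \<open>\<nu>(f\<^sub>i(n)) = m\<^sub>i \<nu>(n - \<theta>\<^sub>i) + c\<^sub>i\<close>, and \<open>p\<^sub>i\<^bsup>l\<^sub>i\<^esup>\<close> divides the digit exactly when component \<open>i\<close>
  does not attain the minimum defining \<open>\<nu>\<^sub>b\<close>. Away from common roots the sequence is constant on
  residue classes modulo a power of \<open>b\<close>, which gives (a); at a common root it is discontinuous.

  If all roots equal the rational \<open>\<theta>\<close>, the substitution \<open>n \<mapsto> k\<^sup>e n + j\<close> with \<open>j \<equiv> \<theta>\<close> modulo \<open>k\<^sup>e\<close> multiplies
  \<open>f\<^sub>i\<close> by \<open>b\<^bsup>We\<^esup>\<close> up to a unit and moves the root to \<open>(\<theta> - j) / k\<^sup>e\<close>, a rational of bounded height;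
  so finitely many sequences arise.

  Conversely, let the sequence be \<open>g\<close>-automatic and \<open>\<theta>\<close> a common root. For \<open>j \<equiv> \<theta>\<close> modulo \<open>g\<^sup>e\<close> the point
  \<open>(\<theta> - j) / g\<^sup>e\<close> is a discontinuity of a kernel element, and each of the finitely many kernel
  elements has finitely many discontinuities. Counting shows that \<open>g\<close> is a product of the \<open>p\<^sub>i\<close>, and a
  coincidence of two such points (for the same kernel element) for distinct \<open>e\<close> makes \<open>\<theta>\<close> rational and
  the comparison of the \<open>\<lfloor>\<nu>(f\<^sub>i(n)) / l\<^sub>i\<rfloor>\<close> invariant under a shift of the \<open>\<nu>(n - \<theta>\<^sub>i)\<close>; this forces the
  exponents of \<open>g\<close> to be proportional to those of \<open>k\<close>.

  Elements of \<open>\<rat>\<^sub>p\<close> are handled through representing Cauchy sequences, which form a type-class ring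
  (\<open>nat \<Rightarrow> rat\<close> with pointwise operations) with a seminorm; equality in \<open>\<rat>\<^sub>p\<close> becomes vanishing of
  the seminorm of the difference.
\<close>

section \<open>The p-adic absolute value on the rationals\<close>

text \<open>A common root is a discontinuity because there are two primes: by the Chinese remainder
  theorem the valuations of n - \<theta>_i can be prescribed independently, so arbitrarily near the
  root either of two components can be made to attain the minimum alone. The exponents of k satisfy
  w_i m_i = W for all i, hence k^(m_i) and b^W have the same p_i-adic valuation l_i W. The
  substitution therefore scales all components by one power of b, which normalization removes; the
  remaining units matter only modulo p_i^(l_i d) and so take finitely many values. Proportionality
  of the exponents of g comes from comparing the growth rates of the two floors when the shift is
  iterated. Three facts on analytic functions carry this: division by a root in the manner of
  Strassmann (finitely many roots, factorization), a Lipschitz bound, and a positive lower bound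
  when there is no root. As equality is visible only through the seminorm, sums of series are chosen
  limits and identities between them hold up to seminorm zero.\<close>

lemma powi_less_iff: "1 < (x::real) \<Longrightarrow> x powi a < x powi b \<longleftrightarrow> a < b"
  using power_int_strict_increasing[of a b x] power_int_strict_increasing[of b a x]
  by (cases a b rule: linorder_cases) auto

lemma powi_le_iff: "1 < (x::real) \<Longrightarrow> x powi a \<le> x powi b \<longleftrightarrow> a \<le> b"
  by (simp add: powi_less_iff flip: not_less)

lemma powi_inj: "1 < (x::real) \<Longrightarrow> x powi a = x powi b \<longleftrightarrow> a = b"
  by (auto simp: order.eq_iff powi_le_iff)

text \<open>\<open>rat_val\<close> reads off the reduced fraction. Equal fractions have equal cross
  products, so the multiplicities of any other representation give the same difference; products can
  then be computed without reducing.\<close>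

lemma rat_val_divide:
  assumes "prime p" "a \<noteq> 0" "b \<noteq> 0"
  shows "rat_val p (of_int a / of_int b) = int (multiplicity (int p) a) - int (multiplicity (int p) b)"
proof -
  obtain c e where q: "quotient_of (of_int a / of_int b) = (c, e)" by fastforce
  have e: "e > 0" using quotient_of_denom_pos[OF q] .
  have "(of_int a / of_int b :: rat) = of_int c / of_int e" using quotient_of_div[OF q] .
  hence "(of_int (a * e) :: rat) = of_int (c * b)" using assms e by (simp add: field_simps)
  hence eq: "a * e = c * b" by (simp only: of_int_eq_iff)
  have c: "c \<noteq> 0" using eq assms e by auto
  have pr: "prime_elem (int p)" using assms by auto
  have "multiplicity (int p) a + multiplicity (int p) e = multiplicity (int p) c + multiplicity (int p) b"
    using prime_elem_multiplicity_mult_distrib[OF pr] assms e c eq by (metis less_irrefl)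
  thus ?thesis by (simp add: rat_val_def q)
qed

lemma rat_as_fraction:
  obtains a b :: int where "(q::rat) = of_int a / of_int b" "b > 0"
  by (metis quotient_of_denom_pos quotient_of_div surj_pair)

lemma rat_val_mult:
  assumes "prime p" "x \<noteq> 0" "y \<noteq> 0"
  shows "rat_val p (x * y) = rat_val p x + rat_val p y"
proof -
  obtain a b where x: "x = of_int a / of_int b" "b > 0" by (rule rat_as_fraction)
  obtain c e where y: "y = of_int c / of_int e" "e > 0" by (rule rat_as_fraction)
  have nz: "a \<noteq> 0" "c \<noteq> 0" using x y assms by auto
  have xy: "x * y = of_int (a * c) / of_int (b * e)" by (simp add: x y)
  have pr: "prime_elem (int p)" using assms by auto
  have "rat_val p (x * y) = int (multiplicity (int p) (a * c)) - int (multiplicity (int p) (b * e))"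
    unfolding xy using nz x(2) y(2) by (intro rat_val_divide assms) auto
  moreover have "rat_val p x = int (multiplicity (int p) a) - int (multiplicity (int p) b)"
    unfolding x(1) using nz x(2) by (intro rat_val_divide assms) auto
  moreover have "rat_val p y = int (multiplicity (int p) c) - int (multiplicity (int p) e)"
    unfolding y(1) using nz y(2) by (intro rat_val_divide assms) auto
  ultimately show ?thesis
    using nz x(2) y(2) by (simp add: prime_elem_multiplicity_mult_distrib[OF pr])
qed

lemma rat_abs_mult: "prime p \<Longrightarrow> rat_abs p (x * y) = rat_abs p x * rat_abs p y"
  by (auto simp: rat_abs_def rat_val_mult prime_gt_0_nat simp flip: power_int_add)

lemma rat_abs_nonneg: "rat_abs p x \<ge> 0"
  by (auto simp: rat_abs_def)

lemma rat_abs_zero [simp]: "rat_abs p 0 = 0"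
  by (auto simp: rat_abs_def)

lemma rat_abs_eq_0: "prime p \<Longrightarrow> rat_abs p x = 0 \<longleftrightarrow> x = 0"
  by (auto simp: rat_abs_def prime_gt_0_nat)

lemma rat_abs_one [simp]: "rat_abs p 1 = 1"
  by (auto simp: rat_abs_def rat_val_def)

lemma rat_abs_uminus: "prime p \<Longrightarrow> rat_abs p (- x) = rat_abs p x"
proof -
  assume "prime p"
  hence "rat_abs p (-1) * rat_abs p (-1) = 1" using rat_abs_mult[of p "-1" "-1"] by simp
  hence "rat_abs p (-1) = 1" using rat_abs_nonneg[of p "-1"]
    by (metis abs_of_nonneg real_sqrt_mult_self real_sqrt_one real_sqrt_mult)
  thus ?thesis using rat_abs_mult[OF \<open>prime p\<close>, of "-1" x] by simp
qed

lemma rat_abs_of_int_le: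
  assumes "prime p"
  shows "rat_abs p (of_int a) \<le> real p powi (- int n) \<longleftrightarrow> int p ^ n dvd a"
proof (cases "a = 0")
  case False
  have "rat_val p (of_int a) = int (multiplicity (int p) a)"
    using rat_val_divide[OF assms False, of 1] by simp
  moreover have "int p ^ n dvd a \<longleftrightarrow> n \<le> multiplicity (int p) a"
    using False assms by (subst power_dvd_iff_le_multiplicity) (auto simp: prime_gt_1_nat)
  ultimately show ?thesis using False prime_gt_1_nat[OF assms]
    by (simp add: rat_abs_def powi_le_iff)
qed auto

lemma rat_abs_add:
  assumes "prime p"
  shows "rat_abs p (x + y) \<le> max (rat_abs p x) (rat_abs p y)"
proof -
  obtain a b where x: "x = of_int a / of_int b" "b > 0" by (rule rat_as_fraction)
  obtain c e where y: "y = of_int c / of_int e" "e > 0" by (rule rat_as_fraction)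
  \<comment> \<open>The larger of the two absolute values is p^(-n) for some n, so p^n divides both
    integers and hence their sum. Fractions follow over a common denominator.\<close>
  have int_case: "rat_abs p (of_int u + of_int v) \<le> max (rat_abs p (of_int u)) (rat_abs p (of_int v))" for u v
  proof -
    have *: "rat_abs p (of_int u + of_int v) \<le> rat_abs p (of_int w)"
      if "w \<noteq> 0" "rat_abs p (of_int u) \<le> rat_abs p (of_int w)" "rat_abs p (of_int v) \<le> rat_abs p (of_int w)" for w
    proof -
      define n where "n = multiplicity (int p) w"
      have "rat_val p (of_int w) = int n"
        using rat_val_divide[OF assms that(1), of 1] by (simp add: n_def)
      hence w: "rat_abs p (of_int w) = real p powi (- int n)" using that by (simp add: rat_abs_def)
      have "int p ^ n dvd u + v" using that(2,3) unfolding w rat_abs_of_int_le[OF assms] by simp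
      thus ?thesis unfolding w using rat_abs_of_int_le[OF assms, of "u + v" n] by simp
    qed
    show ?thesis
    proof (cases "u = 0 \<or> v = 0")
      case False
      thus ?thesis using *[of u] *[of v] by (cases "rat_abs p (of_int u) \<le> rat_abs p (of_int v)") auto
    qed (auto simp: le_max_iff_disj)
  qed
  define i :: rat where "i = 1 / of_int (b * e)"
  have "x = of_int (a * e) * i" "y = of_int (c * b) * i" using x y by (auto simp: i_def field_simps)
  hence "rat_abs p x = rat_abs p (of_int (a * e)) * rat_abs p i"
        "rat_abs p y = rat_abs p (of_int (c * b)) * rat_abs p i"
        "rat_abs p (x + y) = rat_abs p (of_int (a * e) + of_int (c * b)) * rat_abs p i"
    by (metis rat_abs_mult[OF assms] distrib_right)+
  thus ?thesis using int_case[of "a * e" "c * b"] rat_abs_nonneg[of p i]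
    by (metis max_mult_distrib_right mult_right_mono of_int_add)
qed

lemma rat_abs_of_nat_coprime:
  assumes "prime p" "\<not> p dvd n" shows "rat_abs p (of_nat n) = 1"
proof -
  have "n \<noteq> 0" using assms by (metis dvd_0_right)
  have "rat_val p (of_nat n) = int (multiplicity (int p) (int n))"
    using rat_val_divide[OF assms(1), of "int n" 1] \<open>n \<noteq> 0\<close> by simp
  moreover have "multiplicity (int p) (int n) = 0"
    using assms by (intro not_dvd_imp_multiplicity_0) auto
  ultimately show ?thesis using \<open>n \<noteq> 0\<close> by (simp add: rat_abs_def)
qed

lemma rat_abs_prime: assumes "prime p" shows "rat_abs p (of_nat p) = real p powi (- 1)"
proof -
  have "rat_val p (of_nat p) = int (multiplicity (int p) (int p))"
    using rat_val_divide[OF assms(1), of "int p" 1] assms by (simp add: prime_gt_0_nat)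
  moreover have "multiplicity (int p) (int p) = 1"
    using assms by (intro multiplicity_prime) auto
  ultimately show ?thesis using assms by (auto simp: rat_abs_def prime_gt_0_nat)
qed

lemma rat_abs_power: "prime p \<Longrightarrow> rat_abs p (x ^ n) = rat_abs p x ^ n"
  by (induction n) (auto simp: rat_abs_mult)

text \<open>The denominator of a p-integral rational is prime to p, hence invertible modulo p^E; the
  numerator times that inverse is the approximation.\<close>

lemma rat_approx_nat:
  assumes "prime p" "rat_abs p q \<le> 1"
  shows "\<exists>n. rat_abs p (q - of_nat n) \<le> real p powi (- int E)"
proof -
  obtain a b where q: "quotient_of q = (a, b)" by fastforce
  have b: "b > 0" using quotient_of_denom_pos[OF q] .
  have cop: "coprime a b" using quotient_of_coprime[OF q] .
  have qd: "q = of_int a / of_int b" using quotient_of_div[OF q] .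
  have nb: "\<not> int p dvd b"
  proof
    assume d: "int p dvd b"
    have "\<not> int p dvd a" using cop d assms(1)
      by (metis coprime_common_divisor not_prime_unit prime_nat_int_transfer)
    hence "a \<noteq> 0" "multiplicity (int p) a = 0" by (auto intro: not_dvd_imp_multiplicity_0)
    moreover have "multiplicity (int p) b \<ge> 1"
      using d b assms(1) by (intro multiplicity_geI) (auto simp: prime_gt_1_nat)
    ultimately have "rat_val p q \<le> -1" by (simp add: rat_val_def q)
    moreover have "q \<noteq> 0" using \<open>a \<noteq> 0\<close> b qd by auto
    ultimately have "rat_abs p q \<ge> real p powi 1" unfolding rat_abs_def
      using powi_le_iff[of "real p" 1 "- rat_val p q"] prime_gt_1_nat[OF assms(1)] by auto
    thus False using assms(2) prime_gt_1_nat[OF assms(1)] by simp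
  qed
  have "coprime b (int p ^ E)" using nb assms(1)
    by (metis coprime_commute coprime_power_right_iff prime_imp_coprime prime_nat_int_transfer)
  then obtain c where c: "[b * c = 1] (mod (int p ^ E))" using cong_solve_coprime_int by blast
  define n where "n = nat ((a * c) mod int p ^ E)"
  have pE: "int p ^ E > 0" using assms(1) by (simp add: prime_gt_0_nat)
  have n: "int n = (a * c) mod int p ^ E" unfolding n_def using pE by simp
  have "[int n = a * c] (mod int p ^ E)" unfolding n by (simp add: cong_def)
  hence "[b * int n = b * (a * c)] (mod int p ^ E)" by (rule cong_scalar_left)
  also have "b * (a * c) = a * (b * c)" by simp
  also have "[a * (b * c) = a * 1] (mod int p ^ E)" using c by (rule cong_scalar_left)
  finally have "int p ^ E dvd a - b * int n" by (metis cong_iff_dvd_diff cong_sym mult.right_neutral)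
  hence *: "rat_abs p (of_int (a - b * int n)) \<le> real p powi (- int E)"
    using rat_abs_of_int_le[OF assms(1)] by blast
  have rb: "rat_abs p (of_int b) = 1" using rat_abs_of_nat_coprime[OF assms(1), of "nat b"] nb b
    by (metis int_dvd_int_iff nat_0_le of_int_of_nat_eq order_less_imp_le)
  have "of_int b * (q - of_nat n) = of_int (a - b * int n)" using b by (simp add: qd field_simps)
  hence "rat_abs p (q - of_nat n) = rat_abs p (of_int (a - b * int n))"
    using rat_abs_mult[OF assms(1), of "of_int b" "q - of_nat n"] rb by simp
  thus ?thesis using * by metis
qed

lemma rat_abs_inverse: assumes "prime p" shows "rat_abs p (inverse x) = inverse (rat_abs p x)"
proof (cases "x = 0")
  case False
  hence "rat_abs p x * rat_abs p (inverse x) = 1" using rat_abs_mult[OF assms, of x "inverse x"] by simp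
  thus ?thesis by (metis inverse_unique)
qed simp

lemma rat_abs_power_int: "prime p \<Longrightarrow> rat_abs p (x powi c) = rat_abs p x powi c"
  by (simp add: power_int_def rat_abs_power rat_abs_inverse)

section \<open>Multiplicative ultrametric seminorms\<close>

text \<open>The ring is the whole type, and \<open>K\<close> is the part on which the seminorm is
  under control. Thus one type and one embedding \<open>iota\<close> of the rationals serve all
  primes at once; only \<open>K\<close> and \<open>N\<close> depend on the prime. Elements other
  than 0 may have seminorm zero, so limits exist but are not unique.\<close>

locale padic =
  fixes p :: nat and K :: "'a::comm_ring_1 set" and N :: "'a \<Rightarrow> real" and iota :: "rat \<Rightarrow> 'a"
  assumes prime_p: "prime p"
    and K_add [simp, intro]: "x \<in> K \<Longrightarrow> y \<in> K \<Longrightarrow> x + y \<in> K"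
    and K_mult [simp, intro]: "x \<in> K \<Longrightarrow> y \<in> K \<Longrightarrow> x * y \<in> K"
    and K_iota [simp, intro]: "iota r \<in> K"
    and iota_add: "iota (r + t) = iota r + iota t"
    and iota_mult: "iota (r * t) = iota r * iota t"
    and iota_1 [simp]: "iota 1 = 1"
    and N_iota: "N (iota r) = rat_abs p r"
    and N_nonneg [simp]: "x \<in> K \<Longrightarrow> 0 \<le> N x"
    and N_mult: "x \<in> K \<Longrightarrow> y \<in> K \<Longrightarrow> N (x * y) = N x * N y"
    and N_add_max: "x \<in> K \<Longrightarrow> y \<in> K \<Longrightarrow> N (x + y) \<le> max (N x) (N y)"
    and dense: "x \<in> K \<Longrightarrow> e > 0 \<Longrightarrow> \<exists>r. N (x - iota r) < e"
    and complete: "(\<And>n. X n \<in> K) \<Longrightarrow>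
      (\<And>e. e > 0 \<Longrightarrow> \<exists>M. \<forall>m\<ge>M. \<forall>n\<ge>M. N (X m - X n) < e) \<Longrightarrow>
      \<exists>x\<in>K. (\<lambda>n. N (X n - x)) \<longlonglongrightarrow> 0"
begin

text \<open>With this sign \<open>N x = P v\<close> says that x has valuation v, and larger
  valuations give smaller values.\<close>

abbreviation P :: "int \<Rightarrow> real" where "P v \<equiv> real p powi (- v)"

lemma p_gt_1: "1 < real p"
  using prime_gt_1_nat[OF prime_p] by simp

lemma P_pos [simp]: "0 < P v"
  using p_gt_1 by simp

lemma P_le: "P v \<le> P w \<longleftrightarrow> w \<le> v"
  using powi_le_iff[OF p_gt_1] by simp

lemma P_less: "P v < P w \<longleftrightarrow> w < v"
  using powi_less_iff[OF p_gt_1] by simp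

lemma P_add: "P (v + w) = P v * P w"
  using p_gt_1 by (simp flip: power_int_add)

lemma P_mult_nat: "P (v * int n) = P v ^ n"
  using p_gt_1 by (metis mult_minus_left power_int_mult power_int_of_nat)

lemma ex_P_less: assumes "e > 0" shows "\<exists>E::nat. P (int E) < e"
proof -
  obtain E where "(1 / real p) ^ E < e"
    using real_arch_pow_inv[OF assms, of "1 / real p"] p_gt_1 by auto
  thus ?thesis by (auto simp: power_int_minus power_divide field_simps)
qed

lemma eventually_P_less: "e > 0 \<Longrightarrow> \<forall>\<^sub>F E in sequentially. P (int E) < e"
proof -
  assume "e > 0"
  then obtain E where E: "P (int E) < e" using ex_P_less by blast
  show ?thesis
  proof (rule eventually_sequentiallyI[of E])
    fix E' assume "E \<le> E'"
    hence "P (int E') \<le> P (int E)" unfolding P_le by simp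
    thus "P (int E') < e" using E by linarith
  qed
qed

lemma iota_0 [simp]: "iota 0 = 0"
  using iota_add[of 0 0] by simp

lemma iota_minus: "iota (- r) = - iota r"
  using iota_add[of r "- r"] by (simp add: eq_neg_iff_add_eq_0 add.commute)

lemma iota_diff: "iota (r - t) = iota r - iota t"
  using iota_add[of r "- t"] by (simp add: iota_minus)

lemma iota_power: "iota (r ^ n) = iota r ^ n"
  by (induction n) (auto simp: iota_mult)

lemma iota_of_nat [simp]: "iota (of_nat n) = of_nat n"
  by (induction n) (auto simp: iota_add)

lemma K_0 [simp]: "0 \<in> K" and K_1 [simp]: "1 \<in> K"
  using K_iota[of 0] K_iota[of 1] by (simp_all del: K_iota)

lemma K_of_nat [simp]: "of_nat n \<in> K"
  using K_iota[of "of_nat n"] by (simp del: K_iota)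

lemma K_minus [simp, intro]: "x \<in> K \<Longrightarrow> - x \<in> K"
  using K_mult[OF K_iota[of "- 1"], of x] by (simp only: iota_minus iota_1 mult_minus1)

lemma K_diff [simp, intro]: "x \<in> K \<Longrightarrow> y \<in> K \<Longrightarrow> x - y \<in> K"
  using K_add[of x "- y"] by (simp del: K_add)

lemma K_power [simp, intro]: "x \<in> K \<Longrightarrow> x ^ n \<in> K"
  by (induction n) auto

lemma K_sum [simp, intro]: "(\<And>i. i \<in> A \<Longrightarrow> g i \<in> K) \<Longrightarrow> sum g A \<in> K"
  by (induction A rule: infinite_finite_induct) auto

lemma N_0 [simp]: "N 0 = 0" and N_1 [simp]: "N 1 = 1"
  using N_iota[of 0] N_iota[of 1] by simp_all

lemma N_minus [simp]: "x \<in> K \<Longrightarrow> N (- x) = N x"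
  using N_mult[of "iota (- 1)" x] N_iota[of "- 1"] rat_abs_uminus[OF prime_p, of 1]
  by (simp add: iota_minus)

lemma N_diff_max: "x \<in> K \<Longrightarrow> y \<in> K \<Longrightarrow> N (x - y) \<le> max (N x) (N y)"
  using N_add_max[of x "- y"] by simp

lemma N_commute: "x \<in> K \<Longrightarrow> y \<in> K \<Longrightarrow> N (x - y) = N (y - x)"
  using N_minus[of "x - y"] by simp

lemma N_add_le: "x \<in> K \<Longrightarrow> y \<in> K \<Longrightarrow> N x \<le> e \<Longrightarrow> N y \<le> e \<Longrightarrow> N (x + y) \<le> e"
  using N_add_max[of x y] by linarith

lemma N_diff_le: "x \<in> K \<Longrightarrow> y \<in> K \<Longrightarrow> N x \<le> e \<Longrightarrow> N y \<le> e \<Longrightarrow> N (x - y) \<le> e"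
  using N_diff_max[of x y] by linarith

lemma N_trans: "x \<in> K \<Longrightarrow> y \<in> K \<Longrightarrow> z \<in> K \<Longrightarrow> N (x - y) \<le> e \<Longrightarrow> N (y - z) \<le> e \<Longrightarrow> N (x - z) \<le> e"
  using N_add_le[of "x - y" "y - z" e] by simp

text \<open>In an ultrametric triangle the two longest sides are equal.\<close>

lemma N_eq_of_close: assumes "x \<in> K" "y \<in> K" "N (x - y) < N x" shows "N y = N x"
proof -
  have "N y \<le> max (N x) (N (x - y))" using N_diff_max[of x "x - y"] assms by simp
  moreover have "N x \<le> max (N (x - y)) (N y)" using N_add_max[of "x - y" y] assms by simp
  ultimately show ?thesis using assms(3) by linarith
qed

lemma N_cong: assumes "x \<in> K" "y \<in> K" "N (x - y) = 0" shows "N x = N y"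
proof (cases "N x = 0")
  case True
  thus ?thesis using N_diff_max[of x "x - y"] assms by (simp add: order.antisym)
next
  case False
  thus ?thesis using N_eq_of_close[of x y] assms by (simp add: order_less_le)
qed

lemma N_power: "x \<in> K \<Longrightarrow> N (x ^ n) = N x ^ n"
  by (induction n) (auto simp: N_mult)

lemma N_sum_le:
  assumes "\<And>i. i \<in> A \<Longrightarrow> g i \<in> K" "\<And>i. i \<in> A \<Longrightarrow> N (g i) \<le> e" "e \<ge> 0"
  shows "N (sum g A) \<le> e"
  using assms by (induction A rule: infinite_finite_induct) (auto intro!: N_add_le)

lemma N_of_nat_le_1: "N (of_nat n) \<le> 1"
  by (induction n) (auto intro!: N_add_le)

text \<open>A rational closer to x than \<open>N x\<close> has the same seminorm, so
  \<open>K\<close> takes no values beyond those of the rationals. In particular the values are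
  discrete.\<close>

lemma N_values: assumes "x \<in> K" "N x \<noteq> 0" shows "\<exists>v. N x = P v"
proof -
  obtain r where "N (x - iota r) < N x" using dense[of x "N x"] assms N_nonneg[of x] by (metis order_less_le)
  hence "N (iota r) = N x" using N_eq_of_close[of x "iota r"] assms by simp
  hence "N x = P (rat_val p r)" using assms(2) by (auto simp: N_iota rat_abs_def split: if_splits)
  thus ?thesis ..
qed

lemma N_of_nat_diff_le:
  "N (of_nat a - of_nat b) \<le> P (int E) \<longleftrightarrow> [a = b] (mod (p ^ E))"
proof -
  have "(of_nat a - of_nat b :: 'a) = iota (of_int (int a - int b))"
    by (simp add: iota_diff)
  hence "N (of_nat a - of_nat b) \<le> P (int E) \<longleftrightarrow> int p ^ E dvd int a - int b"
    by (simp only: N_iota rat_abs_of_int_le[OF prime_p])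
  also have "\<dots> \<longleftrightarrow> [a = b] (mod (p ^ E))"
    by (metis cong_iff_dvd_diff cong_int_iff of_nat_power)
  finally show ?thesis .
qed

lemma N_of_nat_le: "N (of_nat a) \<le> P (int E) \<longleftrightarrow> p ^ E dvd a"
  using N_of_nat_diff_le[of a 0 E] by (simp add: cong_0_iff)

lemma N_of_nat_p: "N (of_nat p) = P 1"
  using N_iota[of "of_nat p"] rat_abs_prime[OF prime_p] by simp

lemma N_of_nat_eq: "g > 0 \<Longrightarrow> N (of_nat g) = P (int (multiplicity (int p) (int g)))"
  using N_iota[of "of_nat g"] rat_val_divide[OF prime_p, of "int g" 1] by (simp add: rat_abs_def)

lemma N_of_nat_diff_0: "N (of_nat m - of_nat n) = 0 \<longleftrightarrow> m = n"
  using N_iota[of "of_nat m - of_nat n"] rat_abs_eq_0[OF prime_p, of "of_nat m - of_nat n"]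
  by (simp add: iota_diff)

section \<open>The unit ball and its approximation by natural numbers\<close>

definition integers :: "'a set" where "integers = {x \<in> K. N x \<le> 1}"

lemma integersD: "x \<in> integers \<Longrightarrow> x \<in> K"
  and integers_N: "x \<in> integers \<Longrightarrow> N x \<le> 1"
  by (auto simp: integers_def)

lemma integers_mult [intro]: "x \<in> integers \<Longrightarrow> y \<in> integers \<Longrightarrow> x * y \<in> integers"
  by (auto simp: integers_def N_mult mult_le_one)

lemma integers_power [intro]: "x \<in> integers \<Longrightarrow> x ^ n \<in> integers"
  by (auto simp: integers_def N_power power_le_one)

lemma integers_add [intro]: "x \<in> integers \<Longrightarrow> y \<in> integers \<Longrightarrow> x + y \<in> integers"
  by (auto simp: integers_def intro: N_add_le)

lemma integers_diff [intro]: "x \<in> integers \<Longrightarrow> y \<in> integers \<Longrightarrow> x - y \<in> integers"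
  by (auto simp: integers_def intro: N_diff_le)

lemma integers_of_nat [simp]: "of_nat n \<in> integers"
  by (auto simp: integers_def N_of_nat_le_1)

lemma integersI: "x \<in> K \<Longrightarrow> N x \<le> 1 \<Longrightarrow> x \<in> integers"
  unfolding integers_def by blast

declare integersD [simp, intro]

lemma ex_nat_approx:
  assumes "x \<in> integers" shows "\<exists>n. N (x - of_nat n) \<le> P (int E)"
proof -
  have x: "x \<in> K" "N x \<le> 1" using integersD[OF assms] integers_N[OF assms] .
  obtain r where r: "N (x - iota r) < P (int E)" using dense[OF x(1), of "P (int E)"] by auto
  have "N (iota r) \<le> 1"
    using N_diff_le[of x "x - iota r" 1] x r P_le[of "int E" 0] by simp
  then obtain n where "rat_abs p (r - of_nat n) \<le> P (int E)"
    using rat_approx_nat[OF prime_p, of r E] by (auto simp: N_iota)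
  hence "N (iota r - of_nat n) \<le> P (int E)" using N_iota[of "r - of_nat n"] by (simp add: iota_diff)
  thus ?thesis using N_trans[of x "iota r" "of_nat n"] r x by (auto intro!: exI[of _ n])
qed

lemma ex_nat_approx_below:
  assumes "x \<in> integers" shows "\<exists>n < p ^ E. N (x - of_nat n) \<le> P (int E)"
proof -
  obtain n where n: "N (x - of_nat n) \<le> P (int E)" using ex_nat_approx[OF assms] by blast
  have "N (of_nat n - of_nat (n mod p ^ E)) \<le> P (int E)"
    unfolding N_of_nat_diff_le by (simp add: cong_def)
  hence "N (x - of_nat (n mod p ^ E)) \<le> P (int E)"
    using N_trans[of x "of_nat n" "of_nat (n mod p ^ E)"] n assms by auto
  thus ?thesis using prime_gt_0_nat[OF prime_p] by (intro exI[of _ "n mod p ^ E"]) simp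
qed

lemma tendsto_unique_N:
  assumes "\<And>n. X n \<in> K" "x \<in> K" "y \<in> K" "(\<lambda>n. N (X n - x)) \<longlonglongrightarrow> 0" "(\<lambda>n. N (X n - y)) \<longlonglongrightarrow> 0"
  shows "N (x - y) = 0"
proof -
  have "(\<lambda>n. max (N (X n - x)) (N (X n - y))) \<longlonglongrightarrow> max 0 0"
    using assms by (intro tendsto_max)
  moreover have "N (x - y) \<le> max (N (X n - x)) (N (X n - y))" for n
    using N_diff_max[of "X n - y" "X n - x"] assms by (simp add: max.commute)
  ultimately have "N (x - y) \<le> 0" by (intro LIMSEQ_le_const[of _ 0 "N (x - y)"]) auto
  thus ?thesis using assms by (simp add: order.antisym)
qed

lemma limit_N_le:
  assumes "\<And>n. X n \<in> K" "x \<in> K" "(\<lambda>n. N (X n - x)) \<longlonglongrightarrow> 0" "\<forall>\<^sub>F n in sequentially. N (X n) \<le> e"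
  shows "N x \<le> e"
proof -
  have "(\<lambda>n. max (N (X n - x)) e) \<longlonglongrightarrow> max 0 e"
    using assms by (intro tendsto_max) auto
  moreover have "\<forall>\<^sub>F n in sequentially. N x \<le> max (N (X n - x)) e"
    using assms(4)
  proof eventually_elim
    case (elim n)
    thus ?case using N_diff_max[of "X n" "X n - x"] assms(1,2) by (auto simp: max_def split: if_splits)
  qed
  ultimately have "N x \<le> max 0 e" by (intro tendsto_lowerbound) auto
  moreover have "\<exists>n. N (X n) \<le> e" using assms(4) eventually_happens' sequentially_bot by blast
  hence "0 \<le> e" using assms(1) N_nonneg by (meson order.trans)
  ultimately show ?thesis by simp
qed

end

section \<open>Analytic functions and division by roots\<close>

context padic
begin

lemma null_sandwich:
  assumes "B \<longlonglongrightarrow> 0" "\<And>n. X n \<in> K" "\<And>n. N (X n) \<le> B n"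
  shows "(\<lambda>n. N (X n)) \<longlonglongrightarrow> 0"
  by (rule tendsto_sandwich[of "\<lambda>_. 0" _ _ B]) (use assms in simp_all)

lemma null_max: "A \<longlonglongrightarrow> 0 \<Longrightarrow> B \<longlonglongrightarrow> 0 \<Longrightarrow> (\<lambda>n. max (A n) (B n)) \<longlonglongrightarrow> (0::real)"
  using tendsto_max[of A 0 sequentially B 0] by simp

text \<open>Since the values are discrete, a strict inequality gains a full factor p. Such a gap
  survives a passage to the limit, which strictness alone does not.\<close>

lemma P_succ: "N x = P v \<Longrightarrow> y \<in> K \<Longrightarrow> N y < N x \<Longrightarrow> N y \<le> P (v + 1)"
proof (cases "N y = 0")
  case False
  assume "N x = P v" "y \<in> K" "N y < N x"
  moreover obtain w where "N y = P w" using N_values[of y] False \<open>y \<in> K\<close> by blast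
  ultimately have "v + 1 \<le> w" by (simp add: P_less)
  thus ?thesis unfolding \<open>N y = P w\<close> P_le .
qed simp

text \<open>In an ultrametric ring it suffices that the terms tend to zero: a block of late terms is
  no larger than its largest term.\<close>

lemma ex_series_limit:
  assumes "\<And>k. c k \<in> K" "(\<lambda>k. N (c k)) \<longlonglongrightarrow> 0"
  shows "\<exists>s\<in>K. (\<lambda>n. N ((\<Sum>k<n. c k) - s)) \<longlonglongrightarrow> 0"
proof (rule complete)
  fix e :: real assume "e > 0"
  then obtain M where M: "\<And>k. k \<ge> M \<Longrightarrow> N (c k) < e / 2"
    using LIMSEQ_D[OF assms(2), of "e / 2"] assms(1) by auto
  have *: "N ((\<Sum>k<n. c k) - (\<Sum>k<m. c k)) < e" if "M \<le> m" "m \<le> n" for m n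
  proof -
    have "(\<Sum>k<n. c k) - (\<Sum>k<m. c k) = (\<Sum>k=m..<n. c k)"
      using that sum_diff_nat_ivl[of 0 m n c] by (simp add: lessThan_atLeast0)
    also have "N \<dots> \<le> e / 2"
      using that \<open>e > 0\<close> by (intro N_sum_le assms(1) less_imp_le[OF M]) auto
    finally show ?thesis using \<open>e > 0\<close> by simp
  qed
  show "\<exists>M. \<forall>m\<ge>M. \<forall>n\<ge>M. N ((\<Sum>k<m. c k) - (\<Sum>k<n. c k)) < e"
  proof (intro exI[of _ M] allI impI)
    fix m n assume "M \<le> m" "M \<le> n"
    thus "N ((\<Sum>k<m. c k) - (\<Sum>k<n. c k)) < e"
      using *[of m n] *[of n m] N_commute[of "\<Sum>k<m. c k" "\<Sum>k<n. c k"] assms(1)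
      by (cases "m \<le> n") auto
  qed
qed (use assms in auto)

text \<open>The sum is determined only up to seminorm zero, hence the choice.\<close>

definition limsum :: "(nat \<Rightarrow> 'a) \<Rightarrow> 'a" where
  "limsum c = (SOME s. s \<in> K \<and> (\<lambda>n. N ((\<Sum>k<n. c k) - s)) \<longlonglongrightarrow> 0)"

lemma limsum:
  assumes "\<And>k. c k \<in> K" "(\<lambda>k. N (c k)) \<longlonglongrightarrow> 0"
  shows "limsum c \<in> K" "(\<lambda>n. N ((\<Sum>k<n. c k) - limsum c)) \<longlonglongrightarrow> 0"
  using someI_ex[of "\<lambda>s. s \<in> K \<and> (\<lambda>n. N ((\<Sum>k<n. c k) - s)) \<longlonglongrightarrow> 0"] ex_series_limit[OF assms]
  unfolding limsum_def by auto

lemma K_series [simp]: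
  assumes "\<And>k. a k \<in> K" "x \<in> integers" shows "(\<Sum>k<n. a k * x ^ k) \<in> K"
  by (intro K_sum K_mult K_power integersD assms)

lemma series_limit_N_le:
  assumes "\<And>k. c k \<in> K" "s \<in> K" "(\<lambda>n. N ((\<Sum>k<n. c k) - s)) \<longlonglongrightarrow> 0" "\<And>k. N (c k) \<le> e"
  shows "N s \<le> e"
proof -
  have "e \<ge> 0" using assms(4)[of 0] N_nonneg[OF assms(1)[of 0]] by linarith
  show ?thesis
    by (rule limit_N_le[OF _ assms(2,3)]) (intro K_sum always_eventually allI N_sum_le assms \<open>e \<ge> 0\<close>)+
qed

text \<open>The coefficients are a parameter because the index of Strassmann is read off from them.
  The values of F are fixed only up to seminorm zero; that F respects classes is a consequence of
  the Lipschitz bound.\<close>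

definition analytic_with :: "(nat \<Rightarrow> 'a) \<Rightarrow> ('a \<Rightarrow> 'a) \<Rightarrow> bool" where
  "analytic_with a F \<longleftrightarrow> (\<forall>k. a k \<in> K) \<and>
     (\<forall>x\<in>integers. F x \<in> K \<and> (\<lambda>n. N ((\<Sum>k<n. a k * x ^ k) - F x)) \<longlonglongrightarrow> 0)"

lemma analytic_withD:
  assumes "analytic_with a F"
  shows "a k \<in> K" "x \<in> integers \<Longrightarrow> F x \<in> K"
    "x \<in> integers \<Longrightarrow> (\<lambda>n. N ((\<Sum>k<n. a k * x ^ k) - F x)) \<longlonglongrightarrow> 0"
  using assms by (auto simp: analytic_with_def)

lemma N_coeff_mult_le: "c \<in> K \<Longrightarrow> x \<in> integers \<Longrightarrow> N (c * x ^ k) \<le> N c"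
  using integers_power[of x k] by (auto simp: N_mult integersD integers_N intro: mult_right_le_one_le)

text \<open>Convergence at x = 1 forces this: there the coefficients are differences of consecutive
  partial sums.\<close>

lemma analytic_coeff_null:
  assumes "analytic_with a F" shows "(\<lambda>k. N (a k)) \<longlonglongrightarrow> 0"
proof -
  note A = analytic_withD[OF assms]
  have 1: "(1 :: 'a) \<in> integers" using integers_of_nat[of 1] by simp
  define S where "S = (\<lambda>n. (\<Sum>k<n. a k) - F 1)"
  have SK: "S n \<in> K" for n unfolding S_def by (intro K_diff K_sum A 1)
  have S: "(\<lambda>n. N (S n)) \<longlonglongrightarrow> 0" using A(3)[OF 1] by (simp only: S_def power_one mult_1_right)
  hence lim: "(\<lambda>n. max (N (S (Suc n))) (N (S n))) \<longlonglongrightarrow> 0"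
    by (intro null_max LIMSEQ_Suc)
  have "N (a n) \<le> max (N (S (Suc n))) (N (S n))" for n
    using N_diff_max[OF SK SK, of "Suc n" n] by (simp add: S_def)
  thus ?thesis by (rule null_sandwich[OF lim A(1)])
qed

lemma null_imp_bounded:
  assumes "\<And>k. c k \<in> K" "(\<lambda>k. N (c k)) \<longlonglongrightarrow> 0" shows "\<exists>C>0. \<forall>k. N (c k) \<le> C"
proof -
  have "Bseq (\<lambda>k. N (c k))" using assms(2) by (intro convergent_imp_Bseq convergentI)
  then obtain C where "C > 0" "\<forall>k. norm (N (c k)) \<le> C" by (auto simp: Bseq_def)
  thus ?thesis using assms(1) by (auto intro!: exI[of _ C])
qed

text \<open>The difference x^k - y^k is x - y times an integral element. So each partial sum obeys
  the estimate with C a bound for the coefficients, and the estimate passes to the limit.\<close>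

lemma analytic_Lipschitz:
  assumes "analytic_with a F"
  shows "\<exists>C>0. \<forall>x\<in>integers. \<forall>y\<in>integers. N (F x - F y) \<le> C * N (x - y)"
proof -
  note A = analytic_withD[OF assms]
  obtain C where C: "C > 0" "\<And>k. N (a k) \<le> C"
    using null_imp_bounded[OF A(1) analytic_coeff_null[OF assms]] by blast
  have "N (F x - F y) \<le> C * N (x - y)" if x: "x \<in> integers" and y: "y \<in> integers" for x y
  proof (rule limit_N_le)
    let ?S = "\<lambda>x n. \<Sum>k<n. a k * x ^ k"
    show S: "?S x n - ?S y n \<in> K" for n using A(1) x y by auto
    show "F x - F y \<in> K" using A(2) x y by auto
    have lim: "(\<lambda>n. max (N (?S x n - F x)) (N (?S y n - F y))) \<longlonglongrightarrow> 0"
      by (intro null_max A(3) x y)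
    have "N (?S x n - ?S y n - (F x - F y)) \<le> max (N (?S x n - F x)) (N (?S y n - F y))" for n
    proof -
      have "?S x n - ?S y n - (F x - F y) = (?S x n - F x) - (?S y n - F y)" by simp
      thus ?thesis using N_diff_max[of "?S x n - F x" "?S y n - F y"] A(1,2) x y
        by (simp only: K_diff K_series)
    qed
    thus "(\<lambda>n. N (?S x n - ?S y n - (F x - F y))) \<longlonglongrightarrow> 0"
      by (intro null_sandwich[OF lim]) (use A(1,2) x y in simp_all)
    have "N (?S x n - ?S y n) \<le> C * N (x - y)" for n
    proof -
      have "?S x n - ?S y n = (\<Sum>k<n. a k * (x ^ k - y ^ k))"
        by (simp add: sum_subtractf right_diff_distrib)
      also have "N \<dots> \<le> C * N (x - y)"
      proof (rule N_sum_le)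
        fix k
        define z where "z = (\<Sum>i<k. y ^ (k - Suc i) * x ^ i)"
        have "z \<in> K" unfolding z_def by (intro K_sum K_mult K_power integersD x y)
        moreover have "N z \<le> 1" unfolding z_def
          by (intro N_sum_le integers_N integersD integers_mult integers_power x y) simp
        moreover have "x ^ k - y ^ k = (x - y) * z" by (simp add: z_def power_diff_sumr2)
        ultimately have "N (x ^ k - y ^ k) \<le> N (x - y)" using x y
          by (auto simp: N_mult integersD intro: mult_right_le_one_le)
        moreover have "N (a k * (x ^ k - y ^ k)) = N (a k) * N (x ^ k - y ^ k)"
          using A(1) x y by (intro N_mult) auto
        ultimately show "N (a k * (x ^ k - y ^ k)) \<le> C * N (x - y)"
          using C x y by (simp add: mult_mono integersD)
      qed (use A(1) x y C in \<open>auto simp: integersD\<close>)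
      finally show ?thesis .
    qed
    thus "\<forall>\<^sub>F n in sequentially. N (?S x n - ?S y n) \<le> C * N (x - y)" by simp
  qed
  thus ?thesis using C(1) by blast
qed

section \<open>Strassmann's theorem and the factorization at a root\<close>

text \<open>The index in Strassmann's theorem; dividing by a root lowers it by one.\<close>

definition strassmann_index :: "(nat \<Rightarrow> 'a) \<Rightarrow> nat \<Rightarrow> bool" where
  "strassmann_index a M \<longleftrightarrow> N (a M) \<noteq> 0 \<and> (\<forall>k. N (a k) \<le> N (a M)) \<and> (\<forall>k>M. N (a k) < N (a M))"

text \<open>If all coefficients had seminorm zero, so would every value of F. Otherwise only
  finitely many reach a fixed positive level, as they tend to zero, and the last one of maximal
  seminorm is the index.\<close>

lemma ex_strassmann_index:
  assumes "analytic_with a F" "x \<in> integers" "N (F x) \<noteq> 0"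
  shows "\<exists>M. strassmann_index a M"
proof -
  note A = analytic_withD[OF assms(1)]
  obtain k0 where k0: "N (a k0) \<noteq> 0"
  proof (rule ccontr)
    assume "\<not> thesis"
    with that have "N (a k) = 0" for k by blast
    hence "N (F x) \<le> 0" using A(1,2) assms(2)
      by (intro series_limit_N_le[OF _ _ A(3)[OF assms(2)]]) (auto simp: N_mult integersD)
    thus False using assms(2,3) A(2)[OF assms(2)] N_nonneg order.antisym by blast
  qed
  have k0p: "N (a k0) > 0" using k0 A(1) by (simp add: order_less_le)
  define S where "S = {k. N (a k) \<ge> N (a k0)}"
  obtain m where m: "\<And>k. k \<ge> m \<Longrightarrow> N (a k) < N (a k0)"
    using LIMSEQ_D[OF analytic_coeff_null[OF assms(1)] k0p] A(1) by auto
  have "S \<subseteq> {..<m}" using m by (force simp: S_def not_le[symmetric])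
  hence fin: "finite S" using finite_subset by blast
  define v where "v = Max ((\<lambda>k. N (a k)) ` S)"
  define T where "T = {k\<in>S. N (a k) = v}"
  have "k0 \<in> S" by (simp add: S_def)
  hence "v \<in> (\<lambda>k. N (a k)) ` S" unfolding v_def using fin by (intro Max_in) auto
  hence "T \<noteq> {}" by (auto simp: T_def)
  moreover have finT: "finite T" using fin by (simp add: T_def)
  ultimately have M: "Max T \<in> T" by (intro Max_in)
  have le: "N (a k) \<le> v" if "k \<in> S" for k unfolding v_def using fin that by simp
  have "v > 0" "v \<ge> N (a k0)" using le[OF \<open>k0 \<in> S\<close>] k0p by auto
  have le': "N (a k) \<le> v" for k using le[of k] \<open>v \<ge> N (a k0)\<close> by (cases "k \<in> S") (auto simp: S_def)
  have "N (a k) < v" if "k > Max T" for k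
  proof -
    have "k \<notin> T" using that finT Max_ge leD by blast
    hence "N (a k) \<noteq> v" using \<open>v \<ge> N (a k0)\<close> by (auto simp: T_def S_def)
    thus ?thesis using le'[of k] by simp
  qed
  thus ?thesis using M le' \<open>v > 0\<close> unfolding strassmann_index_def T_def
    by (intro exI[of _ "Max T"]) (auto simp: T_def)
qed

text \<open>Horner's scheme for a power series: the quotient has the coefficients b_j = sum over i
  of a_(j+1+i) \<theta>^i, so that b_(n-1) = a_n + \<theta> b_n. The index drops by exactly one
  because b_j with j \<ge> M involves only coefficients beyond a_M, all strictly smaller than
  a_M.\<close>

lemma divide_root:
  assumes "analytic_with a F" "strassmann_index a M" "\<theta> \<in> integers" "N (F \<theta>) = 0"
  obtains b G where "analytic_with b G" "M > 0" "strassmann_index b (M - 1)"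
    "\<And>x. x \<in> integers \<Longrightarrow> N (F x - (x - \<theta>) * G x) = 0"
proof -
  note A = analytic_withD[OF assms(1)]
  note null = analytic_coeff_null[OF assms(1)]
  have thK [simp]: "\<theta> \<in> K" using assms(3) by auto
  define b where "b = (\<lambda>j. limsum (\<lambda>i. a (Suc j + i) * \<theta> ^ i))"
  have trm: "a (Suc j + i) * \<theta> ^ i \<in> K" for i j using A(1) by auto
  have term0: "(\<lambda>i. N (a (Suc j + i) * \<theta> ^ i)) \<longlonglongrightarrow> 0" for j
  proof (rule null_sandwich[OF LIMSEQ_ignore_initial_segment[OF null, of "Suc j"] trm])
    show "N (a (Suc j + i) * \<theta> ^ i) \<le> N (a (i + Suc j))" for i
      using N_coeff_mult_le[OF A(1) assms(3)] by (simp add: add.commute)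
  qed
  have bK [simp]: "b j \<in> K" and blim: "(\<lambda>n. N ((\<Sum>i<n. a (Suc j + i) * \<theta> ^ i) - b j)) \<longlonglongrightarrow> 0" for j
    using limsum[OF trm term0, of j] by (auto simp: b_def)
  have b_le: "N (b j) \<le> e" if "\<And>k. k > j \<Longrightarrow> N (a k) \<le> e" for j e
    using that by (intro series_limit_N_le[OF trm bK blim] order.trans[OF N_coeff_mult_le[OF A(1) assms(3)]]) auto
  have bnull: "(\<lambda>j. N (b j)) \<longlonglongrightarrow> 0"
  proof (rule LIMSEQ_I)
    fix e :: real assume "e > 0"
    then obtain m where m: "\<And>k. k \<ge> m \<Longrightarrow> N (a k) < e / 2"
      using LIMSEQ_D[OF null, of "e / 2"] A(1) by auto
    have "N (b j) \<le> e / 2" if "j \<ge> m" for j using that m by (intro b_le) (auto intro: less_imp_le)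
    thus "\<exists>m. \<forall>j\<ge>m. norm (N (b j) - 0) < e" using \<open>e > 0\<close> by (intro exI[of _ m]) force
  qed
  \<comment> \<open>The coefficients of x G(x): those of G moved up by one place, with 0 in
    front.\<close>
  define b' where "b' = (\<lambda>n. case n of 0 \<Rightarrow> 0 | Suc j \<Rightarrow> b j)"
  have b'K: "b' j \<in> K" for j by (auto simp: b'_def split: nat.splits)
  \<comment> \<open>The defect of the Horner recurrence. It has seminorm zero but may differ from 0,
    the b_j being chosen limits. For n = 0 its vanishing is the assumption on F(\<theta>).\<close>
  define eps where "eps = (\<lambda>n. b' n - a n - \<theta> * b n)"
  have epsK: "eps n \<in> K" for n using A(1) b'K by (auto simp: eps_def)
  have shift: "(\<lambda>m. N ((\<Sum>i<m. a (n + i) * \<theta> ^ i) - (a n + \<theta> * b n))) \<longlonglongrightarrow> 0" for n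
  proof -
    have eq: "(\<Sum>i<Suc m. a (n + i) * \<theta> ^ i) - (a n + \<theta> * b n)
        = \<theta> * ((\<Sum>i<m. a (Suc n + i) * \<theta> ^ i) - b n)" for m
      unfolding sum.lessThan_Suc_shift by (simp add: algebra_simps sum_distrib_left)
    have "N ((\<Sum>i<Suc m. a (n + i) * \<theta> ^ i) - (a n + \<theta> * b n))
        \<le> N ((\<Sum>i<m. a (Suc n + i) * \<theta> ^ i) - b n)" for m
      unfolding eq using trm[of n] integers_N[OF assms(3)] A(1)
      by (subst N_mult) (auto intro!: mult_left_le_one_le)
    hence "(\<lambda>m. N ((\<Sum>i<Suc m. a (n + i) * \<theta> ^ i) - (a n + \<theta> * b n))) \<longlonglongrightarrow> 0"
      by (intro null_sandwich[OF blim[of n]]) (use A(1) in auto)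
    thus ?thesis by (rule LIMSEQ_imp_Suc)
  qed
  have eps0: "N (eps n) = 0" for n
  proof (cases n)
    case 0
    have "N (F \<theta> - (a 0 + \<theta> * b 0)) = 0"
      using A(2) A(3)[OF assms(3)] shift[of 0] assms(3) A(1)
      by (intro tendsto_unique_N[of "\<lambda>m. \<Sum>i<m. a i * \<theta> ^ i"]) auto
    hence "N (a 0 + \<theta> * b 0) = 0" using N_cong[of "F \<theta>" "a 0 + \<theta> * b 0"] A(1,2) assms(3,4) by auto
    moreover have "eps n = - (a 0 + \<theta> * b 0)" by (simp add: eps_def 0 b'_def)
    ultimately show ?thesis using N_minus[of "a 0 + \<theta> * b 0"] A(1) by auto
  next
    case (Suc j)
    have "N (b j - (a n + \<theta> * b n)) = 0"
      using blim[of j] shift[of n] A(1) unfolding Suc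
      by (intro tendsto_unique_N[of "\<lambda>m. \<Sum>i<m. a (Suc j + i) * \<theta> ^ i"]) auto
    thus ?thesis by (simp add: eps_def Suc b'_def algebra_simps)
  qed
  have prod_term0: "(\<lambda>k. N (b k * x ^ k)) \<longlonglongrightarrow> 0" if "x \<in> integers" for x
    by (rule null_sandwich[OF bnull]) (use N_coeff_mult_le[OF bK that] that in auto)
  define G where "G = (\<lambda>x. limsum (\<lambda>k. b k * x ^ k))"
  have G: "G x \<in> K" "(\<lambda>n. N ((\<Sum>k<n. b k * x ^ k) - G x)) \<longlonglongrightarrow> 0" if "x \<in> integers" for x
    using limsum[OF _ prod_term0[OF that]] that by (auto simp: G_def)
  have anG: "analytic_with b G" using G by (auto simp: analytic_with_def)
  have FG: "N (F x - (x - \<theta>) * G x) = 0" if x: "x \<in> integers" for x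
  proof (rule tendsto_unique_N)
    have xK [simp]: "x \<in> K" using x by auto
    let ?S = "\<lambda>n. (x - \<theta>) * (\<Sum>j<n. b j * x ^ j)"
    \<comment> \<open>Multiplying out telescopes. The boundary term b'_n x^n tends to zero and the
      sum of the defects has seminorm zero.\<close>
    have id: "?S n = b' n * x ^ n + (\<Sum>j<n. a j * x ^ j) + (\<Sum>j<n. eps j * x ^ j)" for n
    proof (induction n)
      case (Suc n)
      have "b' (Suc n) = b n" by (simp add: b'_def)
      moreover have "b' n = eps n + a n + \<theta> * b n" by (simp add: eps_def)
      ultimately show ?case using Suc by (simp add: algebra_simps)
    qed (simp add: b'_def)
    have id': "?S n - (\<Sum>j<n. a j * x ^ j) = b' n * x ^ n + (\<Sum>j<n. eps j * x ^ j)" for n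
      unfolding id by simp
    show SK: "?S n \<in> K" for n by auto
    show "F x \<in> K" "(x - \<theta>) * G x \<in> K" using A(2) G x by auto
    have "N (\<Sum>j<n. eps j * x ^ j) \<le> 0" for n
      using epsK eps0 by (intro N_sum_le) (auto simp: N_mult)
    hence 0: "N (?S n - (\<Sum>j<n. a j * x ^ j)) \<le> N (b' n)" for n
      unfolding id' using N_coeff_mult_le[OF b'K x, of n n] b'K epsK
      by (intro N_add_le) (auto intro: order.trans[of _ 0])
    have 1: "N (?S n - F x) \<le> max (N (b' n)) (N ((\<Sum>j<n. a j * x ^ j) - F x))" for n
    proof -
      let ?T = "\<Sum>j<n. a j * x ^ j"
      have "N ((?S n - ?T) + (?T - F x)) \<le> max (N (?S n - ?T)) (N (?T - F x))"
        by (intro N_add_max K_diff SK K_series A(1) A(2) x)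
      also have "\<dots> \<le> max (N (b' n)) (N (?T - F x))" by (intro max.mono 0 order.refl)
      also have "(?S n - ?T) + (?T - F x) = ?S n - F x" by simp
      finally show ?thesis .
    qed
    have "(\<lambda>n. N (b' (Suc n))) \<longlonglongrightarrow> 0" using bnull by (simp add: b'_def)
    hence "(\<lambda>n. N (b' n)) \<longlonglongrightarrow> 0" by (rule LIMSEQ_imp_Suc)
    hence "(\<lambda>n. max (N (b' n)) (N ((\<Sum>j<n. a j * x ^ j) - F x))) \<longlonglongrightarrow> 0"
      by (rule null_max[OF _ A(3)[OF x]])
    thus "(\<lambda>n. N (?S n - F x)) \<longlonglongrightarrow> 0"
      by (rule null_sandwich) (intro K_diff SK A(2) x 1)+
    have "(\<lambda>n. N (x - \<theta>) * N ((\<Sum>j<n. b j * x ^ j) - G x)) \<longlonglongrightarrow> N (x - \<theta>) * 0"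
      using G(2)[OF x] by (intro tendsto_mult tendsto_const)
    moreover have "N (?S n - (x - \<theta>) * G x) = N (x - \<theta>) * N ((\<Sum>j<n. b j * x ^ j) - G x)" for n
      using N_mult[of "x - \<theta>" "(\<Sum>j<n. b j * x ^ j) - G x"] G(1)[OF x]
      by (simp add: right_diff_distrib[of "x - \<theta>" "\<Sum>j<n. b j * x ^ j" "G x"])
    ultimately show "(\<lambda>n. N (?S n - (x - \<theta>) * G x)) \<longlonglongrightarrow> 0" by (simp only: mult_zero_right)
  qed
  have M: "N (a M) \<noteq> 0" "\<And>k. N (a k) \<le> N (a M)" "\<And>k. k > M \<Longrightarrow> N (a k) < N (a M)"
    using assms(2) by (auto simp: strassmann_index_def)
  obtain v where v: "N (a M) = P v" using N_values[OF A(1) M(1)] by blast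
  \<comment> \<open>\<open>b_le\<close> yields nonstrict bounds only; the gap from
    \<open>P_succ\<close> restores strictness.\<close>
  have bM: "N (b M) < N (a M)"
  proof -
    have "N (b M) \<le> P (v + 1)" using M(3) A(1) by (intro b_le P_succ[OF v]) auto
    also have "\<dots> < P v" unfolding P_less by simp
    finally show ?thesis by (simp add: v)
  qed
  have bM': "N (b' M) = N (a M)"
  proof (rule N_eq_of_close)
    have "a M - b' M = - (\<theta> * b M) - eps M" by (simp add: eps_def)
    also have "N \<dots> \<le> N (b M)"
    proof (rule N_diff_le)
      have "N (- (\<theta> * b M)) = N \<theta> * N (b M)" by (simp add: N_mult)
      thus "N (- (\<theta> * b M)) \<le> N (b M)" using integers_N[OF assms(3)] by (simp add: mult_left_le_one_le)
    qed (use epsK eps0 in simp_all)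
    finally show "N (a M - b' M) < N (a M)" using bM by simp
  qed (use A(1) b'K in auto)
  \<comment> \<open>For M = 0 the value \<open>b' 0\<close>, which is 0, would have the nonzero
    seminorm of a_0. So index 0 excludes roots, which starts the inductions below.\<close>
  hence M0: "M > 0" using M(1) by (cases M) (auto simp: b'_def)
  hence bM1: "N (b (M - 1)) = N (a M)" using bM' by (cases M) (auto simp: b'_def)
  have "N (b k) < N (a M)" if "k > M - 1" for k
  proof -
    have "N (b k) \<le> P (v + 1)" using M(3) A(1) that M0 by (intro b_le P_succ[OF v]) auto
    also have "\<dots> < P v" unfolding P_less by simp
    finally show ?thesis by (simp add: v)
  qed
  moreover have "N (b k) \<le> N (a M)" for k using M(2) by (intro b_le)
  ultimately have "strassmann_index b (M - 1)" using bM1 M(1) by (auto simp: strassmann_index_def)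
  thus thesis using that[OF anG M0 _ FG] by blast
qed

text \<open>The factor x - \<theta> is split off repeatedly. Each division lowers the Strassmann
  index, so after finitely many steps the cofactor no longer vanishes at \<theta>.\<close>

lemma factor_root:
  assumes "analytic_with a F" "strassmann_index a M" "\<theta> \<in> integers" "N (F \<theta>) = 0"
  obtains m b G where "analytic_with b G" "m > 0" "N (G \<theta>) \<noteq> 0"
    "\<And>x. x \<in> integers \<Longrightarrow> N (F x - (x - \<theta>) ^ m * G x) = 0"
  using assms
proof (induction M arbitrary: a F thesis)
  case (0 a F)
  show ?case using divide_root[OF 0(2,3,4,5)] by (metis less_irrefl)
next
  case (Suc M a F)
  obtain b G where G: "analytic_with b G" "strassmann_index b M"
    "\<And>x. x \<in> integers \<Longrightarrow> N (F x - (x - \<theta>) * G x) = 0"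
    using divide_root[OF Suc(3,4,5,6)] by (metis diff_Suc_1)
  show ?case
  proof (cases "N (G \<theta>) = 0")
    case False
    show ?thesis using G by (intro Suc(2)[of b G 1] False) auto
  next
    case True
    obtain c H m where H: "analytic_with c H" "m > 0" "N (H \<theta>) \<noteq> 0"
      "\<And>x. x \<in> integers \<Longrightarrow> N (G x - (x - \<theta>) ^ m * H x) = 0"
      using Suc(1)[OF _ G(1,2) Suc(5) True] by metis
    have "N (F x - (x - \<theta>) ^ Suc m * H x) = 0" if x: "x \<in> integers" for x
    proof -
      note K = analytic_withD(2)[OF Suc(3) x] analytic_withD(2)[OF G(1) x] analytic_withD(2)[OF H(1) x]
        integersD[OF x] integersD[OF Suc(5)]
      have "F x - (x - \<theta>) ^ Suc m * H x
          = (F x - (x - \<theta>) * G x) + (x - \<theta>) * (G x - (x - \<theta>) ^ m * H x)"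
        by (simp add: algebra_simps)
      also have "N \<dots> \<le> 0" using G(3)[OF x] H(4)[OF x] K by (intro N_add_le) (auto simp: N_mult)
      finally show ?thesis using K by (simp add: order.antisym)
    qed
    thus ?thesis using H by (intro Suc(2)[of c H "Suc m"]) auto
  qed
qed

text \<open>Strassmann's theorem: after division by one root the others are roots of a quotient of
  smaller index, and index 0 admits none. Roots are counted up to seminorm zero.\<close>

lemma finite_roots:
  assumes "analytic_with a F" "strassmann_index a M"
  shows "\<exists>R. finite R \<and> R \<subseteq> integers \<and> (\<forall>x\<in>integers. N (F x) = 0 \<longrightarrow> (\<exists>\<theta>\<in>R. N (x - \<theta>) = 0))"
  using assms
proof (induction M arbitrary: a F)
  case (0 a F)
  have "N (F x) \<noteq> 0" if "x \<in> integers" for x using divide_root[OF 0 that] by (metis less_irrefl)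
  thus ?case by blast
next
  case (Suc M a F)
  show ?case
  proof (cases "\<exists>\<theta>\<in>integers. N (F \<theta>) = 0")
    case True
    then obtain \<theta> where th: "\<theta> \<in> integers" "N (F \<theta>) = 0" by blast
    obtain b G where G: "analytic_with b G" "strassmann_index b M"
      "\<And>x. x \<in> integers \<Longrightarrow> N (F x - (x - \<theta>) * G x) = 0"
      using divide_root[OF Suc(2,3) th] by (metis diff_Suc_1)
    obtain R where R: "finite R" "R \<subseteq> integers"
      "\<And>x. x \<in> integers \<Longrightarrow> N (G x) = 0 \<Longrightarrow> \<exists>\<theta>\<in>R. N (x - \<theta>) = 0"
      using Suc(1)[OF G(1,2)] by blast
    have "N (x - \<theta>) = 0 \<or> N (G x) = 0" if x: "x \<in> integers" "N (F x) = 0" for x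
    proof -
      note K = analytic_withD(2)[OF Suc(2) x(1)] analytic_withD(2)[OF G(1) x(1)]
        integersD[OF x(1)] integersD[OF th(1)]
      have "N ((x - \<theta>) * G x) = 0" using N_cong[OF _ _ G(3)[OF x(1)]] K x(2) by auto
      thus ?thesis using K by (simp add: N_mult)
    qed
    thus ?thesis using R th(1) by (intro exI[of _ "insert \<theta> R"]) auto
  qed (auto intro: exI[of _ "{}"])
qed

section \<open>Compactness of the unit ball\<close>

lemma Cauchy_digits:
  assumes "\<And>E. N (of_nat (r (Suc E)) - of_nat (r E)) \<le> P (int E)"
  shows "\<exists>x\<in>integers. \<forall>E. N (x - of_nat (r E)) \<le> P (int E)"
proof -
  have up: "N (of_nat (r (E + k)) - of_nat (r E)) \<le> P (int E)" for E k
  proof (induction k)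
    case (Suc k)
    have "N (of_nat (r (Suc (E + k))) - of_nat (r (E + k))) \<le> P (int (E + k))" by (rule assms)
    also have "\<dots> \<le> P (int E)" unfolding P_le by simp
    finally show ?case using N_trans[OF K_of_nat K_of_nat K_of_nat _ Suc] by simp
  qed simp
  have "\<exists>x\<in>K. (\<lambda>n. N (of_nat (r n) - x)) \<longlonglongrightarrow> 0"
  proof (rule complete)
    fix e :: real assume "e > 0"
    then obtain E where E: "P (int E) < e" using ex_P_less by blast
    have "N (of_nat (r m) - of_nat (r n)) < e" if "m \<ge> E" "n \<ge> E" for m n
    proof -
      have 1: "N (of_nat (r m) - of_nat (r E)) \<le> P (int E)" using up[of E "m - E"] that by simp
      have "N (of_nat (r n) - of_nat (r E)) \<le> P (int E)" using up[of E "n - E"] that by simp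
      hence 2: "N (of_nat (r E) - of_nat (r n)) \<le> P (int E)"
        using N_commute[OF K_of_nat K_of_nat] by simp
      show ?thesis using N_trans[OF K_of_nat K_of_nat K_of_nat 1 2] E by simp
    qed
    thus "\<exists>M. \<forall>m\<ge>M. \<forall>n\<ge>M. N (of_nat (r m) - of_nat (r n)) < e" by blast
  qed simp
  then obtain x where x: "x \<in> K" "(\<lambda>n. N (of_nat (r n) - x)) \<longlonglongrightarrow> 0" by blast
  have le: "N (x - of_nat (r E)) \<le> P (int E)" for E
  proof (rule limit_N_le)
    show "(\<lambda>n. N (of_nat (r n) - of_nat (r E) - (x - of_nat (r E)))) \<longlonglongrightarrow> 0" using x(2) by simp
    show "\<forall>\<^sub>F n in sequentially. N (of_nat (r n) - of_nat (r E)) \<le> P (int E)"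
      using up[of E] by (intro eventually_sequentiallyI[of E]) (metis le_add_diff_inverse)
  qed (use x in simp_all)
  have "N x \<le> 1"
    using N_add_le[of "x - of_nat (r 0)" "of_nat (r 0)" 1] le[of 0] N_of_nat_le_1[of "r 0"] x(1) by simp
  thus ?thesis using integersI[OF x(1)] le by blast
qed

text \<open>Compactness of the ring of integers, by a nested choice of residue classes.\<close>

lemma nonzero_bounded_below:
  assumes "analytic_with a F" "\<And>x. x \<in> integers \<Longrightarrow> N (F x) \<noteq> 0"
  shows "\<exists>\<delta>>0. \<forall>x\<in>integers. \<delta> \<le> N (F x)"
proof (rule ccontr)
  assume neg: "\<not> ?thesis"
  note FK = analytic_withD(2)[OF assms(1)]
  \<comment> \<open>A class modulo p^E is bad if \<open>N (F x)\<close> comes arbitrarily close to 0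
    on it. It has finitely many subclasses modulo p^(E+1), so one of these is bad: otherwise the
    least of their lower bounds would serve for the whole class.\<close>
  define bad where "bad = (\<lambda>E r. \<forall>e>0. \<exists>x\<in>integers. N (x - of_nat r) \<le> P (int E) \<and> N (F x) < e)"
  have "bad 0 0" using neg by (force simp: bad_def not_le integers_N)
  have step: "\<exists>r'. bad (Suc E) r' \<and> N (of_nat r' - of_nat r) \<le> P (int E)" if "bad E r" for E r
  proof (rule ccontr)
    assume no: "\<not> ?thesis"
    define R where "R = {r'. r' < p ^ Suc E \<and> N (of_nat r' - of_nat r) \<le> P (int E)}"
    have "\<exists>e. \<forall>r'\<in>R. e r' > 0 \<and> (\<forall>x\<in>integers. N (x - of_nat r') \<le> P (int (Suc E)) \<longrightarrow> N (F x) \<ge> e r')"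
      using no unfolding bad_def R_def by (intro bchoice) (force simp: not_less)
    then obtain e where e: "\<And>r'. r' \<in> R \<Longrightarrow> e r' > 0"
      "\<And>r' x. r' \<in> R \<Longrightarrow> x \<in> integers \<Longrightarrow> N (x - of_nat r') \<le> P (int (Suc E)) \<Longrightarrow> N (F x) \<ge> e r'"
      by blast
    have fin: "finite R" by (simp add: R_def)
    define m where "m = Min (insert 1 (e ` R))"
    have "m > 0" unfolding m_def using fin e(1) by (subst Min_gr_iff) auto
    then obtain x where x: "x \<in> integers" "N (x - of_nat r) \<le> P (int E)" "N (F x) < m"
      using \<open>bad E r\<close> unfolding bad_def by blast
    obtain r' where r': "r' < p ^ Suc E" "N (x - of_nat r') \<le> P (int (Suc E))"
      using ex_nat_approx_below[OF x(1)] by blast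
    have "P (int (Suc E)) \<le> P (int E)" unfolding P_le by simp
    hence "N (of_nat r' - x) \<le> P (int E)" using r'(2) N_commute[of x "of_nat r'"] x(1) by simp
    hence "r' \<in> R" using r'(1) N_trans[OF K_of_nat _ K_of_nat _ x(2)] x(1) by (simp add: R_def)
    moreover from this have "m \<le> e r'" unfolding m_def using fin by (intro Min_le) auto
    ultimately show False using e(2)[OF _ x(1) r'(2)] x(3) by fastforce
  qed
  obtain r where r: "\<And>E. bad E (r E)" "\<And>E. N (of_nat (r (Suc E)) - of_nat (r E)) \<le> P (int E)"
    using dependent_nat_choice[of bad "\<lambda>E r r'. N (of_nat r' - of_nat r) \<le> P (int E)"]
      \<open>bad 0 0\<close> step by blast
  obtain x where x: "x \<in> integers" "\<And>E. N (x - of_nat (r E)) \<le> P (int E)"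
    using Cauchy_digits[OF r(2)] by blast
  obtain C where C: "C > 0" "\<And>x y. x \<in> integers \<Longrightarrow> y \<in> integers \<Longrightarrow> N (F x - F y) \<le> C * N (x - y)"
    using analytic_Lipschitz[OF assms(1)] by blast
  \<comment> \<open>At the common point of the nested bad classes F has nonzero seminorm, so by the
    Lipschitz bound the seminorm of F is constant on the small classes around it, against their
    badness.\<close>
  have Fx: "N (F x) > 0" using assms(2)[OF x(1)] FK[OF x(1)] by (simp add: order_less_le)
  obtain E where "P (int E) < N (F x) / C" using ex_P_less[of "N (F x) / C"] Fx C(1) by auto
  hence E: "C * P (int E) < N (F x)" using C(1) by (simp add: field_simps)
  obtain y where y: "y \<in> integers" "N (y - of_nat (r E)) \<le> P (int E)" "N (F y) < N (F x)"
    using r(1)[of E] Fx unfolding bad_def by blast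
  have "N (of_nat (r E) - y) \<le> P (int E)" using y(1,2) N_commute[of y "of_nat (r E)"] by simp
  hence "N (x - y) \<le> P (int E)" using N_trans[OF _ K_of_nat _ x(2)] x(1) y(1) by simp
  hence "N (F x - F y) < N (F x)" using C(2)[OF x(1) y(1)] mult_left_mono[of "N (x - y)" "P (int E)" C] C(1) E
    by linarith
  hence "N (F y) = N (F x)" using N_eq_of_close FK x(1) y(1) by blast
  thus False using y(3) by simp
qed

text \<open>Evaluate at \<theta> + p^n. If m' exceeded m, cancelling the m-th power of
  \<open>N (x - \<theta>)\<close> would bound the fixed positive number
  \<open>N (G \<theta>)\<close> by a constant times p^(-n).\<close>

lemma multiplicity_le:
  assumes G: "analytic_with c G" "N (G \<theta>) \<noteq> 0" and G': "analytic_with c' G'" and th: "\<theta> \<in> integers"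
    and eq: "\<And>x. x \<in> integers \<Longrightarrow> N ((x - \<theta>) ^ m * G x - (x - \<theta>) ^ m' * G' x) = 0"
  shows "m' \<le> m"
proof (rule ccontr)
  assume "\<not> m' \<le> m"
  then obtain k where k: "m' = m + Suc k" using less_imp_Suc_add[of m m'] by auto
  note GK = analytic_withD(2)[OF G(1)] analytic_withD(2)[OF G']
  obtain C where C: "C > 0" "\<And>x y. x \<in> integers \<Longrightarrow> y \<in> integers \<Longrightarrow> N (G x - G y) \<le> C * N (x - y)"
    using analytic_Lipschitz[OF G(1)] by blast
  obtain C' where C': "C' > 0" "\<And>x y. x \<in> integers \<Longrightarrow> y \<in> integers \<Longrightarrow> N (G' x - G' y) \<le> C' * N (x - y)"
    using analytic_Lipschitz[OF G'] by blast
  \<comment> \<open>Dominates both Lipschitz constants and thereby also \<open>N (G' x)\<close>,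
    uniformly in n.\<close>
  define D where "D = C + C' + N (G' \<theta>)"
  have D: "D > 0" "C \<le> D" "C' \<le> D" "N (G' \<theta>) \<le> D"
    using C(1) C'(1) N_nonneg[OF GK(2)[OF th]] by (simp_all add: D_def)
  have pos: "N (G \<theta>) > 0" using G(2) N_nonneg[OF GK(1)[OF th]] by simp
  obtain n where "P (int n) < N (G \<theta>) / D" using ex_P_less[of "N (G \<theta>) / D"] pos D(1) by auto
  hence n: "D * P (int n) < N (G \<theta>)" using D(1) by (simp add: field_simps)
  define x where "x = \<theta> + of_nat (p ^ n)"
  have x: "x \<in> integers" unfolding x_def by (intro integers_add th integers_of_nat)
  have dx: "x - \<theta> = of_nat (p ^ n)" by (simp add: x_def)
  have Ndx: "N (x - \<theta>) = P (int n)"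
    unfolding dx of_nat_power using N_power[OF K_of_nat] N_of_nat_p P_mult_nat[of 1 n] by simp
  have Pn: "P (int n) \<le> 1" using P_le[of "int n" 0] by simp
  have "N (\<theta> - x) = P (int n)" using Ndx N_commute[OF integersD[OF x] integersD[OF th]] by simp
  hence "N (G \<theta> - G x) \<le> C * P (int n)" using C(2)[OF th x] by simp
  also have "\<dots> \<le> D * P (int n)" using D(2) by (intro mult_right_mono) (simp_all add: less_imp_le)
  finally have Gx: "N (G x) = N (G \<theta>)" using n by (intro N_eq_of_close GK th x) linarith
  have "N (G' x - G' \<theta>) \<le> C' * P (int n)" using C'(2)[OF x th] Ndx by simp
  also have "\<dots> \<le> C' * 1" using Pn C'(1) by (intro mult_left_mono) simp_all
  finally have "N (G' x - G' \<theta>) \<le> D" using D(3) by simp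
  hence "N ((G' x - G' \<theta>) + G' \<theta>) \<le> D"
    using D(4) by (intro N_add_le[of "G' x - G' \<theta>" "G' \<theta>"] K_diff GK th x)
  hence G'x: "N (G' x) \<le> D" by simp
  have "N ((x - \<theta>) ^ m * G x) = N ((x - \<theta>) ^ m' * G' x)"
    by (intro N_cong[OF _ _ eq[OF x]] K_mult K_power K_diff integersD[OF x] integersD[OF th] GK x)
  hence "P (int n) ^ m * N (G x) = P (int n) ^ m' * N (G' x)"
    using GK x Ndx integersD[OF x] integersD[OF th] by (simp add: N_mult N_power)
  hence "P (int n) ^ m * N (G x) = P (int n) ^ m * (P (int n) ^ Suc k * N (G' x))"
    unfolding k power_add by (simp add: mult.assoc)
  hence "N (G \<theta>) = P (int n) ^ Suc k * N (G' x)" using Gx p_gt_1 by (auto simp del: power_Suc)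
  also have "\<dots> \<le> P (int n) ^ Suc k * D" using G'x by (intro mult_left_mono) simp_all
  also have "\<dots> \<le> P (int n) * D"
    using D(1) Pn power_le_one[of "P (int n)" k] by (intro mult_right_mono) (simp_all add: mult_left_le)
  finally show False using n by (simp add: mult.commute)
qed

end

section \<open>Last nonzero digits over several primes\<close>

locale padic_family =
  fixes I :: "'i set" and p l :: "'i \<Rightarrow> nat" and K :: "'i \<Rightarrow> 'a::comm_ring_1 set"
    and N :: "'i \<Rightarrow> 'a \<Rightarrow> real" and iota :: "rat \<Rightarrow> 'a"
  assumes finite_I: "finite I" and inj_p: "inj_on p I" and l_pos: "i \<in> I \<Longrightarrow> 1 \<le> l i"
    and padic: "i \<in> I \<Longrightarrow> padic (p i) (K i) (N i) iota"
begin

abbreviation PP :: "'i \<Rightarrow> int \<Rightarrow> real" where "PP i v \<equiv> real (p i) powi (- v)"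

abbreviation ints :: "'i \<Rightarrow> 'a set" where "ints i \<equiv> padic.integers (K i) (N i)"

definition b :: nat where "b = (\<Prod>i\<in>I. p i ^ l i)"

lemma prime_p: "i \<in> I \<Longrightarrow> prime (p i)"
  using padic padic.prime_p by blast

lemma p_neq: "i \<in> I \<Longrightarrow> j \<in> I \<Longrightarrow> i \<noteq> j \<Longrightarrow> p i \<noteq> p j"
  using inj_p by (auto simp: inj_on_def)

lemma coprime_powers: "i \<in> I \<Longrightarrow> j \<in> I \<Longrightarrow> i \<noteq> j \<Longrightarrow> coprime (p i ^ e) (p j ^ e')"
  using prime_p p_neq by (simp add: primes_coprime)

lemma b_pos: "b > 0"
  unfolding b_def using prime_p prime_gt_0_nat by (intro prod_pos) auto

lemma N_base_power:
  assumes "i \<in> I"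
  shows "rat_abs (p i) (of_nat (\<Prod>j\<in>I. p j ^ e j)) = PP i (int (e i))"
proof -
  note pr = prime_p[OF assms]
  have "(\<Prod>j\<in>I. p j ^ e j) = p i ^ e i * (\<Prod>j\<in>I-{i}. p j ^ e j)"
    using assms finite_I by (rule prod.remove[rotated])
  moreover have "\<not> p i dvd (\<Prod>j\<in>I-{i}. p j ^ e j)"
  proof
    assume "p i dvd (\<Prod>j\<in>I-{i}. p j ^ e j)"
    then obtain j where "j \<in> I - {i}" "p i dvd p j ^ e j"
      using prime_dvd_prod_iff[of "I - {i}" "p i" "\<lambda>j. p j ^ e j"] finite_I pr by auto
    hence "j \<in> I" "i \<noteq> j" "p i dvd p j" using prime_dvd_power[OF pr] by auto
    thus False using p_neq[OF assms] primes_dvd_imp_eq[OF pr prime_p] by blast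
  qed
  moreover have "rat_abs (p i) (of_nat (p i) ^ e i) = PP i (int (e i))"
    unfolding rat_abs_power[OF pr] rat_abs_prime[OF pr]
    by (simp add: power_int_minus power_inverse)
  ultimately show ?thesis
    using rat_abs_of_nat_coprime[OF pr, of "\<Prod>j\<in>I-{i}. p j ^ e j"]
    by (simp only: rat_abs_mult[OF pr] of_nat_mult of_nat_power mult_1_right not_False_eq_True simp_thms)
qed

section \<open>The normalized digit as a relation, with existence, uniqueness and stability\<close>

definition scal :: "int \<Rightarrow> 'a" where "scal c = iota (of_nat b powi c)"

lemma N_scal: assumes "i \<in> I" shows "N i (scal c) = PP i (int (l i) * c)"
proof -
  interpret padic "p i" "K i" "N i" iota by (rule padic[OF assms])
  have "N i (scal c) = PP i (int (l i)) powi c"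
    unfolding scal_def N_iota rat_abs_power_int[OF prime_p] unfolding b_def N_base_power[OF assms] ..
  also have "\<dots> = PP i (int (l i) * c)" by (metis mult_minus_left power_int_mult)
  finally show ?thesis .
qed

lemma scal_K [simp]: assumes "i \<in> I" shows "scal c \<in> K i"
  unfolding scal_def by (rule padic.K_iota[OF padic[OF assms]])

lemma scal_add: assumes "i \<in> I" shows "scal (c + e) = scal c * scal e"
  unfolding scal_def using b_pos padic.iota_mult[OF padic[OF assms]] by (simp add: power_int_add)

text \<open>Expresses v = \<nu>_b(x) by inequalities instead of a minimum of floors: l_i v bounds
  every valuation from below, and some valuation is less than l_i (v + 1). A component of seminorm
  zero passes the first test and never witnesses the second, as the convention of an infinite
  valuation demands.\<close>

definition isnu :: "('i \<Rightarrow> 'a) \<Rightarrow> int \<Rightarrow> bool" where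
  "isnu x v \<longleftrightarrow> (\<forall>i\<in>I. N i (x i) \<le> PP i (int (l i) * v)) \<and>
     (\<exists>i\<in>I. PP i (int (l i) * (v + 1)) < N i (x i))"

text \<open>Says that y is the digit block of x of length d. A relation allows arguing with
  inequalities for all components instead of computing a residue; the first alternative is the
  convention for the zero vector.\<close>

definition isdig :: "nat \<Rightarrow> ('i \<Rightarrow> 'a) \<Rightarrow> nat \<Rightarrow> bool" where
  "isdig d x y \<longleftrightarrow> y < b ^ d \<and>
     ((\<forall>i\<in>I. N i (x i) = 0) \<and> y = 0 \<or>
      (\<exists>v. isnu x v \<and> (\<forall>i\<in>I. N i (of_nat y - scal (- v) * x i) \<le> PP i (int (l i * d)))))"

lemma PP_le: "i \<in> I \<Longrightarrow> PP i v \<le> PP i w \<longleftrightarrow> w \<le> v"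
  and PP_less: "i \<in> I \<Longrightarrow> PP i v < PP i w \<longleftrightarrow> w < v"
  and PP_pos: "i \<in> I \<Longrightarrow> 0 < PP i v"
  and PP_add: "i \<in> I \<Longrightarrow> PP i (v + w) = PP i v * PP i w"
  using padic.P_le[OF padic] padic.P_less[OF padic] padic.P_pos[OF padic] padic.P_add[OF padic] by blast+

lemma isnu_nonzero: "isnu x v \<Longrightarrow> \<exists>i\<in>I. N i (x i) \<noteq> 0"
  unfolding isnu_def using PP_pos by (metis less_asym)

lemma isnu_le: assumes "isnu x v" "isnu x w" shows "v \<le> w"
proof -
  obtain i where i: "i \<in> I" "PP i (int (l i) * (w + 1)) < N i (x i)" using assms(2) by (auto simp: isnu_def)
  hence "PP i (int (l i) * (w + 1)) < PP i (int (l i) * v)" using assms(1) by (force simp: isnu_def)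
  hence "int (l i) * v < int (l i) * (w + 1)" using PP_less[OF i(1)] by blast
  thus ?thesis using l_pos[OF i(1)] by simp
qed

lemma isnu_unique: "isnu x v \<Longrightarrow> isnu x w \<Longrightarrow> v = w"
  using isnu_le order.antisym by blast

lemma ex_isnu:
  assumes "\<And>i. i \<in> I \<Longrightarrow> x i \<in> K i" "i \<in> I" "N i (x i) \<noteq> 0"
  shows "\<exists>v. isnu x v"
proof -
  define J where "J = {i\<in>I. N i (x i) \<noteq> 0}"
  have "\<forall>i\<in>J. \<exists>v. N i (x i) = PP i v" using padic.N_values[OF padic] assms(1) by (auto simp: J_def)
  then obtain v where v: "\<And>i. i \<in> J \<Longrightarrow> N i (x i) = PP i (v i)" by (auto dest!: bchoice)
  define w where "w = Min ((\<lambda>i. v i div int (l i)) ` J)"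
  have fin: "finite J" "J \<noteq> {}" using finite_I assms by (auto simp: J_def)
  have "isnu x w" unfolding isnu_def
  proof (intro conjI ballI)
    fix i assume i: "i \<in> I"
    show "N i (x i) \<le> PP i (int (l i) * w)"
    proof (cases "i \<in> J")
      case True
      hence "w \<le> v i div int (l i)" unfolding w_def using fin by (intro Min_le) auto
      hence "int (l i) * w \<le> int (l i) * (v i div int (l i))" by (intro mult_left_mono) auto
      also have "\<dots> \<le> v i"
        using l_pos[OF i] pos_mod_sign[of "int (l i)" "v i"] by (simp flip: minus_mod_eq_mult_div)
      finally show ?thesis using v[OF True] PP_le[OF i] by simp
    next
      case False
      thus ?thesis using i less_imp_le[OF PP_pos[OF i]] by (simp add: J_def)
    qed
  next
    have "w \<in> (\<lambda>i. v i div int (l i)) ` J" unfolding w_def using fin by (intro Min_in) auto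
    then obtain i where i: "i \<in> J" "w = v i div int (l i)" by blast
    have iI: "i \<in> I" using i by (simp add: J_def)
    have "v i = int (l i) * w + v i mod int (l i)" unfolding i(2) by simp
    moreover have "v i mod int (l i) < int (l i)" using l_pos[OF iI] by simp
    ultimately have "v i < int (l i) * (w + 1)" by (simp add: algebra_simps)
    hence "PP i (int (l i) * (w + 1)) < N i (x i)" using v[OF i(1)] PP_less[OF iI] by simp
    thus "\<exists>i\<in>I. PP i (int (l i) * (w + 1)) < N i (x i)" using iI by blast
  qed
  thus ?thesis ..
qed

lemma crt: "\<exists>n. \<forall>i\<in>I. [n = r i] (mod (p i ^ E i))"
  using chinese_remainder_nat[of I "\<lambda>i. p i ^ E i" r] finite_I coprime_powers by blast

lemma cong_base_power:
  assumes "\<And>i. i \<in> I \<Longrightarrow> [y = y'] (mod (p i ^ (l i * d)))" shows "[y = y'] (mod (b ^ d))"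
proof -
  have "[y = y'] (mod (\<Prod>i\<in>I. p i ^ (l i * d)))"
    by (rule coprime_cong_prod_nat) (use coprime_powers assms in auto)
  thus ?thesis by (simp add: b_def prod_power_distrib power_mult)
qed

text \<open>The normalized components fix the digit block modulo each p_i^(l_i d), hence modulo b^d,
  and both blocks are less than b^d.\<close>

lemma isdig_eqI:
  assumes "isdig d x y" "isdig d x' y'" "isnu x v" "isnu x' v'"
    and "\<And>i. i \<in> I \<Longrightarrow> x i \<in> K i" "\<And>i. i \<in> I \<Longrightarrow> x' i \<in> K i"
    and "\<And>i. i \<in> I \<Longrightarrow> N i (scal (- v) * x i - scal (- v') * x' i) \<le> PP i (int (l i * d))"
  shows "y = y'"
proof -
  have y: "y < b ^ d" "\<And>i. i \<in> I \<Longrightarrow> N i (of_nat y - scal (- v) * x i) \<le> PP i (int (l i * d))"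
    using assms(1) isnu_unique[OF assms(3)] isnu_nonzero[OF assms(3)] by (auto simp: isdig_def)
  have y': "y' < b ^ d" "\<And>i. i \<in> I \<Longrightarrow> N i (of_nat y' - scal (- v') * x' i) \<le> PP i (int (l i * d))"
    using assms(2) isnu_unique[OF assms(4)] isnu_nonzero[OF assms(4)] by (auto simp: isdig_def)
  have "[y = y'] (mod (p i ^ (l i * d)))" if i: "i \<in> I" for i
  proof -
    interpret padic "p i" "K i" "N i" iota by (rule padic[OF i])
    have xK: "scal (- v) * x i \<in> K i" "scal (- v') * x' i \<in> K i"
      using assms(5,6)[OF i] scal_K[OF i] by auto
    have "N i (scal (- v') * x' i - of_nat y') \<le> PP i (int (l i * d))"
      using y'(2)[OF i] N_commute[OF K_of_nat xK(2)] by simp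
    hence "N i (of_nat y - of_nat y') \<le> PP i (int (l i * d))"
      using N_trans[OF K_of_nat xK(1) K_of_nat y(2)[OF i] N_trans[OF xK K_of_nat assms(7)[OF i]]] by blast
    thus ?thesis unfolding N_of_nat_diff_le .
  qed
  hence "[y = y'] (mod (b ^ d))" by (rule cong_base_power)
  thus ?thesis using y(1) y'(1) by (simp add: cong_less_modulus_unique_nat)
qed

lemma isdig_zero: "isdig d x y \<Longrightarrow> (\<And>i. i \<in> I \<Longrightarrow> N i (x i) = 0) \<Longrightarrow> y = 0"
  using isnu_nonzero unfolding isdig_def by metis

text \<open>The lower bound in \<open>isnu\<close> makes the components integral after division by
  b^v. Their natural approximations at the single primes are joined by the Chinese remainder
  theorem.\<close>

lemma isdig_exists:
  assumes "\<And>i. i \<in> I \<Longrightarrow> x i \<in> K i" shows "\<exists>y. isdig d x y"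
proof (cases "\<exists>i\<in>I. N i (x i) \<noteq> 0")
  case False
  hence "isdig d x 0" using b_pos by (simp add: isdig_def)
  thus ?thesis ..
next
  case True
  then obtain v where v: "isnu x v" using ex_isnu assms by blast
  have "\<exists>r. N i (scal (- v) * x i - of_nat r) \<le> PP i (int (l i * d))" if i: "i \<in> I" for i
  proof -
    interpret padic "p i" "K i" "N i" iota by (rule padic[OF i])
    have "N i (scal (- v) * x i) = PP i (int (l i) * - v) * N i (x i)"
      using N_mult[OF scal_K[OF i] assms[OF i]] N_scal[OF i] by simp
    also have "\<dots> \<le> PP i (int (l i) * - v) * PP i (int (l i) * v)"
      using v i by (intro mult_left_mono) (auto simp: isnu_def less_imp_le)
    also have "\<dots> = 1" unfolding P_add[symmetric] by simp
    finally have "scal (- v) * x i \<in> integers" using assms[OF i] scal_K[OF i] by (intro integersI K_mult) simp_all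
    thus ?thesis by (rule ex_nat_approx)
  qed
  then obtain r where r: "\<And>i. i \<in> I \<Longrightarrow> N i (scal (- v) * x i - of_nat (r i)) \<le> PP i (int (l i * d))"
    by metis
  obtain n where n: "\<And>i. i \<in> I \<Longrightarrow> [n = r i] (mod (p i ^ (l i * d)))" using crt[of r "\<lambda>i. l i * d"] by blast
  have "N i (of_nat (n mod b ^ d) - scal (- v) * x i) \<le> PP i (int (l i * d))" if i: "i \<in> I" for i
  proof -
    interpret padic "p i" "K i" "N i" iota by (rule padic[OF i])
    have xK: "scal (- v) * x i \<in> K i" using assms[OF i] scal_K[OF i] by auto
    have "p i ^ (l i * d) dvd b ^ d" unfolding b_def power_mult
      using i finite_I by (intro dvd_power_same dvd_prodI)
    hence "[n mod b ^ d = n] (mod (p i ^ (l i * d)))" by (simp add: cong_def mod_mod_cancel)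
    hence "[n mod b ^ d = r i] (mod (p i ^ (l i * d)))" using n[OF i] cong_trans by blast
    hence "N i (of_nat (n mod b ^ d) - of_nat (r i)) \<le> PP i (int (l i * d))"
      unfolding N_of_nat_diff_le .
    moreover have "N i (of_nat (r i) - scal (- v) * x i) \<le> PP i (int (l i * d))"
      using r[OF i] N_commute[OF K_of_nat xK] by simp
    ultimately show ?thesis using N_trans[OF K_of_nat K_of_nat xK] by blast
  qed
  moreover have "n mod b ^ d < b ^ d" using b_pos by simp
  ultimately have "isdig d x (n mod b ^ d)" unfolding isdig_def using v by blast
  thus ?thesis ..
qed

text \<open>A common factor b^c merely shifts \<nu>_b by c. Normalized components have seminorm at
  most 1, so a relative error of valuation l_i d becomes an absolute error that the first d digits
  do not see.\<close>

lemma isdig_scale: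
  assumes "isdig d x y" "isdig d x' y'"
    and "\<And>i. i \<in> I \<Longrightarrow> x i \<in> K i" "\<And>i. i \<in> I \<Longrightarrow> x' i \<in> K i"
    and "\<And>i. i \<in> I \<Longrightarrow> N i (x' i - scal c * x i) \<le> PP i (int (l i * d)) * N i (x' i)" "d \<ge> 1"
  shows "y = y'"
proof -
  have Neq: "N i (x' i) = PP i (int (l i) * c) * N i (x i)" if i: "i \<in> I" for i
  proof -
    interpret padic "p i" "K i" "N i" iota by (rule padic[OF i])
    have xK: "x i \<in> K i" "x' i \<in> K i" "scal c * x i \<in> K i" using assms(3,4)[OF i] scal_K[OF i] by auto
    have "N i (scal c * x i) = N i (x' i)"
    proof (cases "N i (x' i) = 0")
      case True
      hence "N i (x' i - scal c * x i) \<le> 0" using assms(5)[OF i] by simp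
      hence "N i (x' i - scal c * x i) = 0" using N_nonneg[OF K_diff[OF xK(2,3)]] by linarith
      thus ?thesis using N_cong[OF xK(2,3)] by simp
    next
      case False
      \<comment> \<open>Positivity of d and l_i puts the relative error below 1, so that the two
        seminorms agree exactly.\<close>
      have "1 * 1 \<le> l i * d" by (intro mult_le_mono l_pos i assms(6))
      hence "int (l i * d) > 0" by linarith
      hence "PP i (int (l i * d)) < PP i 0" unfolding PP_less[OF i] .
      hence "PP i (int (l i * d)) * N i (x' i) < N i (x' i)"
        using False N_nonneg[OF xK(2)] by (simp add: order_less_le)
      thus ?thesis using assms(5)[OF i] by (intro N_eq_of_close[OF xK(2,3)]) linarith
    qed
    thus ?thesis using N_mult[OF scal_K[OF i] xK(1)] N_scal[OF i] by simp
  qed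
  show ?thesis
  proof (cases "\<exists>i\<in>I. N i (x i) \<noteq> 0")
    case True
    then obtain v where v: "isnu x v" using ex_isnu assms(3) by blast
    have shift: "PP i (int (l i) * (w + c)) = PP i (int (l i) * c) * PP i (int (l i) * w)" if "i \<in> I" for i w
      using PP_add[OF that, of "int (l i) * c" "int (l i) * w"] by (simp only: distrib_left add.commute)
    have v': "isnu x' (v + c)" unfolding isnu_def
    proof (intro conjI ballI)
      fix i assume i: "i \<in> I"
      show "N i (x' i) \<le> PP i (int (l i) * (v + c))"
        unfolding shift[OF i] Neq[OF i] using v i PP_pos[OF i] by (auto simp: isnu_def)
    next
      obtain i where i: "i \<in> I" "PP i (int (l i) * (v + 1)) < N i (x i)" using v by (auto simp: isnu_def)
      have "PP i (int (l i) * (v + 1 + c)) < N i (x' i)"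
        unfolding shift[OF i(1)] Neq[OF i(1)] using i PP_pos[OF i(1)] by simp
      thus "\<exists>i\<in>I. PP i (int (l i) * (v + c + 1)) < N i (x' i)" using i(1) by (metis add.assoc add.commute)
    qed
    have "N i (scal (- v) * x i - scal (- (v + c)) * x' i) \<le> PP i (int (l i * d))" if i: "i \<in> I" for i
    proof -
      interpret padic "p i" "K i" "N i" iota by (rule padic[OF i])
      have xK: "x i \<in> K i" "x' i \<in> K i" "x' i - scal c * x i \<in> K i" "scal (- (v + c)) \<in> K i"
        using assms(3,4)[OF i] scal_K[OF i] by auto
      have "scal (- v) = scal (- (v + c)) * scal c" unfolding scal_add[OF i, symmetric] by simp
      hence "N i (scal (- v) * x i - scal (- (v + c)) * x' i) = N i (- (scal (- (v + c)) * (x' i - scal c * x i)))"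
        by (simp add: algebra_simps)
      also have "\<dots> = PP i (int (l i) * - (v + c)) * N i (x' i - scal c * x i)"
        using xK N_scal[OF i] by (simp add: N_mult)
      also have "\<dots> \<le> PP i (int (l i) * - (v + c)) * (PP i (int (l i * d)) * PP i (int (l i) * (v + c)))"
        using v' i assms(5)[OF i] PP_pos[OF i]
        by (intro mult_left_mono order.trans[OF assms(5)[OF i]]) (auto simp: isnu_def less_imp_le)
      also have "\<dots> = PP i (int (l i * d))" unfolding P_add[symmetric] by (simp add: algebra_simps)
      finally show ?thesis .
    qed
    thus ?thesis using isdig_eqI[OF assms(1,2) v v' assms(3,4)] by blast
  next
    case False
    thus ?thesis using isdig_zero assms(1,2) Neq by (metis mult_zero_right)
  qed
qed

text \<open>One component of valuation less than l_j (B + 1) forces \<nu>_b \<le> B. Precision l_i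
  (B + d) in each component therefore still leaves d digits after normalization.\<close>

lemma isdig_local:
  assumes "isdig d x y" "isdig d x' y'"
    and "\<And>i. i \<in> I \<Longrightarrow> x i \<in> K i" "\<And>i. i \<in> I \<Longrightarrow> x' i \<in> K i"
    and "j \<in> I" "PP j (int (l j) * (B + 1)) < N j (x j)"
    and "\<And>i. i \<in> I \<Longrightarrow> N i (x i - x' i) \<le> PP i (int (l i) * (B + int d))" "d \<ge> 1"
  shows "y = y'"
proof -
  have PPd: "PP i (int (l i) * (B + int d)) \<le> PP i (int (l i) * (B + 1))" if "i \<in> I" for i
    unfolding PP_le[OF that] using assms(8) by (intro mult_left_mono) auto
  have "N j (x j) \<noteq> 0" using assms(6) PP_pos[OF assms(5)] by (metis less_asym)
  then obtain v where v: "isnu x v" using ex_isnu assms(3,5) by blast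
  have "PP j (int (l j) * (B + 1)) < PP j (int (l j) * v)" using v assms(5,6) by (force simp: isnu_def)
  hence "int (l j) * v < int (l j) * (B + 1)" unfolding PP_less[OF assms(5)] .
  hence vB: "v \<le> B" using l_pos[OF assms(5)] by simp
  have mono: "PP i (int (l i) * (B + 1)) \<le> PP i (int (l i) * (v + 1))" if "i \<in> I" for i
    unfolding PP_le[OF that] using vB by (intro mult_left_mono) auto
  have small: "N i (x i - x' i) \<le> PP i (int (l i) * (v + 1))" if "i \<in> I" for i
    using assms(7)[OF that] PPd[OF that] mono[OF that] by linarith
  have small': "N i (x i - x' i) \<le> PP i (int (l i) * v)" if "i \<in> I" for i
    using small[OF that] PP_le[OF that, of "int (l i) * (v + 1)" "int (l i) * v"] by (simp add: algebra_simps)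
  have v': "isnu x' v" unfolding isnu_def
  proof (intro conjI ballI)
    fix i assume i: "i \<in> I"
    interpret padic "p i" "K i" "N i" iota by (rule padic[OF i])
    have "N i (x i - (x i - x' i)) \<le> PP i (int (l i) * v)"
    proof (rule N_diff_le)
      show "N i (x i) \<le> PP i (int (l i) * v)" using v i by (simp add: isnu_def)
    qed (use small'[OF i] assms(3,4)[OF i] in simp_all)
    thus "N i (x' i) \<le> PP i (int (l i) * v)" by simp
  next
    obtain i where i: "i \<in> I" "PP i (int (l i) * (v + 1)) < N i (x i)" using v by (auto simp: isnu_def)
    interpret padic "p i" "K i" "N i" iota by (rule padic[OF i(1)])
    have "N i (x i - x' i) < N i (x i)" using small[OF i(1)] i(2) by linarith
    hence "N i (x' i) = N i (x i)" using N_eq_of_close assms(3,4) i(1) by blast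
    thus "\<exists>i\<in>I. PP i (int (l i) * (v + 1)) < N i (x' i)" using i by (intro bexI[of _ i]) simp_all
  qed
  show ?thesis
  proof (rule isdig_eqI[OF assms(1,2) v v' assms(3,4)])
    fix i assume i: "i \<in> I"
    interpret padic "p i" "K i" "N i" iota by (rule padic[OF i])
    have "N i (scal (- v) * x i - scal (- v) * x' i) = N i (scal (- v) * (x i - x' i))"
      by (simp add: right_diff_distrib)
    also have "\<dots> = PP i (int (l i) * - v) * N i (x i - x' i)"
      using N_mult[of "scal (- v)" "x i - x' i"] assms(3,4)[OF i] scal_K[OF i] N_scal[OF i] by simp
    also have "\<dots> \<le> PP i (int (l i) * - v) * PP i (int (l i) * (B + int d))"
      using assms(7)[OF i] by (intro mult_left_mono) (auto simp: less_imp_le)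
    also have "\<dots> = PP i (int (l i) * (B - v) + int (l i * d))"
      unfolding P_add[symmetric] by (simp add: algebra_simps)
    also have "\<dots> \<le> PP i (int (l i * d))"
      unfolding PP_le[OF i] using vB by simp
    finally show "N i (scal (- v) * x i - scal (- v) * x' i) \<le> PP i (int (l i * d))" .
  qed
qed

end

section \<open>Automaticity at a rational root\<close>

lemma int_le_div_iff: "0 < (l::int) \<Longrightarrow> v \<le> a div l \<longleftrightarrow> l * v \<le> a"
proof
  assume l: "0 < l" and "v \<le> a div l"
  hence "l * v \<le> l * (a div l)" by simp
  also have "\<dots> \<le> a" using l pos_mod_sign[of l a] by (simp flip: minus_mod_eq_mult_div)
  finally show "l * v \<le> a" .
next
  assume l: "0 < l" and "l * v \<le> a"
  hence "l * v div l \<le> a div l" by (intro zdiv_mono1)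
  thus "v \<le> a div l" using l by simp
qed

text \<open>The kernel arises from a by iterating the substitutions n \<mapsto> k n + c; the
  induction splits off the leading base-k digit c of j.\<close>

lemma finite_kernelI:
  assumes "finite T" "a \<in> T" "\<And>h c. h \<in> T \<Longrightarrow> c < k \<Longrightarrow> (\<lambda>n. h (k * n + c)) \<in> T" "k > 0"
  shows "finite (kernel k a)"
proof -
  have "(\<lambda>n. a (k ^ i * n + j)) \<in> T" if "j < k ^ i" for i j
    using that
  proof (induction i arbitrary: j)
    case (Suc i)
    define c j0 where "c = j div k ^ i" and "j0 = j mod k ^ i"
    have j: "j = k ^ i * c + j0" "j0 < k ^ i" using \<open>k > 0\<close> by (simp_all add: c_def j0_def)
    have "c < k" using Suc.prems \<open>k > 0\<close> by (simp add: c_def less_mult_imp_div_less)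
    hence "(\<lambda>n. a (k ^ i * (k * n + c) + j0)) \<in> T" using assms(3)[OF Suc.IH[OF j(2)]] by blast
    moreover have "(\<lambda>n. a (k ^ i * (k * n + c) + j0)) = (\<lambda>n. a (k ^ Suc i * n + j))"
      by (simp add: j(1) algebra_simps)
    ultimately show ?case by simp
  qed (use assms(2) in simp)
  moreover have "j < k ^ i" if "j \<le> k ^ i - 1" for i j
  proof -
    have "k ^ i > 0" using \<open>k > 0\<close> by simp
    thus ?thesis using that by linarith
  qed
  ultimately have "kernel k a \<subseteq> T" unfolding kernel_def by blast
  thus ?thesis using assms(1) finite_subset by blast
qed

lemma finite_mod_periodic:
  fixes M B :: nat assumes "M > 0"
  shows "finite {h :: nat \<Rightarrow> nat. (\<forall>n n'. [n = n'] (mod M) \<longrightarrow> h n = h n') \<and> (\<forall>n. h n < B)}" (is "finite ?P")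
proof (rule inj_on_finite)
  show "finite (PiE {..<M} (\<lambda>_. {..<B}))" by (simp add: finite_PiE)
  show "(\<lambda>h. restrict h {..<M}) ` ?P \<subseteq> PiE {..<M} (\<lambda>_. {..<B})"
    by (auto simp: PiE_def extensional_def split: if_splits)
  show "inj_on (\<lambda>h. restrict h {..<M}) ?P"
  proof (rule inj_onI, rule ext)
    fix h h' n assume h: "h \<in> ?P" "h' \<in> ?P" and eq: "restrict h {..<M} = restrict h' {..<M}"
    have "h (n mod M) = h' (n mod M)" using fun_cong[OF eq, of "n mod M"] assms by simp
    moreover have "[n mod M = n] (mod M)" by (simp add: cong_def)
    hence "h (n mod M) = h n" "h' (n mod M) = h' n" using h by blast+
    ultimately show "h n = h' n" by simp
  qed
qed

text \<open>On S the value of H factors through the finitely many values of g.\<close>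

lemma finite_by_invariant:
  assumes "finite (g ` S)" "\<And>x y. x \<in> S \<Longrightarrow> y \<in> S \<Longrightarrow> g x = g y \<Longrightarrow> H x = H y"
  shows "finite (H ` S)"
proof -
  have "H ` S \<subseteq> (\<lambda>c. H (SOME x. x \<in> S \<and> g x = c)) ` g ` S"
  proof
    fix z assume "z \<in> H ` S"
    then obtain x where x: "x \<in> S" "z = H x" by blast
    define y where "y = (SOME y. y \<in> S \<and> g y = g x)"
    have "y \<in> S \<and> g y = g x" unfolding y_def using x(1) by (rule someI[of _ x, OF conjI[OF _ refl]])
    hence "z = H y" using assms(2) x by metis
    thus "z \<in> (\<lambda>c. H (SOME x. x \<in> S \<and> g x = c)) ` g ` S" using x(1) by (auto simp: y_def)
  qed
  thus ?thesis using assms(1) finite_surj by blast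
qed

context padic_family
begin

lemma eventually_PP_less:
  assumes "\<And>i. i \<in> I \<Longrightarrow> e i > 0" "\<And>i. i \<in> I \<Longrightarrow> 1 \<le> r i"
  shows "\<exists>E::nat. \<forall>i\<in>I. PP i (int (r i) * int E) < e i"
proof -
  have "\<forall>\<^sub>F E in sequentially. \<forall>i\<in>I. PP i (int E) < e i"
    using finite_I padic.eventually_P_less[OF padic] assms(1) by (intro eventually_ball_finite) auto
  then obtain E where E: "\<And>i. i \<in> I \<Longrightarrow> PP i (int E) < e i"
    using eventually_happens' sequentially_bot by blast
  have "PP i (int (r i) * int E) \<le> PP i (int E)" if "i \<in> I" for i
    unfolding PP_le[OF that] using mult_right_mono[of 1 "int (r i)" "int E"] assms(2)[OF that] by simp
  thus ?thesis using E by (meson order.strict_trans1)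
qed

lemma family_Lipschitz:
  assumes "\<And>i. i \<in> I \<Longrightarrow> padic.analytic_with (K i) (N i) (co i) (F i)"
  shows "\<exists>C>0. \<forall>i\<in>I. \<forall>x\<in>ints i. \<forall>y\<in>ints i. N i (F i x - F i y) \<le> C * N i (x - y)"
proof -
  have "\<forall>i\<in>I. \<exists>C>0. \<forall>x\<in>ints i. \<forall>y\<in>ints i. N i (F i x - F i y) \<le> C * N i (x - y)"
    using padic.analytic_Lipschitz[OF padic assms] by blast
  then obtain C where C: "\<And>i. i \<in> I \<Longrightarrow> C i > 0"
    "\<And>i x y. i \<in> I \<Longrightarrow> x \<in> ints i \<Longrightarrow> y \<in> ints i \<Longrightarrow> N i (F i x - F i y) \<le> C i * N i (x - y)"
    by metis
  define D where "D = Max (insert 1 (C ` I))"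
  have D: "D \<ge> C i" if "i \<in> I" for i unfolding D_def using finite_I that by (intro Max_ge) auto
  have "D \<ge> 1" unfolding D_def using finite_I by (intro Max_ge) auto
  moreover have "N i (F i x - F i y) \<le> D * N i (x - y)" if "i \<in> I" "x \<in> ints i" "y \<in> ints i" for i x y
  proof -
    interpret padic "p i" "K i" "N i" iota by (rule padic[OF that(1)])
    have "C i * N i (x - y) \<le> D * N i (x - y)"
      using D[OF that(1)] that by (intro mult_right_mono N_nonneg K_diff integersD)
    thus ?thesis using C(2)[OF that] by linarith
  qed
  ultimately show ?thesis by (intro exI[of _ D]) auto
qed

lemma int_base_dvd:
  assumes "\<And>i. i \<in> I \<Longrightarrow> int (p i) ^ e i dvd z" shows "int (\<Prod>i\<in>I. p i ^ e i) dvd z"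
proof -
  have "[nat \<bar>z\<bar> = 0] (mod (\<Prod>i\<in>I. p i ^ e i))"
  proof (rule coprime_cong_prod_nat)
    fix i assume "i \<in> I"
    thus "[nat \<bar>z\<bar> = 0] (mod (p i ^ e i))" using assms[of i] by (simp add: cong_0_iff dvd_nat_abs_iff)
  qed (rule coprime_powers)
  thus ?thesis by (simp only: cong_0_iff dvd_nat_abs_iff)
qed

lemma N_cong_base:
  assumes "i \<in> I" "[n = n'] (mod (b ^ E))"
  shows "N i (of_nat n - of_nat n') \<le> PP i (int (l i) * int E)"
proof -
  have "p i ^ (l i * E) dvd b ^ E" unfolding b_def power_mult
    using assms(1) finite_I by (intro dvd_power_same dvd_prodI)
  hence "[n = n'] (mod (p i ^ (l i * E)))" using assms(2) cong_dvd_modulus_nat by blast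
  hence "N i (of_nat n - of_nat n') \<le> PP i (int (l i * E))"
    using padic.N_of_nat_diff_le[OF padic[OF assms(1)]] by blast
  thus ?thesis by simp
qed

end

section \<open>The digit sequence of analytic functions away from common roots\<close>

locale analytic_family = padic_family +
  fixes F :: "'a \<Rightarrow> 'b \<Rightarrow> 'b" and co :: "'a \<Rightarrow> nat \<Rightarrow> 'b" and d :: nat and a :: "nat \<Rightarrow> nat"
  assumes F_analytic: "i \<in> I \<Longrightarrow> padic.analytic_with (K i) (N i) (co i) (F i)"
    and d_pos: "1 \<le> d"
    and digits: "isdig d (\<lambda>i. F i (of_nat n)) (a n)"
begin

lemma F_K: "i \<in> I \<Longrightarrow> x \<in> ints i \<Longrightarrow> F i x \<in> K i"
  using padic.analytic_withD(2)[OF padic F_analytic] by blast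

lemma of_nat_ints [simp]: "i \<in> I \<Longrightarrow> of_nat n \<in> ints i"
  using padic.integers_of_nat[OF padic] by blast

lemma a_less: "a n < b ^ d"
  using digits[of n] by (simp add: isdig_def)

text \<open>The bound B on \<nu>_b at n limits the precision on which the digits depend, and the
  Lipschitz constant turns it into a modulus b^E. This modulus depends on B alone and not on
  n.\<close>

lemma locally_constant:
  "\<exists>E. \<forall>n n'. (\<exists>j\<in>I. PP j (int (l j) * (B + 1)) < N j (F j (of_nat n))) \<longrightarrow> [n = n'] (mod (b ^ E)) \<longrightarrow> a n = a n'"
proof -
  obtain C where C: "C > 0"
    "\<And>i x y. i \<in> I \<Longrightarrow> x \<in> ints i \<Longrightarrow> y \<in> ints i \<Longrightarrow> N i (F i x - F i y) \<le> C * N i (x - y)"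
    using family_Lipschitz[OF F_analytic] by blast
  have "\<exists>E::nat. \<forall>i\<in>I. PP i (int (l i) * int E) < PP i (int (l i) * (B + int d)) / C"
    using C(1) PP_pos l_pos by (intro eventually_PP_less) auto
  then obtain E where E: "\<And>i. i \<in> I \<Longrightarrow> C * PP i (int (l i) * int E) < PP i (int (l i) * (B + int d))"
    using C(1) by (auto simp: field_simps)
  have "a n = a n'" if j: "j \<in> I" "PP j (int (l j) * (B + 1)) < N j (F j (of_nat n))" and c: "[n = n'] (mod (b ^ E))" for n n' j
  proof (rule isdig_local[OF digits digits _ _ j _ d_pos])
    fix i assume i: "i \<in> I"
    have "N i (F i (of_nat n) - F i (of_nat n')) \<le> C * N i (of_nat n - of_nat n')"
      using C(2) i by simp
    also have "\<dots> \<le> C * PP i (int (l i) * int E)"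
      using N_cong_base[OF i c] C(1) by simp
    also have "\<dots> \<le> PP i (int (l i) * (B + int d))" using E[OF i] by simp
    finally show "N i (F i (of_nat n) - F i (of_nat n')) \<le> PP i (int (l i) * (B + int d))" .
  qed (use F_K in simp_all)
  thus ?thesis by blast
qed

lemma ex_below:
  assumes "\<And>i. i \<in> I \<Longrightarrow> e i > 0" shows "\<exists>B::int. \<forall>i\<in>I. PP i (int (l i) * (B + 1)) < e i"
proof -
  obtain E where "\<forall>i\<in>I. PP i (int (l i) * int E) < e i"
    using eventually_PP_less[of e l] assms l_pos by blast
  thus ?thesis by (intro exI[of _ "int E - 1"]) simp
qed

text \<open>A single component without roots is bounded away from zero by compactness, so \<nu>_b is
  bounded above along the whole sequence.\<close>

lemma periodic_if_no_root:
  assumes "j \<in> I" "\<And>x. x \<in> ints j \<Longrightarrow> N j (F j x) \<noteq> 0"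
  shows "\<exists>e. has_period a (b ^ e)"
proof -
  obtain \<delta> where \<delta>: "\<delta> > 0" "\<And>x. x \<in> ints j \<Longrightarrow> \<delta> \<le> N j (F j x)"
    using padic.nonzero_bounded_below[OF padic F_analytic assms(2)] assms(1) by blast
  obtain B where B: "PP j (int (l j) * (B + 1)) < \<delta>" using ex_below[of "\<lambda>_. \<delta>"] \<delta>(1) assms(1) by blast
  obtain E where E: "\<And>n n'. (\<exists>j\<in>I. PP j (int (l j) * (B + 1)) < N j (F j (of_nat n))) \<Longrightarrow>
      [n = n'] (mod (b ^ E)) \<Longrightarrow> a n = a n'"
    using locally_constant[of B] by blast
  have "PP j (int (l j) * (B + 1)) < N j (F j (of_nat n))" for n
    using B \<delta>(2)[OF of_nat_ints[OF assms(1)], of n] by linarith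
  hence "a (n + b ^ E) = a n" for n
    using assms(1) by (intro E bexI[of _ j]) (simp_all only: cong_def mod_add_self2)
  thus ?thesis using b_pos by (auto simp: has_period_def Suc_le_eq)
qed

end

text \<open>\<open>G_nz\<close> concerns the whole unit ball: q is the only root of every component,
  so the cofactors are bounded away from zero. W is the common value of the products w_i
  m_i.\<close>

locale rational_root = analytic_family +
  fixes q :: rat and m w :: "'a \<Rightarrow> nat" and W :: nat and G :: "'a \<Rightarrow> 'b \<Rightarrow> 'b" and cg :: "'a \<Rightarrow> nat \<Rightarrow> 'b"
  assumes q_int: "i \<in> I \<Longrightarrow> rat_abs (p i) q \<le> 1"
    and w_pos: "i \<in> I \<Longrightarrow> 1 \<le> w i" and w_m: "i \<in> I \<Longrightarrow> w i * m i = W"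
    and G_analytic: "i \<in> I \<Longrightarrow> padic.analytic_with (K i) (N i) (cg i) (G i)"
    and F_G: "i \<in> I \<Longrightarrow> x \<in> ints i \<Longrightarrow> N i (F i x - (x - iota q) ^ m i * G i x) = 0"
    and G_nz: "i \<in> I \<Longrightarrow> x \<in> ints i \<Longrightarrow> N i (G i x) \<noteq> 0"
begin

text \<open>These exponents give k^(m_i) the p_i-adic valuation l_i W, which is that of b^W, for
  every i.\<close>

definition k :: nat where "k = (\<Prod>i\<in>I. p i ^ (l i * w i))"

lemma G_K: "i \<in> I \<Longrightarrow> x \<in> ints i \<Longrightarrow> G i x \<in> K i"
  using padic.analytic_withD(2)[OF padic G_analytic] by blast

lemma q_ints: "i \<in> I \<Longrightarrow> iota q \<in> ints i"
  using padic.integersI[OF padic] padic.K_iota[OF padic] padic.N_iota[OF padic] q_int by metis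

lemma k_pos: "k > 0"
  unfolding k_def using prime_p prime_gt_0_nat by (intro prod_pos) auto

lemma rat_abs_k: assumes "i \<in> I" shows "rat_abs (p i) (of_nat k ^ e) = PP i (int (l i * w i) * int e)"
proof -
  have "rat_abs (p i) (of_nat k) = PP i (int (l i * w i))"
    unfolding k_def by (rule N_base_power[OF assms])
  thus ?thesis unfolding rat_abs_power[OF prime_p[OF assms]] using padic.P_mult_nat[OF padic[OF assms]] by simp
qed

lemma ex_G_bound: "\<exists>\<delta>. \<forall>i\<in>I. \<delta> i > 0 \<and> (\<forall>x\<in>ints i. \<delta> i \<le> N i (G i x))"
  using padic.nonzero_bounded_below[OF padic G_analytic G_nz] by (intro bchoice) blast

lemma N_F: assumes "i \<in> I" "x \<in> ints i" shows "N i (F i x) = N i (x - iota q) ^ m i * N i (G i x)"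
proof -
  interpret padic "p i" "K i" "N i" iota by (rule padic[OF assms(1)])
  have "N i (F i x) = N i ((x - iota q) ^ m i * G i x)"
    by (intro N_cong K_mult K_power K_diff K_iota F_K G_K F_G integersD[OF assms(2)] assms)
  thus ?thesis using G_K[OF assms] integersD[OF assms(2)] by (simp add: N_mult N_power)
qed

text \<open>The seminorm of F_j is a power of the distance to q times a factor bounded below, so
  \<nu>_b is bounded at the points that are farther from q than k^e in some component.\<close>

lemma constant_off_root:
  "\<exists>E. \<forall>n n'. (\<exists>j\<in>I. PP j (int (l j * w j) * int e) < N j (of_nat n - iota q)) \<longrightarrow>
     [n = n'] (mod (b ^ E)) \<longrightarrow> a n = a n'"
proof -
  obtain \<delta> where \<delta>: "\<And>i. i \<in> I \<Longrightarrow> \<delta> i > 0" "\<And>i x. i \<in> I \<Longrightarrow> x \<in> ints i \<Longrightarrow> \<delta> i \<le> N i (G i x)"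
    using ex_G_bound by blast
  define \<epsilon> where "\<epsilon> = (\<lambda>i. PP i (int (l i * w i) * int e) ^ m i * \<delta> i)"
  have "\<epsilon> i > 0" if "i \<in> I" for i unfolding \<epsilon>_def using \<delta>(1) PP_pos that by simp
  then obtain B where B: "\<And>i. i \<in> I \<Longrightarrow> PP i (int (l i) * (B + 1)) < \<epsilon> i" using ex_below[of \<epsilon>] by blast
  obtain E where E: "\<And>n n'. (\<exists>j\<in>I. PP j (int (l j) * (B + 1)) < N j (F j (of_nat n))) \<Longrightarrow>
      [n = n'] (mod (b ^ E)) \<Longrightarrow> a n = a n'"
    using locally_constant[of B] by blast
  have "PP j (int (l j) * (B + 1)) < N j (F j (of_nat n))"
    if "j \<in> I" "PP j (int (l j * w j) * int e) < N j (of_nat n - iota q)" for j n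
  proof -
    have "\<epsilon> j \<le> N j (F j (of_nat n))"
      unfolding \<epsilon>_def N_F[OF that(1) of_nat_ints[OF that(1)]]
    proof (intro mult_mono power_mono zero_le_power)
      show "0 \<le> N j (of_nat n - iota q)" using that PP_pos[OF that(1)] by (metis less_imp_le order.strict_trans)
    qed (use that \<delta> PP_pos[OF that(1)] in \<open>auto intro: less_imp_le\<close>)
    thus ?thesis using B[OF that(1)] by linarith
  qed
  thus ?thesis using E by blast
qed

text \<open>The pairs for which n \<mapsto> k^e n + j still comes arbitrarily close to q, that is, j
  is the residue of q modulo k^e.\<close>

definition good :: "(nat \<times> nat) set" where
  "good = {(e, j). j < k ^ e \<and> (\<forall>i\<in>I. rat_abs (p i) (of_nat j - q) \<le> PP i (int (l i * w i) * int e))}"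

definition root_at :: "nat \<times> nat \<Rightarrow> rat" where
  "root_at = (\<lambda>(e, j). (q - of_nat j) / of_nat k ^ e)"

definition kseq :: "nat \<times> nat \<Rightarrow> nat \<Rightarrow> nat" where
  "kseq = (\<lambda>(e, j) n. a (k ^ e * n + j))"

text \<open>For q = u / v the number v times the new root is an integer, because k^e divides u - v j
  one prime at a time, and it is bounded because 0 \<le> j < k^e.\<close>

lemma finite_root_at: "finite (root_at ` good)"
proof -
  obtain u v where q: "q = of_int u / of_int v" "v > 0" by (rule rat_as_fraction)
  define M where "M = \<lceil>of_int v * (\<bar>q\<bar> + 1)\<rceil>"
  have "root_at (e, j) \<in> (\<lambda>z. of_int z / of_int v) ` {- M..M}" if "(e, j) \<in> good" for e j
  proof -
    from that have j: "j < k ^ e" "\<And>i. i \<in> I \<Longrightarrow> rat_abs (p i) (of_nat j - q) \<le> PP i (int (l i * w i) * int e)"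
      by (auto simp: good_def)
    have "int (\<Prod>i\<in>I. p i ^ (l i * w i * e)) dvd u - v * int j"
    proof (rule int_base_dvd)
      fix i assume i: "i \<in> I"
      have "of_int (u - v * int j) = (- of_int v) * (of_nat j - q)" using q by (simp add: field_simps)
      hence "rat_abs (p i) (of_int (u - v * int j)) = rat_abs (p i) (of_int v) * rat_abs (p i) (of_nat j - q)"
        by (simp only: rat_abs_mult[OF prime_p[OF i]] rat_abs_uminus[OF prime_p[OF i]])
      also have "\<dots> \<le> 1 * PP i (int (l i * w i) * int e)"
      proof (rule mult_mono[OF _ j(2)[OF i]])
        show "rat_abs (p i) (of_int v) \<le> 1"
          using rat_abs_of_int_le[OF prime_p[OF i], of v 0] by simp
      qed (use rat_abs_nonneg in simp_all)
      also have "\<dots> = PP i (int (l i * w i * e))" by simp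
      finally show "int (p i) ^ (l i * w i * e) dvd u - v * int j"
        unfolding rat_abs_of_int_le[OF prime_p[OF i]] .
    qed
    moreover have "int (\<Prod>i\<in>I. p i ^ (l i * w i * e)) = int k ^ e"
      by (simp add: k_def power_mult prod_power_distrib)
    ultimately obtain z where z: "u - v * int j = int k ^ e * z" by (auto simp: dvd_def)
    have kp: "of_nat k ^ e > (0::rat)" using k_pos by simp
    have "of_int v * (q - of_nat j) = of_int (u - v * int j)" using q by (simp add: field_simps)
    hence "of_int v * root_at (e, j) = of_int z"
      using kp unfolding root_at_def z by (simp add: field_simps)
    hence r: "root_at (e, j) = of_int z / of_int v" using q(2) by (simp add: field_simps)
    have "\<bar>root_at (e, j)\<bar> \<le> \<bar>q\<bar> + 1"
    proof -
      have "\<bar>q - of_nat j\<bar> \<le> \<bar>q\<bar> + of_nat j" by linarith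
      also have "\<dots> \<le> \<bar>q\<bar> * of_nat k ^ e + of_nat k ^ e"
      proof (intro add_mono)
        have "1 \<le> (of_nat k :: rat) ^ e" using k_pos by (intro one_le_power) (simp add: Suc_le_eq)
        thus "\<bar>q\<bar> \<le> \<bar>q\<bar> * of_nat k ^ e" using mult_left_mono[of 1 "of_nat k ^ e" "\<bar>q\<bar>"] by simp
        show "of_nat j \<le> (of_nat k :: rat) ^ e" using j(1) by (metis less_imp_le of_nat_le_iff of_nat_power)
      qed
      finally show ?thesis using kp by (simp add: root_at_def field_simps)
    qed
    hence "\<bar>of_int z\<bar> \<le> of_int v * (\<bar>q\<bar> + 1)" using q(2) unfolding r by (simp add: field_simps)
    hence "\<bar>z\<bar> \<le> M" unfolding M_def by (metis le_ceiling_iff le_of_int_ceiling of_int_abs of_int_le_iff order.trans)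
    thus ?thesis unfolding r by (intro image_eqI[OF refl]) auto
  qed
  hence "root_at ` good \<subseteq> (\<lambda>z. of_int z / of_int v) ` {- M..M}" by auto
  thus ?thesis using finite_subset by blast
qed

lemma k_power_dvd: "(e, j) \<in> good \<Longrightarrow> i \<in> I \<Longrightarrow> rat_abs (p i) (of_nat j - q) \<le> PP i (int (l i * w i) * int e)"
  by (auto simp: good_def)

lemma kseq_arg:
  assumes "i \<in> I"
  shows "of_nat (k ^ e * n + j) - iota q = iota (of_nat k ^ e) * iota (of_nat n - root_at (e, j))"
proof -
  interpret padic "p i" "K i" "N i" iota by (rule padic[OF assms])
  have "of_nat (k ^ e * n + j) - q = of_nat k ^ e * (of_nat n - root_at (e, j))"
    using k_pos by (simp add: root_at_def field_simps)
  hence "iota (of_nat (k ^ e * n + j) - q) = iota (of_nat k ^ e * (of_nat n - root_at (e, j)))" by simp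
  thus ?thesis by (simp only: iota_diff iota_mult iota_of_nat)
qed

lemma root_at_int:
  assumes "(e, j) \<in> good" "i \<in> I" shows "rat_abs (p i) (root_at (e, j)) \<le> 1"
proof -
  note pr = prime_p[OF assms(2)]
  have kp: "of_nat k ^ e \<noteq> (0::rat)" using k_pos by simp
  have "root_at (e, j) * of_nat k ^ e = - (of_nat j - q)" using kp by (simp add: root_at_def)
  hence "rat_abs (p i) (root_at (e, j)) * PP i (int (l i * w i) * int e) = rat_abs (p i) (of_nat j - q)"
    using rat_abs_mult[OF pr, of "root_at (e, j)" "of_nat k ^ e"] rat_abs_k[OF assms(2)] rat_abs_uminus[OF pr] by metis
  also have "\<dots> \<le> 1 * PP i (int (l i * w i) * int e)" using k_power_dvd[OF assms] by simp
  finally show ?thesis using PP_pos[OF assms(2)] mult_le_cancel_right_pos by blast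
qed

text \<open>The p_i-adic unit by which k^(m_i) differs from b^W.\<close>

definition unit_part :: "'a \<Rightarrow> rat" where
  "unit_part i = of_nat k ^ m i / of_nat b ^ W"

lemma rat_abs_b: assumes "i \<in> I" shows "rat_abs (p i) (of_nat b) = PP i (int (l i))"
  unfolding b_def by (rule N_base_power[OF assms])

lemma rat_abs_unit_part: assumes "i \<in> I" shows "rat_abs (p i) (unit_part i ^ e) = 1"
proof -
  note pr = prime_p[OF assms]
  have bp: "of_nat b ^ W \<noteq> (0::rat)" using b_pos by simp
  have "unit_part i * of_nat b ^ W = of_nat k ^ m i" using bp by (simp add: unit_part_def)
  hence "rat_abs (p i) (unit_part i) * rat_abs (p i) (of_nat b) ^ W = rat_abs (p i) (of_nat k ^ m i)"
    using rat_abs_mult[OF pr] rat_abs_power[OF pr] by metis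
  also have "\<dots> = PP i (int (l i) * int W)"
    unfolding rat_abs_k[OF assms] w_m[OF assms, symmetric] by (simp add: mult.assoc)
  also have "rat_abs (p i) (of_nat b) ^ W = PP i (int (l i) * int W)"
    unfolding rat_abs_b[OF assms] padic.P_mult_nat[OF padic[OF assms]] ..
  finally have "rat_abs (p i) (unit_part i) = 1" using PP_pos[OF assms, of "int (l i) * int W"]
    by (metis less_irrefl mult_cancel_right2)
  thus ?thesis using rat_abs_power[OF pr] by simp
qed

text \<open>Separates the factor that F_i picks up under n \<mapsto> k^e n + j into a power of b
  common to all i, which the digits ignore, and a unit depending on i.\<close>

lemma iota_k_power:
  assumes "i \<in> I"
  shows "iota (of_nat k ^ e) ^ m i = scal (int (W * e)) * iota (unit_part i ^ e)"
proof -
  interpret padic "p i" "K i" "N i" iota by (rule padic[OF assms])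
  have bp: "of_nat b ^ W \<noteq> (0::rat)" using b_pos by simp
  have "(of_nat k ^ e) ^ m i = (of_nat k ^ m i) ^ e" by (simp flip: power_mult add: mult.commute)
  also have "of_nat k ^ m i = of_nat b ^ W * unit_part i" using bp by (simp add: unit_part_def)
  also have "\<dots> ^ e = of_nat b powi (int (W * e)) * unit_part i ^ e"
    by (simp add: power_mult_distrib power_mult del: of_nat_mult)
  finally show ?thesis unfolding scal_def by (simp only: iota_power[symmetric] iota_mult[symmetric])
qed

text \<open>Up to the relative precision that the digits see, the i-th component of the kernel
  element at n is b^(W e) u^e (n - r)^(m_i) G_i(q), where u is \<open>unit_part i\<close> and r the
  new root. Once e is large enough to freeze G_i at q, only r and the residue of u^e remain.\<close>

lemma kseq_eqI:
  assumes good: "(e, j) \<in> good" "(e', j') \<in> good" and root: "root_at (e, j) = root_at (e', j')"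
    and unit: "\<And>i. i \<in> I \<Longrightarrow> rat_abs (p i) (unit_part i ^ e - unit_part i ^ e') \<le> PP i (int (l i * d))"
    and close: "\<And>i n. i \<in> I \<Longrightarrow> N i (G i (of_nat (k ^ e * n + j)) - G i (iota q)) \<le> PP i (int (l i * d)) * N i (G i (iota q))"
      "\<And>i n. i \<in> I \<Longrightarrow> N i (G i (of_nat (k ^ e' * n + j')) - G i (iota q)) \<le> PP i (int (l i * d)) * N i (G i (iota q))"
  shows "kseq (e, j) = kseq (e', j')"
proof
  fix n
  \<comment> \<open>The difference of the two exponents of b, to be discarded by
    \<open>isdig_scale\<close>.\<close>
  define c where "c = int (W * e') - int (W * e)"
  define A A' where "A = k ^ e * n + j" and "A' = k ^ e' * n + j'"
  have "a A = a A'"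
  proof (rule isdig_scale[OF digits digits _ _ _ d_pos])
    fix i assume i: "i \<in> I"
    interpret padic "p i" "K i" "N i" iota by (rule padic[OF i])
    define X X' z where "X = G i (of_nat A)" and "X' = G i (of_nat A')"
      and "z = iota (of_nat n - root_at (e, j)) ^ m i"
    define U U' where "U = iota (unit_part i ^ e)" and "U' = iota (unit_part i ^ e')"
    \<comment> \<open>The factored values of F_i at A and A'. Both contain the same z because the
      new roots coincide.\<close>
    define Y Y' where "Y = scal (int (W * e)) * U * z * X" and "Y' = scal (int (W * e')) * U' * z * X'"
    define g where "g = N i (G i (iota q))"
    have sK [simp]: "scal r \<in> K i" for r by (rule scal_K[OF i])
    have K [simp]: "X \<in> K i" "X' \<in> K i" "z \<in> K i" "U \<in> K i" "U' \<in> K i" "G i (iota q) \<in> K i"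
      "F i (of_nat r) \<in> K i" for r
      unfolding X_def X'_def z_def U_def U'_def
      by (intro G_K F_K i q_ints integers_of_nat K_power K_iota)+
    have YK [simp]: "Y \<in> K i" "Y' \<in> K i" by (simp_all add: Y_def Y'_def)
    have gp: "g > 0" using G_nz[OF i q_ints[OF i]] N_nonneg[OF K(6)] by (simp add: g_def order_less_le)
    have NU: "N i U = 1" "N i U' = 1" unfolding U_def U'_def N_iota by (rule rat_abs_unit_part[OF i])+
    have ld: "PP i (int (l i * d)) < 1"
    proof -
      have "1 * 1 \<le> l i * d" by (intro mult_le_mono l_pos i d_pos)
      hence "PP i (int (l i * d)) < PP i 0" unfolding PP_less[OF i] by linarith
      thus ?thesis by simp
    qed
    have "N i (X' - G i (iota q)) \<le> PP i (int (l i * d)) * g"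
      using close(2)[OF i, of n, folded A'_def] unfolding X'_def g_def .
    also have "\<dots> < 1 * g" by (rule mult_strict_right_mono[OF ld gp])
    finally have "N i (X' - G i (iota q)) < g" by simp
    hence "N i (G i (iota q) - X') < N i (G i (iota q))"
      using N_commute[of X' "G i (iota q)"] by (simp add: g_def)
    hence NX': "N i X' = g" unfolding g_def by (intro N_eq_of_close) simp_all
    have FY: "N i (F i (of_nat A) - Y) = 0"
      using F_G[OF i of_nat_ints[OF i], of A]
      unfolding kseq_arg[OF i, of e n j, folded A_def] power_mult_distrib iota_k_power[OF i]
      unfolding Y_def U_def z_def X_def by (simp only: mult.assoc)
    have FY': "N i (F i (of_nat A') - Y') = 0"
      using F_G[OF i of_nat_ints[OF i], of A']
      unfolding kseq_arg[OF i, of e' n j', folded A'_def] power_mult_distrib iota_k_power[OF i]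
      unfolding Y'_def U'_def z_def root X'_def by (simp only: mult.assoc)
    have NF': "N i (F i (of_nat A')) = N i (scal (int (W * e'))) * N i z * g"
    proof -
      have "N i (F i (of_nat A')) = N i Y'" using FY' by (intro N_cong) simp_all
      thus ?thesis by (simp add: Y'_def N_mult NU NX')
    qed
    \<comment> \<open>What still differs is the units, close by \<open>unit\<close>, and the
      cofactors, both close to G_i(q).\<close>
    have diff: "N i (U' * X' - U * X) \<le> PP i (int (l i * d)) * g"
    proof -
      have "U' * X' - U * X = (U' - U) * X' + U * ((X' - G i (iota q)) - (X - G i (iota q)))"
        by (simp add: algebra_simps)
      also have "N i \<dots> \<le> PP i (int (l i * d)) * g"
      proof (rule N_add_le)
        have "N i (U' - U) = rat_abs (p i) (unit_part i ^ e' - unit_part i ^ e)"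
          unfolding U_def U'_def iota_diff[symmetric] by (rule N_iota)
        also have "\<dots> \<le> PP i (int (l i * d))"
          using unit[OF i] rat_abs_uminus[OF prime_p, of "unit_part i ^ e - unit_part i ^ e'"] by simp
        finally show "N i ((U' - U) * X') \<le> PP i (int (l i * d)) * g"
          using gp by (simp add: N_mult NX')
        have "N i ((X' - G i (iota q)) - (X - G i (iota q))) \<le> PP i (int (l i * d)) * g"
          using close[OF i, of n, folded A_def A'_def]
          by (intro N_diff_le[of "X' - G i (iota q)" "X - G i (iota q)"]) (simp_all add: X_def[symmetric] X'_def[symmetric] g_def)
        thus "N i (U * ((X' - G i (iota q)) - (X - G i (iota q)))) \<le> PP i (int (l i * d)) * g"
          using N_mult[of U "(X' - G i (iota q)) - (X - G i (iota q))"] NU by simp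
      qed simp_all
      finally show ?thesis .
    qed
    have "scal (int (W * e')) = scal c * scal (int (W * e))"
      unfolding scal_add[OF i, symmetric] c_def by simp
    hence "Y' - scal c * Y = scal (int (W * e')) * z * (U' * X' - U * X)"
      unfolding Y_def Y'_def by (simp add: algebra_simps)
    hence "N i (Y' - scal c * Y) = N i (scal (int (W * e'))) * N i z * N i (U' * X' - U * X)"
      by (simp add: N_mult)
    also have "\<dots> \<le> N i (scal (int (W * e'))) * N i z * (PP i (int (l i * d)) * g)"
      using diff by (intro mult_left_mono mult_nonneg_nonneg N_nonneg) simp_all
    also have "\<dots> = PP i (int (l i * d)) * N i (F i (of_nat A'))"
      unfolding NF' by simp
    finally have YY: "N i (Y' - scal c * Y) \<le> PP i (int (l i * d)) * N i (F i (of_nat A'))" .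
    have "F i (of_nat A') - scal c * F i (of_nat A)
        = ((F i (of_nat A') - Y') + (Y' - scal c * Y)) - scal c * (F i (of_nat A) - Y)"
      by (simp add: algebra_simps)
    also have "N i \<dots> \<le> PP i (int (l i * d)) * N i (F i (of_nat A'))"
    proof (rule N_diff_le)
      show "N i (scal c * (F i (of_nat A) - Y)) \<le> PP i (int (l i * d)) * N i (F i (of_nat A'))"
        using FY N_mult[of "scal c" "F i (of_nat A) - Y"] by simp
      show "N i ((F i (of_nat A') - Y') + (Y' - scal c * Y)) \<le> PP i (int (l i * d)) * N i (F i (of_nat A'))"
        using FY' YY by (intro N_add_le[of "F i (of_nat A') - Y'" "Y' - scal c * Y"]) simp_all
    qed simp_all
    finally show "N i (F i (of_nat A') - scal c * F i (of_nat A))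
        \<le> PP i (int (l i * d)) * N i (F i (of_nat A'))" .
  qed (use F_K in simp_all)
  thus "kseq (e, j) n = kseq (e', j') n" by (simp add: kseq_def A_def A'_def)
qed

text \<open>The root is kept beside the sequence because the closure argument for the kernel must
  know where the root lies. Small e leave finitely many j; for large e the root and the residues of
  the unit powers suffice.\<close>

lemma finite_states: "finite ((\<lambda>s. (root_at s, kseq s)) ` good)"
proof -
  have "\<exists>C>0. \<forall>i\<in>I. \<forall>x\<in>ints i. \<forall>y\<in>ints i. N i (G i x - G i y) \<le> C * N i (x - y)"
    by (rule family_Lipschitz[OF G_analytic])
  then obtain C where C: "C > 0"
    "\<And>i x y. i \<in> I \<Longrightarrow> x \<in> ints i \<Longrightarrow> y \<in> ints i \<Longrightarrow> N i (G i x - G i y) \<le> C * N i (x - y)" by blast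
  \<comment> \<open>C times this is the tolerance that \<open>kseq_eqI\<close> grants to G_i. For e
    \<ge> E0 the distance of k^e n + j from q is below it.\<close>
  define \<epsilon> where "\<epsilon> = (\<lambda>i. PP i (int (l i * d)) * N i (G i (iota q)) / C)"
  have Gq: "N i (G i (iota q)) > 0" if "i \<in> I" for i
    using G_nz[OF that q_ints[OF that]] padic.N_nonneg[OF padic[OF that] G_K[OF that q_ints[OF that]]]
    by (simp add: order_less_le)
  have "\<epsilon> i > 0" if "i \<in> I" for i using Gq[OF that] PP_pos[OF that] C(1) by (simp add: \<epsilon>_def)
  moreover have "1 \<le> l i * w i" if "i \<in> I" for i using mult_le_mono[OF l_pos[OF that] w_pos[OF that]] by simp
  ultimately obtain E0 where E0: "\<And>i. i \<in> I \<Longrightarrow> PP i (int (l i * w i) * int E0) < \<epsilon> i"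
    using eventually_PP_less[of \<epsilon> "\<lambda>i. l i * w i"] by blast
  have close: "N i (G i (of_nat (k ^ e * n + j)) - G i (iota q)) \<le> PP i (int (l i * d)) * N i (G i (iota q))"
    if ej: "(e, j) \<in> good" "e \<ge> E0" and i: "i \<in> I" for e j n i
  proof -
    interpret padic "p i" "K i" "N i" iota by (rule padic[OF i])
    have r: "rat_abs (p i) (of_nat n - root_at (e, j)) \<le> 1"
    proof -
      have "iota (root_at (e, j)) \<in> integers" using root_at_int[OF ej(1) i] N_iota by (intro integersI) simp_all
      hence "of_nat n - iota (root_at (e, j)) \<in> integers" by (intro integers_diff) simp_all
      hence "N i (iota (of_nat n - root_at (e, j))) \<le> 1" using integers_N by (simp add: iota_diff)
      thus ?thesis by (simp only: N_iota)
    qed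
    have "N i (of_nat (k ^ e * n + j) - iota q) = rat_abs (p i) (of_nat k ^ e) * rat_abs (p i) (of_nat n - root_at (e, j))"
      unfolding kseq_arg[OF i] by (simp only: N_mult K_iota N_iota)
    also have "\<dots> \<le> PP i (int (l i * w i) * int e) * 1"
      unfolding rat_abs_k[OF i] using r by (intro mult_left_mono) (simp_all add: less_imp_le)
    also have "\<dots> \<le> PP i (int (l i * w i) * int E0)"
      using ej(2) by (simp only: PP_le[OF i] mult_1_right) (intro mult_left_mono, simp_all)
    also have "\<dots> \<le> \<epsilon> i" using E0[OF i] by simp
    finally have "C * N i (of_nat (k ^ e * n + j) - iota q) \<le> C * \<epsilon> i" using C(1) by simp
    also have "C * \<epsilon> i = PP i (int (l i * d)) * N i (G i (iota q))" using C(1) by (simp add: \<epsilon>_def)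
    finally show ?thesis using C(2)[OF i of_nat_ints[OF i, of "k ^ e * n + j"] q_ints[OF i]] by linarith
  qed
  \<comment> \<open>The residue of the unit power modulo p_i^(l_i d) is the finite datum that
    replaces e.\<close>
  have "\<exists>r. i \<in> I \<longrightarrow> r < p i ^ (l i * d) \<and> rat_abs (p i) (unit_part i ^ e - of_nat r) \<le> PP i (int (l i * d))" for e i
  proof (cases "i \<in> I")
    case i: True
    interpret padic "p i" "K i" "N i" iota by (rule padic[OF i])
    have "iota (unit_part i ^ e) \<in> integers" using rat_abs_unit_part[OF i] N_iota by (intro integersI) simp_all
    then obtain r where "r < p i ^ (l i * d)" "N i (iota (unit_part i ^ e) - of_nat r) \<le> PP i (int (l i * d))"
      using ex_nat_approx_below by blast
    thus ?thesis using N_iota[of "unit_part i ^ e - of_nat r"] by (intro exI[of _ r]) (simp add: iota_diff)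
  qed simp
  hence "\<exists>r. \<forall>x. snd x \<in> I \<longrightarrow> r x < p (snd x) ^ (l (snd x) * d) \<and>
      rat_abs (p (snd x)) (unit_part (snd x) ^ fst x - of_nat (r x)) \<le> PP (snd x) (int (l (snd x) * d))"
    by (intro choice allI)
  then obtain r0 where r0: "\<And>x. snd x \<in> I \<Longrightarrow> r0 x < p (snd x) ^ (l (snd x) * d)"
    "\<And>x. snd x \<in> I \<Longrightarrow>
      rat_abs (p (snd x)) (unit_part (snd x) ^ fst x - of_nat (r0 x)) \<le> PP (snd x) (int (l (snd x) * d))"
    by blast
  define r where "r = (\<lambda>e i. r0 (e, i))"
  have r: "r e i < p i ^ (l i * d)"
    "rat_abs (p i) (unit_part i ^ e - of_nat (r e i)) \<le> PP i (int (l i * d))" if "i \<in> I" for e i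
    using r0[of "(e, i)"] that by (simp_all add: r_def del: of_nat_mult)
  define inv' where "inv' = (\<lambda>s. (root_at s, restrict (r (fst s)) I))"
  define S1 S2 where "S1 = {s \<in> good. fst s < E0}" and "S2 = {s \<in> good. E0 \<le> fst s}"
  have "S1 \<subseteq> (SIGMA e:{..<E0}. {..<k ^ e})" by (auto simp: S1_def good_def)
  hence f1: "finite S1" using finite_subset by blast
  have "inv' ` S2 \<subseteq> root_at ` good \<times> PiE I (\<lambda>i. {..<p i ^ (l i * d)})"
    using r(1) by (auto simp: inv'_def S2_def)
  moreover have "finite (root_at ` good \<times> PiE I (\<lambda>i. {..<p i ^ (l i * d)}))"
    using finite_root_at finite_I by (intro finite_cartesian_product finite_PiE) auto
  ultimately have f2: "finite (inv' ` S2)" using finite_subset by blast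
  have "finite ((\<lambda>s. (root_at s, kseq s)) ` S2)"
  proof (rule finite_by_invariant[OF f2])
    fix s s' assume s: "s \<in> S2" "s' \<in> S2" and eq: "inv' s = inv' s'"
    obtain e j e' j' where ss: "s = (e, j)" "s' = (e', j')" by (cases s, cases s') auto
    have root: "root_at (e, j) = root_at (e', j')" using eq by (simp add: inv'_def ss)
    have "kseq (e, j) = kseq (e', j')"
    proof (rule kseq_eqI[OF _ _ root])
      show g: "(e, j) \<in> good" "(e', j') \<in> good" using s by (auto simp: ss S2_def)
      have E: "E0 \<le> e" "E0 \<le> e'" using s by (auto simp: ss S2_def)
      show "N i (G i (of_nat (k ^ e * n + j)) - G i (iota q)) \<le> PP i (int (l i * d)) * N i (G i (iota q))"
        "N i (G i (of_nat (k ^ e' * n + j')) - G i (iota q)) \<le> PP i (int (l i * d)) * N i (G i (iota q))"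
        if "i \<in> I" for i n using close g E that by blast+
      fix i assume i: "i \<in> I"
      have "restrict (r e) I i = restrict (r e') I i" using eq by (simp add: inv'_def ss)
      hence ri: "r e i = r e' i" using i by simp
      have "unit_part i ^ e - unit_part i ^ e'
          = (unit_part i ^ e - of_nat (r e i)) + - (unit_part i ^ e' - of_nat (r e' i))" unfolding ri by simp
      hence "rat_abs (p i) (unit_part i ^ e - unit_part i ^ e')
          \<le> max (rat_abs (p i) (unit_part i ^ e - of_nat (r e i))) (rat_abs (p i) (unit_part i ^ e' - of_nat (r e' i)))"
        using rat_abs_add[OF prime_p[OF i]] rat_abs_uminus[OF prime_p[OF i]] by metis
      thus "rat_abs (p i) (unit_part i ^ e - unit_part i ^ e') \<le> PP i (int (l i * d))"
        using r(2)[OF i, of e] r(2)[OF i, of e'] by simp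
    qed
    thus "(root_at s, kseq s) = (root_at s', kseq s')" using root by (simp add: ss)
  qed
  moreover have "good = S1 \<union> S2" by (auto simp: S1_def S2_def)
  ultimately show ?thesis using f1 by (simp add: image_Un)
qed

text \<open>The finite closed set has two kinds of members: kernel elements that still see the root,
  and sequences of period b^E' with values less than b^d. A substitution n \<mapsto> k n + c either
  keeps the root in view or leads to the second kind, which is closed under such
  substitutions.\<close>

lemma finite_kernel: "finite (kernel k a)"
proof -
  define bad where "bad = (\<lambda>(t::rat) c. \<exists>i\<in>I. PP i (int (l i * w i)) < rat_abs (p i) (of_nat c - t))"
  \<comment> \<open>A property of the state instead of (e, j): since there are finitely many states,
    one modulus b^E' serves them all.\<close>
  define Q where "Q = (\<lambda>(t, h) E. \<forall>c. bad t c \<longrightarrow>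
      (\<forall>n n'. [n = n'] (mod (b ^ E)) \<longrightarrow> h (k * n + c) = (h (k * n' + c) :: nat)))"
  have arg: "rat_abs (p i) (of_nat (k ^ e * x + j) - q) = PP i (int (l i * w i) * int e) * rat_abs (p i) (of_nat x - root_at (e, j))"
    if "i \<in> I" for i e j x
  proof -
    have "of_nat (k ^ e * x + j) - q = of_nat k ^ e * (of_nat x - root_at (e, j))"
      using k_pos by (simp add: root_at_def field_simps)
    thus ?thesis by (simp only: rat_abs_mult[OF prime_p[OF that]] rat_abs_k[OF that])
  qed
  have Suc_w: "PP i (int (l i * w i) * int (Suc e)) = PP i (int (l i * w i) * int e) * PP i (int (l i * w i))"
    if "i \<in> I" for i e unfolding PP_add[OF that, symmetric] by (simp add: algebra_simps)
  have exQ: "\<exists>E. Q (root_at s, kseq s) E" if "s \<in> good" for s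
  proof -
    obtain e j where s: "s = (e, j)" by (cases s)
    obtain E where E: "\<And>n n'. (\<exists>i\<in>I. PP i (int (l i * w i) * int (Suc e)) < N i (of_nat n - iota q)) \<Longrightarrow>
        [n = n'] (mod (b ^ E)) \<Longrightarrow> a n = a n'"
      using constant_off_root[of "Suc e"] by blast
    have "kseq (e, j) (k * n + c) = kseq (e, j) (k * n' + c)"
      if bd: "bad (root_at (e, j)) c" and cg: "[n = n'] (mod (b ^ E))" for c n n'
    proof -
      obtain i where i: "i \<in> I" "PP i (int (l i * w i)) < rat_abs (p i) (of_nat c - root_at (e, j))"
        using bd unfolding bad_def by blast
      interpret padic "p i" "K i" "N i" iota by (rule padic[OF i(1)])
      have kn: "rat_abs (p i) (of_nat (k * n)) \<le> PP i (int (l i * w i))"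
      proof -
        have "rat_abs (p i) (of_nat (k * n)) = PP i (int (l i * w i)) * rat_abs (p i) (of_nat n)"
          using rat_abs_k[OF i(1), of 1] by (simp add: rat_abs_mult[OF prime_p])
        moreover have "rat_abs (p i) (of_nat n) \<le> 1"
          using N_of_nat_le_1[of n] N_iota[of "of_nat n"] by simp
        ultimately show ?thesis using P_pos[of "int (l i * w i)"] by (simp add: mult_left_le)
      qed
      \<comment> \<open>Being farther from the root than k depends only on the class modulo k, so it
        passes from c to every k n + c.\<close>
      have "PP i (int (l i * w i)) < rat_abs (p i) (of_nat (k * n + c) - root_at (e, j))"
      proof (rule ccontr)
        assume "\<not> ?thesis"
        moreover have "of_nat c - root_at (e, j) = (of_nat (k * n + c) - root_at (e, j)) + - of_nat (k * n)" by simp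
        hence "rat_abs (p i) (of_nat c - root_at (e, j))
            \<le> max (rat_abs (p i) (of_nat (k * n + c) - root_at (e, j))) (rat_abs (p i) (of_nat (k * n)))"
          using rat_abs_add[OF prime_p] rat_abs_uminus[OF prime_p] by metis
        ultimately show False using kn i(2) by linarith
      qed
      hence "PP i (int (l i * w i) * int (Suc e)) < rat_abs (p i) (of_nat (k ^ e * (k * n + c) + j) - q)"
        unfolding Suc_w[OF i(1)] arg[OF i(1)] by simp
      also have "rat_abs (p i) (of_nat (k ^ e * (k * n + c) + j) - q) = N i (of_nat (k ^ e * (k * n + c) + j) - iota q)"
        using N_iota[of "of_nat (k ^ e * (k * n + c) + j) - q"] by (simp only: iota_diff iota_of_nat)
      finally have "\<exists>i\<in>I. PP i (int (l i * w i) * int (Suc e)) < N i (of_nat (k ^ e * (k * n + c) + j) - iota q)"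
        using i(1) by blast
      moreover have "[k ^ e * (k * n + c) + j = k ^ e * (k * n' + c) + j] (mod (b ^ E))"
        using cg by (intro cong_add cong_mult cong_refl)
      ultimately show ?thesis using E by (simp add: kseq_def)
    qed
    thus ?thesis unfolding Q_def s by blast
  qed
  have mono: "Q x E'" if "Q x E" "E \<le> E'" for x E E'
  proof -
    have "[n = n'] (mod (b ^ E))" if "[n = n'] (mod (b ^ E'))" for n n'
      using that \<open>E \<le> E'\<close> cong_dvd_modulus_nat le_imp_power_dvd by blast
    thus ?thesis using that(1) unfolding Q_def by (cases x) blast
  qed
  define D where "D = (\<lambda>s. (root_at s, kseq s)) ` good"
  have "\<forall>x\<in>D. \<exists>E. Q x E" using exQ by (auto simp: D_def)
  then obtain E where E: "\<And>x. x \<in> D \<Longrightarrow> Q x (E x)" by metis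
  have finD: "finite D" unfolding D_def by (rule finite_states)
  define E' where "E' = Max (insert 0 (E ` D))"
  have E': "Q (root_at s, kseq s) E'" if "s \<in> good" for s
  proof (rule mono[OF E])
    show "(root_at s, kseq s) \<in> D" using that by (simp add: D_def)
    thus "E (root_at s, kseq s) \<le> E'" unfolding E'_def using finD by (intro Max_ge) auto
  qed
  define T where "T = snd ` D \<union> {h. (\<forall>n n'. [n = n'] (mod (b ^ E')) \<longrightarrow> h n = h n') \<and> (\<forall>n. h n < b ^ d)}"
  have "finite T" unfolding T_def using finD finite_mod_periodic[of "b ^ E'"] b_pos by simp
  moreover have "a \<in> T"
  proof -
    have "(0, 0) \<in> good" using q_int by (auto simp: good_def rat_abs_uminus[OF prime_p])
    moreover have "kseq (0, 0) = a" by (auto simp: kseq_def)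
    ultimately show ?thesis unfolding T_def D_def by force
  qed
  moreover have "(\<lambda>n. h (k * n + c)) \<in> T" if h: "h \<in> T" and c: "c < k" for h c
  proof (cases "h \<in> snd ` D")
    case True
    then obtain e j where s: "(e, j) \<in> good" "h = kseq (e, j)" by (auto simp: D_def)
    show ?thesis
    proof (cases "bad (root_at (e, j)) c")
      case True
      hence "\<forall>n n'. [n = n'] (mod (b ^ E')) \<longrightarrow> h (k * n + c) = h (k * n' + c)"
        using E'[OF s(1)] unfolding Q_def s(2) by blast
      moreover have "h (k * n + c) < b ^ d" for n unfolding s(2) kseq_def by (simp add: a_less)
      ultimately show ?thesis unfolding T_def by blast
    next
      case False
      have jk: "j < k ^ e" using s(1) by (simp add: good_def)
      have "k ^ e * c + j < k ^ e * c + k ^ e" using jk by simp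
      also have "\<dots> = k ^ e * Suc c" by simp
      also have "\<dots> \<le> k ^ e * k" using c by (intro mult_le_mono) auto
      finally have "k ^ e * c + j < k ^ Suc e" by (simp add: mult.commute)
      moreover have "rat_abs (p i) (of_nat (k ^ e * c + j) - q) \<le> PP i (int (l i * w i) * int (Suc e))" if "i \<in> I" for i
        unfolding arg[OF that] Suc_w[OF that] using False that PP_pos[OF that]
        by (intro mult_left_mono) (auto simp: bad_def not_less less_imp_le)
      ultimately have g: "(Suc e, k ^ e * c + j) \<in> good" by (simp add: good_def)
      have "(\<lambda>n. h (k * n + c)) = kseq (Suc e, k ^ e * c + j)"
        by (simp add: s(2) kseq_def fun_eq_iff algebra_simps)
      thus ?thesis unfolding T_def D_def using g by force
    qed
  next
    case False
    hence "\<forall>n n'. [n = n'] (mod (b ^ E')) \<longrightarrow> h n = h n'" "\<And>n. h n < b ^ d" using h by (auto simp: T_def)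
    moreover have "[k * n + c = k * n' + c] (mod (b ^ E'))" if "[n = n'] (mod (b ^ E'))" for n n'
      using that by (intro cong_add cong_mult cong_refl)
    ultimately show ?thesis unfolding T_def by blast
  qed
  ultimately show ?thesis using k_pos by (intro finite_kernelI)
qed

end

section \<open>Kernels at a common root\<close>

text \<open>The factorization is at one chosen common root. Each F_i may have further roots, so H_i
  is known to be nonzero only at th i.\<close>

locale common_root = analytic_family +
  fixes th :: "'a \<Rightarrow> 'b" and mu :: "'a \<Rightarrow> nat" and H :: "'a \<Rightarrow> 'b \<Rightarrow> 'b" and ch :: "'a \<Rightarrow> nat \<Rightarrow> 'b"
  assumes two_primes: "i \<in> I \<Longrightarrow> \<exists>j\<in>I. j \<noteq> i" and I_nonempty: "I \<noteq> {}"
    and th_int: "i \<in> I \<Longrightarrow> th i \<in> ints i" and mu_pos: "i \<in> I \<Longrightarrow> 0 < mu i"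
    and H_analytic: "i \<in> I \<Longrightarrow> padic.analytic_with (K i) (N i) (ch i) (H i)"
    and H_nz: "i \<in> I \<Longrightarrow> N i (H i (th i)) \<noteq> 0"
    and F_H: "i \<in> I \<Longrightarrow> x \<in> ints i \<Longrightarrow> N i (F i x - (x - th i) ^ mu i * H i x) = 0"
begin

lemma H_K: "i \<in> I \<Longrightarrow> x \<in> ints i \<Longrightarrow> H i x \<in> K i"
  using padic.analytic_withD(2)[OF padic H_analytic] by blast

text \<open>The additive constant c_i in the formula for the valuation of F_i near the root.\<close>

definition cH :: "'a \<Rightarrow> int" where "cH i = (SOME c. N i (H i (th i)) = PP i c)"

lemma cH: assumes "i \<in> I" shows "N i (H i (th i)) = PP i (cH i)"
  unfolding cH_def by (rule someI_ex[OF padic.N_values[OF padic[OF assms] H_K[OF assms th_int[OF assms]] H_nz[OF assms]]])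

text \<open>The value \<open>\<lfloor>\<nu>(F\<^sub>i(x)) / l\<^sub>i\<rfloor>\<close> for \<open>x\<close> near the root with \<open>\<nu>(x - \<theta>\<^sub>i) = T\<close>.\<close>

definition V :: "'a \<Rightarrow> int \<Rightarrow> int" where "V i T = (int (mu i) * T + cH i) div int (l i)"

lemma le_V: "i \<in> I \<Longrightarrow> v \<le> V i T \<longleftrightarrow> int (l i) * v \<le> int (mu i) * T + cH i"
  unfolding V_def using l_pos[of i] by (intro int_le_div_iff) simp

lemma V_unbounded: assumes "i \<in> I" shows "\<exists>t. t \<ge> t0 \<and> B \<le> V i (c + int t)"
proof -
  define t where "t = max t0 (nat (int (l i) * B - cH i - c) + nat (- c))"
  have "t \<ge> nat (int (l i) * B - cH i - c) + nat (- c)" unfolding t_def by (rule max.cobounded2)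
  hence *: "c + int t \<ge> int (l i) * B - cH i" "c + int t \<ge> 0" by linarith+
  have "int (l i) * B - cH i \<le> 1 * (c + int t)" using * by simp
  also have "\<dots> \<le> int (mu i) * (c + int t)" using *(2) mu_pos[OF assms] by (intro mult_right_mono) auto
  finally have "B \<le> V i (c + int t)" unfolding le_V[OF assms] by simp
  thus ?thesis by (intro exI[of _ t]) (simp add: t_def)
qed

definition near :: "int \<Rightarrow> bool" where
  "near T0 \<longleftrightarrow> (\<forall>i\<in>I. \<forall>x\<in>ints i. \<forall>T\<ge>T0. N i (x - th i) = PP i T \<longrightarrow>
     N i (F i x) = PP i (int (mu i) * T + cH i))"

text \<open>Near the root the Lipschitz bound keeps the seminorm of the cofactor at its value there,
  so only the power of x - \<theta>_i varies.\<close>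

lemma ex_near: "\<exists>T0. near T0 \<and> 0 \<le> T0"
proof -
  obtain C where C: "C > 0"
    "\<And>i x y. i \<in> I \<Longrightarrow> x \<in> ints i \<Longrightarrow> y \<in> ints i \<Longrightarrow> N i (H i x - H i y) \<le> C * N i (x - y)"
    using family_Lipschitz[OF H_analytic] by blast
  obtain E where E: "\<And>i. i \<in> I \<Longrightarrow> PP i (int 1 * int E) < PP i (cH i) / C"
    using eventually_PP_less[of "\<lambda>i. PP i (cH i) / C" "\<lambda>_. 1"] C(1) PP_pos by auto
  have "N i (F i x) = PP i (int (mu i) * T + cH i)"
    if i: "i \<in> I" and x: "x \<in> ints i" and T: "int E \<le> T" "N i (x - th i) = PP i T" for i x T
  proof -
    interpret padic "p i" "K i" "N i" iota by (rule padic[OF i])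
    note K = H_K[OF i x] H_K[OF i th_int[OF i]] F_K[OF i x] integersD[OF x] integersD[OF th_int[OF i]]
    have "PP i T \<le> PP i (int E)" unfolding PP_le[OF i] by (rule T(1))
    hence "C * N i (th i - x) \<le> C * PP i (int E)"
      using C(1) T(2) N_commute[OF K(4,5)] by simp
    also have "\<dots> < PP i (cH i)" using E[OF i] C(1) by (simp add: field_simps)
    finally have "N i (H i (th i) - H i x) < N i (H i (th i))"
      using C(2)[OF i th_int[OF i] x] cH[OF i] by linarith
    hence Hx: "N i (H i x) = PP i (cH i)" using N_eq_of_close[OF K(2,1)] cH[OF i] by simp
    have "N i (F i x) = N i ((x - th i) ^ mu i * H i x)" using K F_H[OF i x] by (intro N_cong) simp_all
    also have "\<dots> = PP i T ^ mu i * PP i (cH i)" using K Hx T(2) by (simp add: N_mult N_power)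
    also have "\<dots> = PP i (int (mu i) * T + cH i)"
      unfolding P_add P_mult_nat[symmetric] by (simp only: mult.commute)
    finally show ?thesis .
  qed
  thus ?thesis unfolding near_def by (intro exI[of _ "int E"]) auto
qed

text \<open>Modulo p_i^(l_i) the digit agrees with b^(-v) F_i(n), where v is the least of the V j (T
  j). As d \<ge> 1, this congruence is contained in the one that defines the digit block.\<close>

lemma digit_divisible:
  assumes "near T0" "\<And>j. j \<in> I \<Longrightarrow> T0 \<le> T j" "\<And>j. j \<in> I \<Longrightarrow> N j (of_nat n - th j) = PP j (T j)" "i \<in> I"
  shows "p i ^ l i dvd a n \<longleftrightarrow> (\<exists>j\<in>I. V j (T j) < V i (T i))"
proof -
  have NF: "N j (F j (of_nat n)) = PP j (int (mu j) * T j + cH j)" if "j \<in> I" for j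
    using assms(1,2,3) of_nat_ints that unfolding near_def by blast
  have NF_le: "N j (F j (of_nat n)) \<le> PP j (int (l j) * v) \<longleftrightarrow> v \<le> V j (T j)" if "j \<in> I" for j v
    unfolding NF[OF that] PP_le[OF that] le_V[OF that] ..
  interpret padic "p i" "K i" "N i" iota by (rule padic[OF assms(4)])
  have "N i (F i (of_nat n)) \<noteq> 0" unfolding NF[OF assms(4)] using P_pos by (metis less_irrefl)
  then obtain v where v: "isnu (\<lambda>j. F j (of_nat n)) v"
    "N i (of_nat (a n) - scal (- v) * F i (of_nat n)) \<le> PP i (int (l i * d))"
    using digits[of n] assms(4) unfolding isdig_def by blast
  have vV: "v \<le> V j (T j)" if "j \<in> I" for j using v(1) that NF_le unfolding isnu_def by blast
  obtain j where j: "j \<in> I" "\<not> v + 1 \<le> V j (T j)"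
    using v(1) NF_le unfolding isnu_def by (meson not_less)
  have FK [simp]: "F i (of_nat n) \<in> K i" "scal (- v) \<in> K i"
    using F_K[OF assms(4) of_nat_ints[OF assms(4)]] scal_K[OF assms(4)] by auto
  have "l i * 1 \<le> l i * d" using d_pos by (rule mult_le_mono2)
  hence "int (l i) \<le> int (l i * d)" by linarith
  hence "PP i (int (l i * d)) \<le> PP i (int (l i))" unfolding P_le .
  hence close: "N i (of_nat (a n) - scal (- v) * F i (of_nat n)) \<le> PP i (int (l i))" using v(2) by linarith
  have "p i ^ l i dvd a n \<longleftrightarrow> N i (of_nat (a n)) \<le> PP i (int (l i))" by (simp only: N_of_nat_le)
  also have "\<dots> \<longleftrightarrow> N i (scal (- v) * F i (of_nat n)) \<le> PP i (int (l i))"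
  proof
    assume "N i (of_nat (a n)) \<le> PP i (int (l i))"
    hence "N i (of_nat (a n) - (of_nat (a n) - scal (- v) * F i (of_nat n))) \<le> PP i (int (l i))"
      using close by (intro N_diff_le[of "of_nat (a n)" "of_nat (a n) - scal (- v) * F i (of_nat n)"]) simp_all
    thus "N i (scal (- v) * F i (of_nat n)) \<le> PP i (int (l i))" by simp
  next
    assume "N i (scal (- v) * F i (of_nat n)) \<le> PP i (int (l i))"
    hence "N i ((of_nat (a n) - scal (- v) * F i (of_nat n)) + scal (- v) * F i (of_nat n)) \<le> PP i (int (l i))"
      using close by (intro N_add_le[of "of_nat (a n) - scal (- v) * F i (of_nat n)"]) simp_all
    thus "N i (of_nat (a n)) \<le> PP i (int (l i))" by simp
  qed
  also have "N i (scal (- v) * F i (of_nat n)) = PP i (int (l i) * - v) * N i (F i (of_nat n))"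
    using N_scal[OF assms(4)] by (simp add: N_mult)
  also have "\<dots> = PP i (int (l i) * - v + (int (mu i) * T i + cH i))" unfolding NF[OF assms(4)] P_add ..
  also have "\<dots> \<le> PP i (int (l i)) \<longleftrightarrow> v + 1 \<le> V i (T i)"
    unfolding P_le le_V[OF assms(4)] by (simp add: algebra_simps)
  also have "\<dots> \<longleftrightarrow> (\<exists>j\<in>I. V j (T j) < V i (T i))"
  proof
    assume "v + 1 \<le> V i (T i)"
    thus "\<exists>j\<in>I. V j (T j) < V i (T i)" using j by (intro bexI[of _ j]) linarith+
  next
    assume "\<exists>j\<in>I. V j (T j) < V i (T i)"
    thus "v + 1 \<le> V i (T i)" using vV by force
  qed
  finally show ?thesis .
qed

text \<open>Approximating x_i modulo p_i^(t_i + 1) and adding p_i^(t_i) makes the distance exact.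
  The Chinese remainder theorem does this at all primes simultaneously, so the distances are
  independent of each other.\<close>

lemma ex_nat_at_distance:
  assumes "\<And>i. i \<in> I \<Longrightarrow> x i \<in> ints i"
  shows "\<exists>n. \<forall>i\<in>I. N i (of_nat n - x i) = PP i (int (t i))"
proof -
  have "\<exists>r. i \<in> I \<longrightarrow> N i (x i - of_nat r) \<le> PP i (int (Suc (t i)))" for i
    using padic.ex_nat_approx[OF padic] assms by blast
  then obtain r where r: "\<And>i. i \<in> I \<Longrightarrow> N i (x i - of_nat (r i)) \<le> PP i (int (Suc (t i)))" by metis
  obtain n where n: "\<And>i. i \<in> I \<Longrightarrow> [n = r i + p i ^ t i] (mod (p i ^ Suc (t i)))"
    using crt[of "\<lambda>i. r i + p i ^ t i" "\<lambda>i. Suc (t i)"] by blast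
  have "N i (of_nat n - x i) = PP i (int (t i))" if i: "i \<in> I" for i
  proof -
    interpret padic "p i" "K i" "N i" iota by (rule padic[OF i])
    have xK [simp]: "x i \<in> K i" using assms[OF i] by auto
    have pt: "N i (of_nat (p i ^ t i)) = PP i (int (t i))"
      unfolding of_nat_power using N_power[OF K_of_nat] N_of_nat_p P_mult_nat[of 1 "t i"] by simp
    have 1: "N i (of_nat n - of_nat (r i + p i ^ t i)) \<le> PP i (int (Suc (t i)))"
      unfolding N_of_nat_diff_le by (rule n[OF i])
    have "of_nat (p i ^ t i) - (of_nat n - x i) = (x i - of_nat (r i)) - (of_nat n - of_nat (r i + p i ^ t i))"
      by simp
    also have "N i \<dots> \<le> PP i (int (Suc (t i)))"
      by (intro N_diff_le r i 1) simp_all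
    also have "\<dots> < N i (of_nat (p i ^ t i))" unfolding pt P_less by simp
    finally show ?thesis using pt N_eq_of_close[OF K_of_nat K_diff[OF K_of_nat xK]] by metis
  qed
  thus ?thesis by blast
qed

end

section \<open>Kernel elements for an arbitrary base of automaticity\<close>

locale automatic_root = common_root +
  fixes g :: nat
  assumes g_ge_2: "2 \<le> g" and fin_kernel: "finite (kernel g a)"
    and F_nonzero: "i \<in> I \<Longrightarrow> \<exists>x\<in>ints i. N i (F i x) \<noteq> 0"
begin

definition ex :: "'a \<Rightarrow> nat" where "ex i = multiplicity (int (p i)) (int g)"

text \<open>Closeness to th is asked at the primes p_i only. At this stage g may contain other
  primes, and then a level s has several admissible j.\<close>

definition above :: "(nat \<times> nat) set" where
  "above = {(s, j). j < g ^ s \<and> (\<forall>i\<in>I. N i (of_nat j - th i) \<le> PP i (int (ex i * s)))}"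

text \<open>The preimage of the root under n \<mapsto> g^s n + j, in each component.\<close>

definition pt :: "nat \<times> nat \<Rightarrow> 'a \<Rightarrow> 'b" where
  "pt = (\<lambda>(s, j) i. iota (1 / of_nat g ^ s) * (th i - of_nat j))"

definition hseq :: "nat \<times> nat \<Rightarrow> nat \<Rightarrow> nat" where
  "hseq = (\<lambda>(s, j) n. a (g ^ s * n + j))"

lemma N_g: assumes "i \<in> I" shows "N i (of_nat (g ^ s)) = PP i (int (ex i * s))"
proof -
  interpret padic "p i" "K i" "N i" iota by (rule padic[OF assms])
  have "N i (of_nat g) = PP i (int (ex i))" unfolding ex_def using g_ge_2 by (intro N_of_nat_eq) simp
  thus ?thesis unfolding of_nat_power N_power[OF K_of_nat] of_nat_mult P_mult_nat by simp
qed

lemma iota_g: assumes "i \<in> I" shows "of_nat (g ^ s) * iota (1 / of_nat g ^ s) = 1"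
proof -
  interpret padic "p i" "K i" "N i" iota by (rule padic[OF assms])
  have "of_nat (g ^ s) * (1 / of_nat g ^ s) = (1::rat)" using g_ge_2 by simp
  hence "iota (of_nat (g ^ s)) * iota (1 / of_nat g ^ s) = 1" by (metis iota_1 iota_mult)
  thus ?thesis by (simp only: iota_of_nat)
qed

lemma pt_eq: assumes "i \<in> I" shows "of_nat (g ^ s) * pt (s, j) i + of_nat j = th i"
  unfolding pt_def prod.case mult.assoc[symmetric] iota_g[OF assms] by simp

lemma pt_K: assumes "i \<in> I" shows "pt s i \<in> K i"
proof -
  interpret padic "p i" "K i" "N i" iota by (rule padic[OF assms])
  show ?thesis using integersD[OF th_int[OF assms]] by (cases s) (simp add: pt_def)
qed

lemma pt_int: assumes "s \<in> above" "i \<in> I" shows "pt s i \<in> ints i"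
proof -
  interpret padic "p i" "K i" "N i" iota by (rule padic[OF assms(2)])
  obtain e j where s: "s = (e, j)" by (cases s)
  have thK: "th i \<in> K i" using th_int[OF assms(2)] by auto
  have "of_nat (g ^ e) * pt (e, j) i = th i - of_nat j" using pt_eq[OF assms(2), of e j] by (simp add: eq_diff_eq)
  hence "PP i (int (ex i * e)) * N i (pt s i) = N i (th i - of_nat j)"
    unfolding s N_g[OF assms(2), symmetric] using N_mult[OF K_of_nat pt_K[OF assms(2)]] by metis
  also have "\<dots> \<le> PP i (int (ex i * e)) * 1"
    using assms N_commute[OF thK K_of_nat, of j] by (auto simp: above_def s)
  finally have "N i (pt s i) \<le> 1" using P_pos mult_le_cancel_left_pos by blast
  thus ?thesis using pt_K[OF assms(2)] by (intro integersI)
qed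

lemma N_affine:
  assumes "i \<in> I" "N i (of_nat n - pt (s, j) i) = PP i (int t)"
  shows "N i (of_nat (g ^ s * n + j) - th i) = PP i (int (ex i * s) + int t)"
proof -
  interpret padic "p i" "K i" "N i" iota by (rule padic[OF assms(1)])
  have "of_nat (g ^ s * n + j) - th i = of_nat (g ^ s) * (of_nat n - pt (s, j) i)"
    unfolding pt_eq[OF assms(1), of s j, symmetric] by (simp add: algebra_simps)
  hence "N i (of_nat (g ^ s * n + j) - th i) = N i (of_nat (g ^ s)) * N i (of_nat n - pt (s, j) i)"
    using N_mult[OF K_of_nat K_diff[OF K_of_nat pt_K[OF assms(1)]]] by (simp only:)
  thus ?thesis unfolding N_g[OF assms(1)] assms(2) P_add .
qed

text \<open>Two patterns of valuations occur arbitrarily near the point: in one i1 attains the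
  minimum and p_i1^(l_i1) does not divide the digit, in the other i2 lies strictly below i1 and it
  does.\<close>

lemma ex_separating:
  assumes "\<sigma> \<in> above"
  shows "\<exists>n n'. (\<forall>i\<in>I. N i (of_nat n - pt \<sigma> i) \<le> PP i (int t0) \<and> N i (of_nat n' - pt \<sigma> i) \<le> PP i (int t0)) \<and>
    hseq \<sigma> n \<noteq> hseq \<sigma> n'"
proof -
  obtain s j where s: "\<sigma> = (s, j)" by (cases \<sigma>)
  obtain T0 where T0: "near T0" "0 \<le> T0" using ex_near by blast
  obtain i1 where i1: "i1 \<in> I" using I_nonempty by blast
  obtain i2 where i2: "i2 \<in> I" "i2 \<noteq> i1" using two_primes[OF i1] by blast
  define u where "u = t0 + nat T0"
  define c where "c = (\<lambda>i. int (ex i * s))"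
  have "\<exists>t. i \<in> I \<longrightarrow> t \<ge> u \<and> V i1 (c i1 + int u) \<le> V i (c i + int t)" for i
    using V_unbounded by blast
  then obtain t where t: "\<And>i. i \<in> I \<Longrightarrow> t i \<ge> u \<and> V i1 (c i1 + int u) \<le> V i (c i + int (t i))" by metis
  \<comment> \<open>For n the component i1 stays at u and \<open>t\<close> lifts the others at least
    to its value; for n' only i1 is lifted, to \<open>v\<close>, above i2.\<close>
  obtain v where v: "v \<ge> u" "V i2 (c i2 + int u) + 1 \<le> V i1 (c i1 + int v)" using V_unbounded[OF i1] by blast
  define t1 t2 where "t1 = t(i1 := u)" and "t2 = (\<lambda>i. if i = i1 then v else u)"
  obtain n where n: "\<And>i. i \<in> I \<Longrightarrow> N i (of_nat n - pt \<sigma> i) = PP i (int (t1 i))"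
    using ex_nat_at_distance[of "pt \<sigma>" t1] pt_int[OF assms] by blast
  obtain n' where n': "\<And>i. i \<in> I \<Longrightarrow> N i (of_nat n' - pt \<sigma> i) = PP i (int (t2 i))"
    using ex_nat_at_distance[of "pt \<sigma>" t2] pt_int[OF assms] by blast
  have tu: "t1 i \<ge> u" "t2 i \<ge> u" if "i \<in> I" for i using t[OF that] v(1) by (auto simp: t1_def t2_def)
  have cT: "T0 \<le> c i + int (t1 i)" "T0 \<le> c i + int (t2 i)" if "i \<in> I" for i
  proof -
    have "T0 \<le> int u" "0 \<le> c i" using T0(2) by (simp_all add: u_def c_def)
    thus "T0 \<le> c i + int (t1 i)" "T0 \<le> c i + int (t2 i)" using tu[OF that] by linarith+
  qed
  have "\<not> p i1 ^ l i1 dvd hseq \<sigma> n"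
  proof -
    have "p i1 ^ l i1 dvd a (g ^ s * n + j) \<longleftrightarrow> (\<exists>i\<in>I. V i (c i + int (t1 i)) < V i1 (c i1 + int (t1 i1)))"
      using N_affine n i1 cT unfolding s c_def by (intro digit_divisible[OF T0(1)]) auto
    moreover have "V i1 (c i1 + int (t1 i1)) \<le> V i (c i + int (t1 i))" if "i \<in> I" for i
      using t[OF that] by (auto simp: t1_def)
    ultimately show ?thesis unfolding hseq_def s by (auto simp: not_less)
  qed
  moreover have "p i1 ^ l i1 dvd hseq \<sigma> n'"
  proof -
    have "p i1 ^ l i1 dvd a (g ^ s * n' + j) \<longleftrightarrow> (\<exists>i\<in>I. V i (c i + int (t2 i)) < V i1 (c i1 + int (t2 i1)))"
      using N_affine n' i1 cT unfolding s c_def by (intro digit_divisible[OF T0(1)]) auto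
    moreover have "V i2 (c i2 + int (t2 i2)) < V i1 (c i1 + int (t2 i1))" using v(2) i2 by (simp add: t2_def)
    ultimately show ?thesis unfolding hseq_def s using i2(1) by auto
  qed
  moreover have "PP i (int (t1 i)) \<le> PP i (int t0)" "PP i (int (t2 i)) \<le> PP i (int t0)" if "i \<in> I" for i
    unfolding PP_le[OF that] using tu[OF that] by (simp_all add: u_def)
  ultimately show ?thesis using n n' by (intro exI[of _ n] exI[of _ n']) auto
qed

text \<open>Equality of the sequences moves the discontinuity at the point to its image under the
  other affine map. There a would be locally constant if even one component were nonzero.\<close>

lemma same_seq_imp_root:
  assumes "\<sigma> \<in> above" "hseq \<sigma> = hseq (s', j')" "i \<in> I"
  shows "N i (F i (of_nat (g ^ s') * pt \<sigma> i + of_nat j')) = 0"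
proof (rule ccontr)
  define y where "y = (\<lambda>i. of_nat (g ^ s') * pt \<sigma> i + of_nat j')"
  assume "N i (F i (of_nat (g ^ s') * pt \<sigma> i + of_nat j')) \<noteq> 0"
  hence nz: "N i (F i (y i)) \<noteq> 0" by (simp add: y_def)
  interpret padic "p i" "K i" "N i" iota by (rule padic[OF assms(3)])
  have yi: "y i \<in> integers"
    unfolding y_def by (intro integers_add integers_mult integers_of_nat pt_int assms)
  have FyK: "F i (y i) \<in> K i" using F_K[OF assms(3) yi] .
  have pos: "N i (F i (y i)) > 0" using nz N_nonneg[OF FyK] by simp
  obtain B where B: "PP i (int (l i) * (B + 1)) < N i (F i (y i))"
    using ex_below[of "\<lambda>_. N i (F i (y i))"] pos assms(3) by blast
  obtain E where E: "\<And>n n'. (\<exists>j\<in>I. PP j (int (l j) * (B + 1)) < N j (F j (of_nat n))) \<Longrightarrow>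
      [n = n'] (mod (b ^ E)) \<Longrightarrow> a n = a n'"
    using locally_constant[of B] by blast
  obtain C where C: "C > 0" "\<And>x y. x \<in> integers \<Longrightarrow> y \<in> integers \<Longrightarrow> N i (F i x - F i y) \<le> C * N i (x - y)"
    using analytic_Lipschitz[OF F_analytic[OF assms(3)]] by blast
  obtain t1 where "PP i (int t1) < N i (F i (y i)) / C" using ex_P_less[of "N i (F i (y i)) / C"] pos C(1) by auto
  hence t1: "C * PP i (int t1) < N i (F i (y i))" using C(1) by (simp add: field_simps)
  define L where "L = Max (insert 0 (l ` I))"
  have L: "l r \<le> L" if "r \<in> I" for r unfolding L_def using finite_I that by (intro Max_ge) auto
  \<comment> \<open>The part t1 keeps the seminorm of F_i at its value at y, and L E makes n and n'
    congruent modulo b^E.\<close>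
  define t0 where "t0 = t1 + L * E"
  obtain n n' where n: "\<And>r. r \<in> I \<Longrightarrow> N r (of_nat n - pt \<sigma> r) \<le> PP r (int t0)"
    "\<And>r. r \<in> I \<Longrightarrow> N r (of_nat n' - pt \<sigma> r) \<le> PP r (int t0)" "hseq \<sigma> n \<noteq> hseq \<sigma> n'"
    using ex_separating[OF assms(1), of t0] by blast
  have "[n = n'] (mod (p r ^ (l r * E)))" if r: "r \<in> I" for r
  proof -
    interpret R: padic "p r" "K r" "N r" iota by (rule padic[OF r])
    have "int (l r * E) \<le> int t0" unfolding t0_def using mult_le_mono1[OF L[OF r], of E] by linarith
    hence "PP r (int t0) \<le> PP r (int (l r * E))" unfolding R.P_le .
    hence *: "N r (of_nat n - pt \<sigma> r) \<le> PP r (int (l r * E))" "N r (of_nat n' - pt \<sigma> r) \<le> PP r (int (l r * E))"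
      using n(1,2)[OF r] by linarith+
    have "N r (of_nat n - of_nat n') \<le> PP r (int (l r * E))"
      by (rule R.N_trans[OF R.K_of_nat pt_K[OF r] R.K_of_nat *(1)])
        (use *(2) R.N_commute[OF R.K_of_nat pt_K[OF r], of n'] in simp)
    thus ?thesis unfolding R.N_of_nat_diff_le .
  qed
  hence "[n = n'] (mod (b ^ E))" by (rule cong_base_power)
  hence cg: "[g ^ s' * n + j' = g ^ s' * n' + j'] (mod (b ^ E))" by (intro cong_add cong_mult cong_refl)
  have "N i (y i - of_nat (g ^ s' * n + j')) \<le> PP i (int t1)"
  proof -
    have "y i - of_nat (g ^ s' * n + j') = of_nat (g ^ s') * - (of_nat n - pt \<sigma> i)"
      by (simp add: y_def algebra_simps)
    hence "N i (y i - of_nat (g ^ s' * n + j')) = N i (of_nat (g ^ s')) * N i (of_nat n - pt \<sigma> i)"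
      using N_mult[OF K_of_nat K_minus[OF K_diff[OF K_of_nat pt_K[OF assms(3)]]]]
        N_minus[OF K_diff[OF K_of_nat pt_K[OF assms(3)]]] by (simp only:)
    also have "\<dots> \<le> 1 * PP i (int t0)"
      using n(1)[OF assms(3)] pt_K[OF assms(3)] by (intro mult_mono N_of_nat_le_1 N_nonneg K_diff K_of_nat) simp_all
    also have "PP i (int t0) \<le> PP i (int t1)" unfolding P_le by (simp add: t0_def)
    finally show ?thesis by simp
  qed
  hence "C * N i (y i - of_nat (g ^ s' * n + j')) \<le> C * PP i (int t1)" using C(1) by simp
  hence "N i (F i (y i) - F i (of_nat (g ^ s' * n + j'))) < N i (F i (y i))"
    using C(2)[OF yi integers_of_nat, of "g ^ s' * n + j'"] t1 by linarith
  hence "N i (F i (of_nat (g ^ s' * n + j'))) = N i (F i (y i))"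
    by (intro N_eq_of_close FyK F_K assms(3) integers_of_nat)
  hence "PP i (int (l i) * (B + 1)) < N i (F i (of_nat (g ^ s' * n + j')))" using B by simp
  hence "a (g ^ s' * n + j') = a (g ^ s' * n' + j')" using E[OF _ cg] assms(3) by blast
  thus False using n(3) unfolding assms(2) by (simp add: hseq_def)
qed

lemma hseq_kernel: "\<sigma> \<in> above \<Longrightarrow> hseq \<sigma> \<in> kernel g a"
  unfolding above_def kernel_def hseq_def by (force simp: less_eq_Suc_le[symmetric])

text \<open>Finitely many kernel elements, each discontinuous at finitely many points only.\<close>

lemma finite_classes:
  "\<exists>(Z :: ((nat \<Rightarrow> nat) \<times> ('a \<Rightarrow> 'b)) set) cls. finite Z \<and> cls ` above \<subseteq> Z \<and>
    (\<forall>\<sigma>\<in>above. \<forall>\<sigma>'\<in>above. cls \<sigma> = cls \<sigma>' \<longrightarrow>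
       hseq \<sigma> = hseq \<sigma>' \<and> (\<forall>i\<in>I. N i (pt \<sigma> i - pt \<sigma>' i) = 0))"
proof -
  have "\<exists>R. i \<in> I \<longrightarrow> finite R \<and> R \<subseteq> ints i \<and> (\<forall>x\<in>ints i. N i (F i x) = 0 \<longrightarrow> (\<exists>\<theta>\<in>R. N i (x - \<theta>) = 0))" for i
  proof (cases "i \<in> I")
    case True
    then obtain x where "x \<in> ints i" "N i (F i x) \<noteq> 0" using F_nonzero by blast
    then obtain M where "padic.strassmann_index (N i) (co i) M"
      using padic.ex_strassmann_index[OF padic[OF True] F_analytic[OF True]] by blast
    from padic.finite_roots[OF padic[OF True] F_analytic[OF True] this] show ?thesis by (simp only: True simp_thms)
  qed simp
  hence "\<exists>R. \<forall>i. i \<in> I \<longrightarrow> finite (R i) \<and> R i \<subseteq> ints i \<and>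
      (\<forall>x\<in>ints i. N i (F i x) = 0 \<longrightarrow> (\<exists>\<theta>\<in>R i. N i (x - \<theta>) = 0))"
    by (intro choice allI)
  then obtain R where R0: "\<forall>i. i \<in> I \<longrightarrow> finite (R i) \<and> R i \<subseteq> ints i \<and>
      (\<forall>x\<in>ints i. N i (F i x) = 0 \<longrightarrow> (\<exists>\<theta>\<in>R i. N i (x - \<theta>) = 0))" ..
  have R: "finite (R i)" "R i \<subseteq> ints i" "x \<in> ints i \<Longrightarrow> N i (F i x) = 0 \<Longrightarrow> \<exists>\<theta>\<in>R i. N i (x - \<theta>) = 0"
    if "i \<in> I" for i x
    using mp[OF spec[OF R0] that] by simp_all
  \<comment> \<open>One representative pair for each kernel element: all points with the same
    sequence are sent by the same affine map into the finite set of roots, and this map is injective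
    up to seminorm zero.\<close>
  define rp where "rp = (\<lambda>h. SOME \<tau>. \<tau> \<in> above \<and> hseq \<tau> = h)"
  have rp: "hseq (rp (hseq \<sigma>)) = hseq \<sigma>" if "\<sigma> \<in> above" for \<sigma>
    unfolding rp_def using someI[of "\<lambda>\<tau>. \<tau> \<in> above \<and> hseq \<tau> = hseq \<sigma>" \<sigma>] that by blast
  define y where "y = (\<lambda>\<sigma> i. case rp (hseq \<sigma>) of (s', j') \<Rightarrow> of_nat (g ^ s') * pt \<sigma> i + of_nat j')"
  have yR: "\<exists>\<theta>\<in>R i. N i (y \<sigma> i - \<theta>) = 0" if "\<sigma> \<in> above" "i \<in> I" for \<sigma> i
  proof -
    interpret padic "p i" "K i" "N i" iota by (rule padic[OF that(2)])
    obtain s' j' where sj: "rp (hseq \<sigma>) = (s', j')" by (cases "rp (hseq \<sigma>)")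
    have y: "y \<sigma> i = of_nat (g ^ s') * pt \<sigma> i + of_nat j'" by (simp add: y_def sj)
    have "N i (F i (y \<sigma> i)) = 0"
      unfolding y using rp[OF that(1)] sj by (intro same_seq_imp_root that) simp
    moreover have "y \<sigma> i \<in> integers"
      unfolding y by (intro integers_add integers_mult integers_of_nat pt_int that)
    ultimately show ?thesis using R(3)[OF that(2)] by blast
  qed
  define \<rho> where "\<rho> = (\<lambda>\<sigma> i. SOME \<theta>. \<theta> \<in> R i \<and> N i (y \<sigma> i - \<theta>) = 0)"
  have \<rho>: "\<rho> \<sigma> i \<in> R i" "N i (y \<sigma> i - \<rho> \<sigma> i) = 0" if "\<sigma> \<in> above" "i \<in> I" for \<sigma> i
    using someI_ex[of "\<lambda>\<theta>. \<theta> \<in> R i \<and> N i (y \<sigma> i - \<theta>) = 0"] yR[OF that] unfolding \<rho>_def by blast+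
  define cls' where "cls' = (\<lambda>\<sigma>. (hseq \<sigma>, restrict (\<rho> \<sigma>) I))"
  have "finite (kernel g a \<times> PiE I R)" using fin_kernel finite_I R(1) by (intro finite_cartesian_product finite_PiE)
  moreover have "cls' ` above \<subseteq> kernel g a \<times> PiE I R"
    using hseq_kernel \<rho>(1) by (auto simp: cls'_def)
  moreover have "hseq \<sigma> = hseq \<sigma>' \<and> (\<forall>i\<in>I. N i (pt \<sigma> i - pt \<sigma>' i) = 0)"
    if s: "\<sigma> \<in> above" "\<sigma>' \<in> above" and eq: "cls' \<sigma> = cls' \<sigma>'" for \<sigma> \<sigma>'
  proof (intro conjI ballI)
    show h: "hseq \<sigma> = hseq \<sigma>'" using eq by (simp add: cls'_def)
    fix i assume i: "i \<in> I"
    interpret padic "p i" "K i" "N i" iota by (rule padic[OF i])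
    have "restrict (\<rho> \<sigma>) I i = restrict (\<rho> \<sigma>') I i" using eq by (simp add: cls'_def)
    hence \<rho>eq: "\<rho> \<sigma> i = \<rho> \<sigma>' i" using i by simp
    obtain s' j' where sj: "rp (hseq \<sigma>) = (s', j')" by (cases "rp (hseq \<sigma>)")
    have y: "y \<sigma> i = of_nat (g ^ s') * pt \<sigma> i + of_nat j'" "y \<sigma>' i = of_nat (g ^ s') * pt \<sigma>' i + of_nat j'"
      using sj h by (simp_all add: y_def)
    have K [simp]: "y \<sigma> i \<in> K i" "y \<sigma>' i \<in> K i" "\<rho> \<sigma> i \<in> K i" "\<rho> \<sigma>' i \<in> K i"
    proof -
      show "y \<sigma> i \<in> K i" "y \<sigma>' i \<in> K i" unfolding y by (intro K_add K_mult K_of_nat pt_K i)+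
      have "\<rho> \<sigma> i \<in> integers" "\<rho> \<sigma>' i \<in> integers" using \<rho>(1) s i R(2)[OF i] by blast+
      thus "\<rho> \<sigma> i \<in> K i" "\<rho> \<sigma>' i \<in> K i" by (simp_all only: integersD)
    qed
    have "(y \<sigma> i - \<rho> \<sigma> i) - (y \<sigma>' i - \<rho> \<sigma>' i) = of_nat (g ^ s') * (pt \<sigma> i - pt \<sigma>' i)"
      unfolding y \<rho>eq by (simp add: algebra_simps)
    moreover have "N i ((y \<sigma> i - \<rho> \<sigma> i) - (y \<sigma>' i - \<rho> \<sigma>' i)) \<le> 0"
      using \<rho>(2) s i by (intro N_diff_le[of "y \<sigma> i - \<rho> \<sigma> i" "y \<sigma>' i - \<rho> \<sigma>' i"]) simp_all
    ultimately have "N i (of_nat (g ^ s')) * N i (pt \<sigma> i - pt \<sigma>' i) \<le> 0"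
      using N_mult[OF K_of_nat K_diff[OF pt_K[OF i] pt_K[OF i]]] by metis
    moreover have "N i (of_nat (g ^ s')) > 0" unfolding N_g[OF i] by simp
    ultimately show "N i (pt \<sigma> i - pt \<sigma>' i) = 0"
      using N_nonneg[OF K_diff[OF pt_K[OF i] pt_K[OF i]], of \<sigma> \<sigma>']
      by (metis less_eq_real_def linorder_not_less mult_pos_pos)
  qed
  ultimately show ?thesis by (intro exI[of _ "kernel g a \<times> PiE I R"] exI[of _ cls']) blast
qed

section \<open>The prime factors of the base, rationality of the root and proportionality of the
  exponents\<close>

definition gb :: nat where "gb = (\<Prod>i\<in>I. p i ^ ex i)"

lemma gb_dvd: "gb dvd g"
proof -
  have "int (\<Prod>i\<in>I. p i ^ ex i) dvd int g" by (rule int_base_dvd) (simp add: ex_def multiplicity_dvd)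
  thus ?thesis by (simp only: gb_def int_dvd_int_iff)
qed

lemma gb_pos: "gb > 0"
  using gb_dvd g_ge_2 by (auto intro: Nat.gr0I)

lemma ex_above_residue: "\<exists>j<gb ^ s. \<forall>i\<in>I. N i (of_nat j - th i) \<le> PP i (int (ex i * s))"
proof -
  have "\<exists>r. i \<in> I \<longrightarrow> N i (th i - of_nat r) \<le> PP i (int (ex i * s))" for i
    using padic.ex_nat_approx[OF padic th_int] by blast
  then obtain r where r: "\<And>i. i \<in> I \<Longrightarrow> N i (th i - of_nat (r i)) \<le> PP i (int (ex i * s))" by metis
  obtain n where n: "\<And>i. i \<in> I \<Longrightarrow> [n = r i] (mod (p i ^ (ex i * s)))"
    using crt[of r "\<lambda>i. ex i * s"] by blast
  have "N i (of_nat (n mod gb ^ s) - th i) \<le> PP i (int (ex i * s))" if i: "i \<in> I" for i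
  proof -
    interpret padic "p i" "K i" "N i" iota by (rule padic[OF i])
    have thK: "th i \<in> K i" using integersD[OF th_int[OF i]] .
    have "p i ^ (ex i * s) dvd gb ^ s" unfolding gb_def power_mult
      using i finite_I by (intro dvd_power_same dvd_prodI)
    hence "[n mod gb ^ s = n] (mod (p i ^ (ex i * s)))" by (simp add: cong_def mod_mod_cancel)
    hence "[n mod gb ^ s = r i] (mod (p i ^ (ex i * s)))" using n[OF i] cong_trans by blast
    hence "N i (of_nat (n mod gb ^ s) - of_nat (r i)) \<le> PP i (int (ex i * s))"
      unfolding N_of_nat_diff_le .
    moreover have "N i (of_nat (r i) - th i) \<le> PP i (int (ex i * s))"
      using r[OF i] N_commute[OF K_of_nat thK] by simp
    ultimately show ?thesis using N_trans[OF K_of_nat K_of_nat thK] by blast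
  qed
  moreover have "n mod gb ^ s < gb ^ s" using gb_pos by simp
  ultimately show ?thesis by blast
qed

text \<open>Every lift of an admissible residue modulo gb^s to a residue modulo g^s is admissible
  again; there are (g div gb)^s of them.\<close>

lemma above_lift:
  assumes "j < gb ^ s" "\<forall>i\<in>I. N i (of_nat j - th i) \<le> PP i (int (ex i * s))" "t < (g div gb) ^ s"
  shows "(s, j + t * gb ^ s) \<in> above"
proof -
  have "j + t * gb ^ s < gb ^ s + t * gb ^ s" using assms(1) by simp
  also have "\<dots> = Suc t * gb ^ s" by simp
  also have "\<dots> \<le> (g div gb) ^ s * gb ^ s" using assms(3) by (intro mult_le_mono) auto
  also have "\<dots> = g ^ s" using gb_dvd by (simp flip: power_mult_distrib)
  finally have "j + t * gb ^ s < g ^ s" .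
  moreover have "N i (of_nat (j + t * gb ^ s) - th i) \<le> PP i (int (ex i * s))" if i: "i \<in> I" for i
  proof -
    interpret padic "p i" "K i" "N i" iota by (rule padic[OF i])
    have thK: "th i \<in> K i" using integersD[OF th_int[OF i]] .
    have "p i ^ (ex i * s) dvd t * gb ^ s" unfolding gb_def power_mult
      using i finite_I by (intro dvd_mult dvd_power_same dvd_prodI)
    hence "N i (of_nat (t * gb ^ s)) \<le> PP i (int (ex i * s))" unfolding N_of_nat_le .
    moreover have "of_nat (j + t * gb ^ s) - th i = (of_nat j - th i) + of_nat (t * gb ^ s)" by simp
    ultimately show ?thesis using assms(2) i thK
      by (simp only:) (intro N_add_le[of "of_nat j - th i"] K_diff K_of_nat; simp)
  qed
  ultimately show ?thesis by (simp add: above_def)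
qed

text \<open>A cofactor g div gb \<ge> 2 would yield at least 2^s different points at level s, but
  the number of classes does not grow with s.\<close>

lemma g_eq: "g = gb"
proof (rule ccontr)
  assume "g \<noteq> gb"
  hence "g div gb \<noteq> 1" using gb_dvd by (metis dvd_div_mult_self mult_1)
  moreover have "g div gb \<noteq> 0" using gb_dvd g_ge_2 by (metis dvd_div_mult_self mult_0 not_numeral_le_zero)
  ultimately have g2: "2 \<le> g div gb" by linarith
  obtain Z :: "((nat \<Rightarrow> nat) \<times> ('a \<Rightarrow> 'b)) set" and cls where Z: "finite Z" "cls ` above \<subseteq> Z"
    "\<And>\<sigma> \<sigma>'. \<sigma> \<in> above \<Longrightarrow> \<sigma>' \<in> above \<Longrightarrow> cls \<sigma> = cls \<sigma>' \<Longrightarrow> \<forall>i\<in>I. N i (pt \<sigma> i - pt \<sigma>' i) = 0"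
    using finite_classes by metis
  \<comment> \<open>Any level with 2^s > card Z contradicts the pigeonhole principle.\<close>
  define s where "s = card Z"
  obtain j where j: "j < gb ^ s" "\<forall>i\<in>I. N i (of_nat j - th i) \<le> PP i (int (ex i * s))"
    using ex_above_residue by blast
  note lift = above_lift[OF j]
  obtain i where i: "i \<in> I" using I_nonempty by blast
  interpret padic "p i" "K i" "N i" iota by (rule padic[OF i])
  have "inj_on (\<lambda>t. cls (s, j + t * gb ^ s)) {..<(g div gb) ^ s}"
  proof (rule inj_onI)
    fix t t' assume t: "t \<in> {..<(g div gb) ^ s}" "t' \<in> {..<(g div gb) ^ s}"
      and eq: "cls (s, j + t * gb ^ s) = cls (s, j + t' * gb ^ s)"
    define A B where "A = j + t * gb ^ s" and "B = j + t' * gb ^ s"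
    have 0: "N i (pt (s, A) i - pt (s, B) i) = 0" using Z(3)[OF lift lift eq] t i by (auto simp: A_def B_def)
    have "of_nat A = th i - of_nat (g ^ s) * pt (s, A) i" "of_nat B = th i - of_nat (g ^ s) * pt (s, B) i"
      using pt_eq[OF i, of s A] pt_eq[OF i, of s B] by (simp_all add: algebra_simps)
    hence "of_nat B - of_nat A = of_nat (g ^ s) * (pt (s, A) i - pt (s, B) i)" by (simp add: algebra_simps)
    hence "N i (of_nat B - of_nat A) = 0"
      using N_mult[OF K_of_nat K_diff[OF pt_K[OF i] pt_K[OF i]]] 0 by (simp only: mult_zero_right)
    hence "B = A" unfolding N_of_nat_diff_0 .
    thus "t = t'" using gb_pos by (simp add: A_def B_def)
  qed
  moreover have "(\<lambda>t. cls (s, j + t * gb ^ s)) ` {..<(g div gb) ^ s} \<subseteq> Z" using lift Z(2) by blast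
  ultimately have "card {..<(g div gb) ^ s} \<le> card Z" using Z(1) by (rule card_inj_on_le)
  hence "(g div gb) ^ s \<le> s" by (simp add: s_def)
  moreover have "s < 2 ^ s" by simp
  moreover have "2 ^ s \<le> (g div gb) ^ s" using g2 by (rule power_mono) simp
  ultimately show False by linarith
qed

text \<open>Since g = gb, every level contains an admissible j, and infinitely many levels share
  finitely many classes.\<close>

lemma ex_coincidence:
  "\<exists>s s' j j'. s < s' \<and> (s, j) \<in> above \<and> (s', j') \<in> above \<and> hseq (s, j) = hseq (s', j') \<and>
     (\<forall>i\<in>I. N i (pt (s, j) i - pt (s', j') i) = 0)"
proof -
  obtain Z :: "((nat \<Rightarrow> nat) \<times> ('a \<Rightarrow> 'b)) set" and cls where Z: "finite Z" "cls ` above \<subseteq> Z"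
    "\<And>\<sigma> \<sigma>'. \<sigma> \<in> above \<Longrightarrow> \<sigma>' \<in> above \<Longrightarrow> cls \<sigma> = cls \<sigma>' \<Longrightarrow>
       hseq \<sigma> = hseq \<sigma>' \<and> (\<forall>i\<in>I. N i (pt \<sigma> i - pt \<sigma>' i) = 0)"
    using finite_classes by metis
  have "\<forall>s. \<exists>j. (s, j) \<in> above" using ex_above_residue g_eq by (auto simp: above_def)
  then obtain j where j: "\<And>s. (s, j s) \<in> above" by metis
  have "range (\<lambda>s. cls (s, j s)) \<subseteq> Z" using j Z(2) by blast
  hence "finite (range (\<lambda>s. cls (s, j s)))" using Z(1) finite_subset by blast
  hence "\<not> inj (\<lambda>s. cls (s, j s))" using finite_imageD infinite_UNIV_nat by blast
  then obtain s s' where "s \<noteq> s'" "cls (s, j s) = cls (s', j s')" by (auto simp: inj_on_def)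
  then obtain s s' where "s < s'" "cls (s, j s) = cls (s', j s')" by (metis linorder_neqE_nat)
  thus ?thesis using Z(3)[OF j j] j by blast
qed

text \<open>Equality of the points at two levels is a linear equation A \<theta> = B whose rational
  coefficients are the same for all i, and A is nonzero because the levels differ.\<close>

lemma root_rational: "\<exists>q. \<forall>i\<in>I. N i (th i - iota q) = 0"
proof -
  obtain s s' j j' where c: "s < s'" "\<And>i. i \<in> I \<Longrightarrow> N i (pt (s, j) i - pt (s', j') i) = 0"
    using ex_coincidence by blast
  define A :: rat where "A = 1 / of_nat g ^ s - 1 / of_nat g ^ s'"
  define B :: rat where "B = of_nat j / of_nat g ^ s - of_nat j' / of_nat g ^ s'"
  have "(of_nat g ^ s :: rat) < of_nat g ^ s'" using c(1) g_ge_2 by (intro power_strict_increasing) auto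
  hence A0: "A \<noteq> 0" using g_ge_2 by (simp add: A_def)
  have "N i (th i - iota (B / A)) = 0" if i: "i \<in> I" for i
  proof -
    interpret padic "p i" "K i" "N i" iota by (rule padic[OF i])
    have thK: "th i \<in> K i" using integersD[OF th_int[OF i]] .
    have "pt (s, j) i - pt (s', j') i = (iota (1 / of_nat g ^ s) - iota (1 / of_nat g ^ s')) * th i
        - (iota (1 / of_nat g ^ s) * of_nat j - iota (1 / of_nat g ^ s') * of_nat j')"
      by (simp add: pt_def algebra_simps)
    also have "iota (1 / of_nat g ^ s) - iota (1 / of_nat g ^ s') = iota A" by (simp add: A_def iota_diff)
    also have "iota (1 / of_nat g ^ s) * of_nat j - iota (1 / of_nat g ^ s') * of_nat j' = iota B"
      unfolding B_def iota_of_nat[symmetric] iota_mult[symmetric] iota_diff[symmetric] by simp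
    also have "iota B = iota A * iota (B / A)" unfolding iota_mult[symmetric] using A0 by simp
    also have "iota A * th i - iota A * iota (B / A) = iota A * (th i - iota (B / A))"
      by (simp add: right_diff_distrib)
    finally have "N i (iota A) * N i (th i - iota (B / A)) = 0"
      using c(2)[OF i] N_mult[OF K_iota K_diff[OF thK K_iota]] by metis
    thus ?thesis using A0 by (simp add: N_iota rat_abs_eq_0[OF prime_p])
  qed
  thus ?thesis by blast
qed

text \<open>At a coincidence one n has the same distances to both points, while the valuations of
  its two images relative to the root differ by (s' - s) ex_i. The two digits are equal, hence so is
  their divisibility by p_i^(l_i); once all other components are large, this divisibility compares i
  with j.\<close>

lemma V_shift_invariant:
  "\<exists>\<Delta> T1. 0 < \<Delta> \<and> 0 \<le> T1 \<and> (\<forall>i\<in>I. \<forall>j\<in>I. \<forall>Ti\<ge>T1. \<forall>Tj\<ge>T1. i \<noteq> j \<longrightarrow>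
     (V i Ti \<le> V j Tj \<longleftrightarrow> V i (Ti + \<Delta> * int (ex i)) \<le> V j (Tj + \<Delta> * int (ex j))))"
proof -
  obtain s s' u u' where c: "s < s'" "(s, u) \<in> above" "(s', u') \<in> above" "hseq (s, u) = hseq (s', u')"
    "\<And>i. i \<in> I \<Longrightarrow> N i (pt (s, u) i - pt (s', u') i) = 0"
    using ex_coincidence by blast
  obtain T0 where T0: "near T0" "0 \<le> T0" using ex_near by blast
  \<comment> \<open>Large enough that T - ex_i s is still at least T0 and can be realized as the
    exponent of a distance to the point.\<close>
  define T1 where "T1 = T0 + (\<Sum>i\<in>I. int (ex i * s))"
  have T1: "T0 + int (ex i * s) \<le> T1" if "i \<in> I" for i
    unfolding T1_def using finite_I that by (intro add_left_mono member_le_sum) auto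
  define \<Delta> where "\<Delta> = int s' - int s"
  have Dp: "0 < \<Delta>" using c(1) by (simp add: \<Delta>_def)
  have "V i Ti \<le> V j Tj \<longleftrightarrow> V i (Ti + \<Delta> * int (ex i)) \<le> V j (Tj + \<Delta> * int (ex j))"
    if ij: "i \<in> I" "j \<in> I" "i \<noteq> j" and T: "T1 \<le> Ti" "T1 \<le> Tj" for i j Ti Tj
  proof -
    define c1 c2 where "c1 = (\<lambda>r. int (ex r * s))" and "c2 = (\<lambda>r. int (ex r * s'))"
    \<comment> \<open>The remaining components are lifted to at least B at both levels, so none of
      them undercuts i and only r = j can witness the existential.\<close>
    define B where "B = max (V i Ti) (V i (Ti + \<Delta> * int (ex i)))"
    have c2: "c2 r = c1 r + \<Delta> * int (ex r)" for r by (simp add: c1_def c2_def \<Delta>_def algebra_simps)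
    have c12: "c1 r \<le> c2 r" "0 \<le> c1 r" for r using Dp by (simp_all add: c2) (simp add: c1_def)
    have "\<exists>t. r \<in> I \<longrightarrow> t \<ge> nat T0 \<and> B \<le> V r (c1 r + int t)" for r using V_unbounded by blast
    then obtain t0 where t0: "\<And>r. r \<in> I \<Longrightarrow> t0 r \<ge> nat T0 \<and> B \<le> V r (c1 r + int (t0 r))" by metis
    define t where "t = t0(i := nat (Ti - c1 i), j := nat (Tj - c1 j))"
    have ti: "int (t i) = Ti - c1 i" "int (t j) = Tj - c1 j"
      using T T1[OF ij(1)] T1[OF ij(2)] ij(3) T0(2) by (simp_all add: t_def c1_def)
    have tT0: "T0 \<le> int (t r)" if "r \<in> I" for r
    proof (cases "r = i \<or> r = j")
      case True
      thus ?thesis using ti T T1[OF ij(1)] T1[OF ij(2)] by (auto simp: c1_def)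
    next
      case False
      thus ?thesis using t0[OF that] by (simp add: t_def nat_le_iff)
    qed
    obtain n where n: "\<And>r. r \<in> I \<Longrightarrow> N r (of_nat n - pt (s, u) r) = PP r (int (t r))"
      using ex_nat_at_distance[of "pt (s, u)" t] pt_int[OF c(2)] by blast
    have n': "N r (of_nat n - pt (s', u') r) = PP r (int (t r))" if r: "r \<in> I" for r
    proof -
      interpret padic "p r" "K r" "N r" iota by (rule padic[OF r])
      have "N r (of_nat n - pt (s, u) r) = N r (of_nat n - pt (s', u') r)"
        using c(5)[OF r] N_commute[OF pt_K[OF r] pt_K[OF r], of "(s, u)" "(s', u')"] pt_K[OF r]
        by (intro N_cong) simp_all
      thus ?thesis using n[OF r] by simp
    qed
    have d1: "p i ^ l i dvd a (g ^ s * n + u) \<longleftrightarrow> (\<exists>r\<in>I. V r (c1 r + int (t r)) < V i (c1 i + int (t i)))"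
    proof (rule digit_divisible[OF T0(1) _ _ ij(1)])
      fix r assume r: "r \<in> I"
      show "T0 \<le> c1 r + int (t r)" using tT0[OF r] c12(2)[of r] by linarith
      show "N r (of_nat (g ^ s * n + u) - th r) = PP r (c1 r + int (t r))"
        unfolding c1_def by (rule N_affine[OF r n[OF r]])
    qed
    have d2: "p i ^ l i dvd a (g ^ s' * n + u') \<longleftrightarrow> (\<exists>r\<in>I. V r (c2 r + int (t r)) < V i (c2 i + int (t i)))"
    proof (rule digit_divisible[OF T0(1) _ _ ij(1)])
      fix r assume r: "r \<in> I"
      show "T0 \<le> c2 r + int (t r)" using tT0[OF r] c12[of r] by linarith
      show "N r (of_nat (g ^ s' * n + u') - th r) = PP r (c2 r + int (t r))"
        unfolding c2_def by (rule N_affine[OF r n'[OF r]])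
    qed
    have mono: "V r x \<le> V r x'" if "r \<in> I" "x \<le> x'" for r x x'
      unfolding V_def using that l_pos[of r] by (intro zdiv_mono1 add_right_mono mult_left_mono) auto
    have other: "B \<le> V r (c1 r + int (t r))" "B \<le> V r (c2 r + int (t r))" if "r \<in> I" "r \<noteq> i" "r \<noteq> j" for r
    proof -
      show 1: "B \<le> V r (c1 r + int (t r))" using t0[OF that(1)] that by (simp add: t_def)
      have "V r (c1 r + int (t r)) \<le> V r (c2 r + int (t r))"
        using c12(1)[of r] by (intro mono that(1)) simp
      thus "B \<le> V r (c2 r + int (t r))" using 1 by linarith
    qed
    have e1: "c1 i + int (t i) = Ti" "c1 j + int (t j) = Tj" using ti by simp_all
    have e2: "c2 i + int (t i) = Ti + \<Delta> * int (ex i)" "c2 j + int (t j) = Tj + \<Delta> * int (ex j)"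
      using ti by (simp_all add: c2)
    have "(\<exists>r\<in>I. V r (c1 r + int (t r)) < V i (c1 i + int (t i))) \<longleftrightarrow> V j Tj < V i Ti"
    proof
      assume "\<exists>r\<in>I. V r (c1 r + int (t r)) < V i (c1 i + int (t i))"
      then obtain r where r: "r \<in> I" "V r (c1 r + int (t r)) < V i Ti" unfolding e1 by blast
      have "r \<noteq> i" using r(2) e1 by auto
      moreover have "r = j" using other(1)[OF r(1) \<open>r \<noteq> i\<close>] r(2) by (force simp: B_def)
      ultimately show "V j Tj < V i Ti" using r e1 by simp
    next
      assume "V j Tj < V i Ti"
      thus "\<exists>r\<in>I. V r (c1 r + int (t r)) < V i (c1 i + int (t i))" using ij(2) e1 by (intro bexI[of _ j]) simp_all
    qed
    moreover have "(\<exists>r\<in>I. V r (c2 r + int (t r)) < V i (c2 i + int (t i))) \<longleftrightarrow>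
        V j (Tj + \<Delta> * int (ex j)) < V i (Ti + \<Delta> * int (ex i))"
    proof
      assume "\<exists>r\<in>I. V r (c2 r + int (t r)) < V i (c2 i + int (t i))"
      then obtain r where r: "r \<in> I" "V r (c2 r + int (t r)) < V i (Ti + \<Delta> * int (ex i))" unfolding e2 by blast
      have "r \<noteq> i" using r(2) e2 by auto
      moreover have "r = j" using other(2)[OF r(1) \<open>r \<noteq> i\<close>] r(2) by (force simp: B_def)
      ultimately show "V j (Tj + \<Delta> * int (ex j)) < V i (Ti + \<Delta> * int (ex i))" using r e2 by simp
    next
      assume "V j (Tj + \<Delta> * int (ex j)) < V i (Ti + \<Delta> * int (ex i))"
      thus "\<exists>r\<in>I. V r (c2 r + int (t r)) < V i (c2 i + int (t i))" using ij(2) e2 by (intro bexI[of _ j]) simp_all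
    qed
    moreover have "a (g ^ s * n + u) = a (g ^ s' * n + u')"
      using fun_cong[OF c(4), of n] by (simp add: hseq_def)
    ultimately have "V j Tj < V i Ti \<longleftrightarrow> V j (Tj + \<Delta> * int (ex j)) < V i (Ti + \<Delta> * int (ex i))"
      using d1 d2 by simp
    thus ?thesis by linarith
  qed
  thus ?thesis using Dp T0(2) T1 by (intro exI[of _ \<Delta>] exI[of _ T1]) (auto simp: T1_def intro!: add_nonneg_nonneg sum_nonneg)
qed

text \<open>One shift increases V i by \<Delta> ex_i mu_i / l_i up to rounding, and V j by \<Delta>
  ex_j mu_j / l_j. An inequality that survives every iteration excludes faster growth of V i;
  exchanging i and j then gives equality.\<close>

lemma exponents_le:
  assumes ij: "i \<in> I" "j \<in> I" "i \<noteq> j"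
  shows "int (ex i * mu i * l j) \<le> int (ex j * mu j * l i)"
proof (rule ccontr)
  assume neg: "\<not> ?thesis"
  obtain \<Delta> T1 where D: "0 < \<Delta>" "0 \<le> T1" and inv: "\<And>Ti Tj. Ti \<ge> T1 \<Longrightarrow> Tj \<ge> T1 \<Longrightarrow>
     (V i Ti \<le> V j Tj \<longleftrightarrow> V i (Ti + \<Delta> * int (ex i)) \<le> V j (Tj + \<Delta> * int (ex j)))"
    using V_shift_invariant ij by metis
  obtain t where t: "t \<ge> nat T1" "V i T1 \<le> V j (0 + int t)" using V_unbounded[OF ij(2)] by blast
  define Tj where "Tj = int t"
  have Tj: "T1 \<le> Tj" "V i T1 \<le> V j Tj" using t D(2) by (simp_all add: Tj_def nat_le_iff)
  have iter: "V i (T1 + int M * \<Delta> * int (ex i)) \<le> V j (Tj + int M * \<Delta> * int (ex j))" for M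
  proof (induction M)
    case (Suc M)
    have "T1 \<le> T1 + int M * \<Delta> * int (ex i)" "T1 \<le> Tj + int M * \<Delta> * int (ex j)"
      using D(1) Tj(1) by (simp_all add: add_increasing2)
    from inv[OF this] Suc.IH show ?case by (simp add: algebra_simps)
  qed (use Tj in simp)
  define \<alpha> \<beta> where "\<alpha> = int (ex i * mu i * l j)" and "\<beta> = int (ex j * mu j * l i)"
  have ab: "\<beta> + 1 \<le> \<alpha>" using neg by (simp add: \<alpha>_def \<beta>_def)
  \<comment> \<open>Everything independent of M, including the rounding error of the floor in V i,
    after clearing the denominators l_i and l_j.\<close>
  define c where "c = int (l i) * (int (mu j) * Tj + cH j) - int (l j) * (int (mu i) * T1 + cH i - int (l i))"
  have bound: "int M * \<Delta> * (\<alpha> - \<beta>) \<le> c" for M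
  proof -
    let ?X = "T1 + int M * \<Delta> * int (ex i)" and ?Y = "Tj + int M * \<Delta> * int (ex j)"
    have li: "0 < int (l i)" "0 < int (l j)" using l_pos ij by (simp_all add: Suc_le_eq)
    have 1: "int (mu i) * ?X + cH i - int (l i) \<le> int (l i) * V i ?X"
    proof -
      have "(int (mu i) * ?X + cH i) mod int (l i) < int (l i)" using li by simp
      moreover have "int (mu i) * ?X + cH i = int (l i) * V i ?X + (int (mu i) * ?X + cH i) mod int (l i)"
        by (simp only: V_def mult_div_mod_eq)
      ultimately show ?thesis by linarith
    qed
    have 2: "int (l j) * V j ?Y \<le> int (mu j) * ?Y + cH j" using le_V[OF ij(2), of "V j ?Y" ?Y] by simp
    have "int (l j) * (int (mu i) * ?X + cH i - int (l i)) \<le> int (l j) * (int (l i) * V i ?X)"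
      using 1 by (intro mult_left_mono) auto
    also have "\<dots> = int (l j) * int (l i) * V i ?X" by simp
    also have "\<dots> \<le> int (l j) * int (l i) * V j ?Y" using iter[of M] by (intro mult_left_mono) auto
    also have "\<dots> = int (l i) * (int (l j) * V j ?Y)" by simp
    also have "\<dots> \<le> int (l i) * (int (mu j) * ?Y + cH j)" using 2 by (intro mult_left_mono) auto
    finally have "int (l j) * (int (mu i) * ?X + cH i - int (l i)) \<le> int (l i) * (int (mu j) * ?Y + cH j)" .
    thus ?thesis by (simp add: c_def \<alpha>_def \<beta>_def algebra_simps)
  qed
  have "int (nat (\<bar>c\<bar> + 1)) * 1 \<le> int (nat (\<bar>c\<bar> + 1)) * (\<Delta> * (\<alpha> - \<beta>))"
  proof (intro mult_left_mono)
    have "1 * 1 \<le> \<Delta> * (\<alpha> - \<beta>)" using D(1) ab by (intro mult_mono) auto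
    thus "1 \<le> \<Delta> * (\<alpha> - \<beta>)" by simp
  qed simp
  also have "\<dots> \<le> c" using bound[of "nat (\<bar>c\<bar> + 1)"] by (simp add: mult.assoc)
  finally show False by simp
qed

lemma exponents_eq: "i \<in> I \<Longrightarrow> j \<in> I \<Longrightarrow> ex i * mu i * l j = ex j * mu j * l i"
proof (cases "i = j")
  case False
  assume "i \<in> I" "j \<in> I"
  hence "int (ex i * mu i * l j) = int (ex j * mu j * l i)"
    using exponents_le[of i j] exponents_le[of j i] False by (intro antisym) blast+
  thus ?thesis by (simp only: of_nat_eq_iff)
qed simp

end

section \<open>Cauchy sequences and the field of p-adic numbers\<close>

definition KC :: "nat \<Rightarrow> (nat \<Rightarrow> rat) set" where "KC p = {X. padic_Cauchy p X}"

definition NC :: "nat \<Rightarrow> (nat \<Rightarrow> rat) \<Rightarrow> real" where "NC p X = lim (\<lambda>n. rat_abs p (X n))"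

definition const_seq :: "rat \<Rightarrow> nat \<Rightarrow> rat" where "const_seq q = (\<lambda>n. q)"

context
  fixes p :: nat
  assumes pr: "prime p"
begin

lemma rat_abs_diff_max: "rat_abs p (x - y) \<le> max (rat_abs p x) (rat_abs p y)"
  using rat_abs_add[OF pr, of x "- y"] rat_abs_uminus[OF pr] by simp

lemma rat_abs_abs_diff: "\<bar>rat_abs p x - rat_abs p y\<bar> \<le> rat_abs p (x - y)"
proof -
  have "rat_abs p x \<le> max (rat_abs p (x - y)) (rat_abs p y)" using rat_abs_add[OF pr, of "x - y" y] by simp
  moreover have "rat_abs p y \<le> max (rat_abs p x) (rat_abs p (x - y))"
    using rat_abs_diff_max[of x "x - y"] by simp
  ultimately show ?thesis
    using rat_abs_nonneg[of p x] rat_abs_nonneg[of p y] rat_abs_nonneg[of p "x - y"]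
    by (simp add: max_def split: if_splits)
qed

lemma KC_D: "X \<in> KC p \<Longrightarrow> e > 0 \<Longrightarrow> \<exists>M. \<forall>m\<ge>M. \<forall>n\<ge>M. rat_abs p (X m - X n) < e"
  by (simp add: KC_def padic_Cauchy_def)

lemma NC_lim: assumes "X \<in> KC p" shows "(\<lambda>n. rat_abs p (X n)) \<longlonglongrightarrow> NC p X"
proof -
  have "Cauchy (\<lambda>n. rat_abs p (X n))"
  proof (rule metric_CauchyI)
    fix e :: real assume "e > 0"
    then obtain M where M: "\<And>m n. m \<ge> M \<Longrightarrow> n \<ge> M \<Longrightarrow> rat_abs p (X m - X n) < e"
      using KC_D[OF assms] by blast
    have "dist (rat_abs p (X m)) (rat_abs p (X n)) < e" if "m \<ge> M" "n \<ge> M" for m n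
      unfolding dist_real_def using rat_abs_abs_diff[of "X m" "X n"] M[OF that] by linarith
    thus "\<exists>M. \<forall>m\<ge>M. \<forall>n\<ge>M. dist (rat_abs p (X m)) (rat_abs p (X n)) < e" by blast
  qed
  thus ?thesis unfolding NC_def using Cauchy_convergent convergent_LIMSEQ_iff by blast
qed

lemma NC_eqI: "X \<in> KC p \<Longrightarrow> (\<lambda>n. rat_abs p (X n)) \<longlonglongrightarrow> r \<Longrightarrow> NC p X = r"
  using NC_lim LIMSEQ_unique by blast

lemma NC_le:
  assumes "X \<in> KC p" "\<And>n. n \<ge> M \<Longrightarrow> rat_abs p (X n) \<le> e" shows "NC p X \<le> e"
  using assms by (intro LIMSEQ_le_const2[OF NC_lim]) auto

lemma KC_add: assumes "X \<in> KC p" "Y \<in> KC p" shows "X + Y \<in> KC p"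
  unfolding KC_def padic_Cauchy_def mem_Collect_eq
proof (intro allI impI)
  fix e :: real assume "e > 0"
  obtain M M' where M: "\<And>m n. m \<ge> M \<Longrightarrow> n \<ge> M \<Longrightarrow> rat_abs p (X m - X n) < e"
    "\<And>m n. m \<ge> M' \<Longrightarrow> n \<ge> M' \<Longrightarrow> rat_abs p (Y m - Y n) < e"
    using KC_D[OF assms(1) \<open>e > 0\<close>] KC_D[OF assms(2) \<open>e > 0\<close>] by blast
  have "rat_abs p ((X + Y) m - (X + Y) n) < e" if "m \<ge> max M M'" "n \<ge> max M M'" for m n
  proof -
    have "(X + Y) m - (X + Y) n = (X m - X n) + (Y m - Y n)" by simp
    hence "rat_abs p ((X + Y) m - (X + Y) n) \<le> max (rat_abs p (X m - X n)) (rat_abs p (Y m - Y n))"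
      using rat_abs_add[OF pr] by metis
    thus ?thesis using M(1)[of m n] M(2)[of m n] that by simp
  qed
  thus "\<exists>M. \<forall>m\<ge>M. \<forall>n\<ge>M. rat_abs p ((X + Y) m - (X + Y) n) < e" by blast
qed

lemma KC_bounded: assumes "X \<in> KC p" shows "\<exists>B>0. \<forall>n. rat_abs p (X n) \<le> B"
proof -
  have "Bseq (\<lambda>n. rat_abs p (X n))" using NC_lim[OF assms] by (intro convergent_imp_Bseq convergentI)
  then obtain B where "B > 0" "\<forall>n. norm (rat_abs p (X n)) \<le> B" by (auto simp: Bseq_def)
  thus ?thesis using rat_abs_nonneg by (intro exI[of _ B]) auto
qed

lemma KC_mult: assumes "X \<in> KC p" "Y \<in> KC p" shows "X * Y \<in> KC p"
  unfolding KC_def padic_Cauchy_def mem_Collect_eq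
proof (intro allI impI)
  fix e :: real assume "e > 0"
  obtain B B' where B: "B > 0" "\<And>n. rat_abs p (X n) \<le> B" "B' > 0" "\<And>n. rat_abs p (Y n) \<le> B'"
    using KC_bounded[OF assms(1)] KC_bounded[OF assms(2)] by blast
  obtain M M' where M: "\<And>m n. m \<ge> M \<Longrightarrow> n \<ge> M \<Longrightarrow> rat_abs p (X m - X n) < e / B'"
    "\<And>m n. m \<ge> M' \<Longrightarrow> n \<ge> M' \<Longrightarrow> rat_abs p (Y m - Y n) < e / B"
    using KC_D[OF assms(1), of "e / B'"] KC_D[OF assms(2), of "e / B"] \<open>e > 0\<close> B(1,3) by (meson divide_pos_pos)
  have "rat_abs p ((X * Y) m - (X * Y) n) < e" if "m \<ge> max M M'" "n \<ge> max M M'" for m n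
  proof -
    have "(X * Y) m - (X * Y) n = (X m - X n) * Y m + X n * (Y m - Y n)" by (simp add: algebra_simps)
    hence "rat_abs p ((X * Y) m - (X * Y) n)
        \<le> max (rat_abs p (X m - X n) * rat_abs p (Y m)) (rat_abs p (X n) * rat_abs p (Y m - Y n))"
      using rat_abs_add[OF pr] rat_abs_mult[OF pr] by metis
    moreover have "rat_abs p (X m - X n) * rat_abs p (Y m) < e"
    proof -
      have "rat_abs p (X m - X n) * rat_abs p (Y m) \<le> rat_abs p (X m - X n) * B'"
        using B(4) rat_abs_nonneg by (intro mult_left_mono)
      also have "\<dots> < e / B' * B'" using M(1)[of m n] that B(3) by (intro mult_strict_right_mono) auto
      finally show ?thesis using B(3) by simp
    qed
    moreover have "rat_abs p (X n) * rat_abs p (Y m - Y n) < e"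
    proof -
      have "rat_abs p (X n) * rat_abs p (Y m - Y n) \<le> B * rat_abs p (Y m - Y n)"
        using B(2) rat_abs_nonneg by (intro mult_right_mono)
      also have "\<dots> < B * (e / B)" using M(2)[of m n] that B(1) by (intro mult_strict_left_mono) auto
      finally show ?thesis using B(1) by simp
    qed
    ultimately show ?thesis by simp
  qed
  thus "\<exists>M. \<forall>m\<ge>M. \<forall>n\<ge>M. rat_abs p ((X * Y) m - (X * Y) n) < e" by blast
qed

lemma KC_const: "const_seq q \<in> KC p"
  by (auto simp: KC_def padic_Cauchy_def const_seq_def)

lemma KC_diff: assumes "X \<in> KC p" "Y \<in> KC p" shows "X - Y \<in> KC p"
proof -
  have "X - Y = X + const_seq (- 1) * Y" by (simp add: fun_eq_iff const_seq_def)
  thus ?thesis using KC_add KC_mult KC_const assms by metis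
qed

lemma NC_const: "NC p (const_seq q) = rat_abs p q"
  by (rule NC_eqI[OF KC_const]) (simp add: const_seq_def)

lemma NC_add_max: assumes "X \<in> KC p" "Y \<in> KC p" shows "NC p (X + Y) \<le> max (NC p X) (NC p Y)"
proof (rule LIMSEQ_le)
  show "(\<lambda>n. rat_abs p ((X + Y) n)) \<longlonglongrightarrow> NC p (X + Y)" by (intro NC_lim KC_add assms)
  show "(\<lambda>n. max (rat_abs p (X n)) (rat_abs p (Y n))) \<longlonglongrightarrow> max (NC p X) (NC p Y)"
    by (intro tendsto_max NC_lim assms)
qed (use rat_abs_add[OF pr] in auto)

lemma NC_mult: assumes "X \<in> KC p" "Y \<in> KC p" shows "NC p (X * Y) = NC p X * NC p Y"
proof (rule NC_eqI[OF KC_mult[OF assms]])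
  show "(\<lambda>n. rat_abs p ((X * Y) n)) \<longlonglongrightarrow> NC p X * NC p Y"
    using tendsto_mult[OF NC_lim[OF assms(1)] NC_lim[OF assms(2)]] by (simp add: rat_abs_mult[OF pr])
qed

lemma NC_nonneg: "X \<in> KC p \<Longrightarrow> 0 \<le> NC p X"
  using LIMSEQ_le_const[OF NC_lim, of X 0] rat_abs_nonneg by blast

lemma NC_dense: assumes "X \<in> KC p" "e > 0" shows "\<exists>q. NC p (X - const_seq q) < e"
proof -
  obtain M where M: "\<And>m n. m \<ge> M \<Longrightarrow> n \<ge> M \<Longrightarrow> rat_abs p (X m - X n) < e / 2"
    using KC_D[OF assms(1), of "e / 2"] assms(2) by auto
  have "NC p (X - const_seq (X M)) \<le> e / 2"
  proof (rule NC_le[OF KC_diff[OF assms(1) KC_const]])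
    fix n assume "M \<le> n"
    thus "rat_abs p ((X - const_seq (X M)) n) \<le> e / 2" using M[of n M] by (simp add: const_seq_def)
  qed
  thus ?thesis using assms(2) by (intro exI[of _ "X M"]) simp
qed

text \<open>Replace each X n by a rational constant within 1/(n + 1). The sequence of these
  rationals is itself Cauchy, and it is the limit.\<close>

lemma NC_complete:
  assumes X: "\<And>n. X n \<in> KC p" and C: "\<And>e. e > 0 \<Longrightarrow> \<exists>M. \<forall>m\<ge>M. \<forall>n\<ge>M. NC p (X m - X n) < e"
  shows "\<exists>x\<in>KC p. (\<lambda>n. NC p (X n - x)) \<longlonglongrightarrow> 0"
proof -
  have "\<forall>n. \<exists>q. NC p (X n - const_seq q) < 1 / real (Suc n)" using NC_dense[OF X] by simp
  then obtain r where r: "\<And>n. NC p (X n - const_seq (r n)) < 1 / real (Suc n)" by metis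
  have r': "NC p (const_seq (r n) - X n) < 1 / real (Suc n)" for n
  proof -
    have "const_seq (r n) - X n = const_seq (- 1) * (X n - const_seq (r n))"
      by (simp add: fun_eq_iff const_seq_def)
    thus ?thesis using r[of n] NC_mult[OF KC_const KC_diff[OF X KC_const]] NC_const[of "- 1"]
        rat_abs_uminus[OF pr, of 1] by simp
  qed
  have ev: "\<exists>M. \<forall>n\<ge>M. 1 / real (Suc n) < e" if "e > 0" for e
    using LIMSEQ_D[OF LIMSEQ_inverse_real_of_nat that] by (auto simp: inverse_eq_divide)
  have rC: "\<exists>M. \<forall>m\<ge>M. \<forall>n\<ge>M. rat_abs p (r m - r n) < e" if e: "e > 0" for e
  proof -
    obtain M1 M2 where M: "\<And>m n. m \<ge> M1 \<Longrightarrow> n \<ge> M1 \<Longrightarrow> NC p (X m - X n) < e"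
      "\<And>n. n \<ge> M2 \<Longrightarrow> 1 / real (Suc n) < e" using C[OF e] ev[OF e] by blast
    have "rat_abs p (r m - r n) < e" if "m \<ge> max M1 M2" "n \<ge> max M1 M2" for m n
    proof -
      have "const_seq (r m - r n) = ((const_seq (r m) - X m) + (X m - X n)) + (X n - const_seq (r n))"
        by (simp add: fun_eq_iff const_seq_def)
      hence "rat_abs p (r m - r n) = NC p (((const_seq (r m) - X m) + (X m - X n)) + (X n - const_seq (r n)))"
        using NC_const by metis
      also have "\<dots> \<le> max (max (NC p (const_seq (r m) - X m)) (NC p (X m - X n))) (NC p (X n - const_seq (r n)))"
        by (intro order.trans[OF NC_add_max] max.mono order.refl NC_add_max KC_add KC_diff X KC_const)
      also have "\<dots> < e" using M(1)[of m n] M(2)[of m] M(2)[of n] r'[of m] r[of n] that by simp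
      finally show ?thesis .
    qed
    thus ?thesis by blast
  qed
  hence rK: "r \<in> KC p" by (simp add: KC_def padic_Cauchy_def)
  have "(\<lambda>n. NC p (X n - r)) \<longlonglongrightarrow> 0"
  proof (rule LIMSEQ_I)
    fix e :: real assume e: "e > 0"
    obtain M1 where M1: "\<And>m n. m \<ge> M1 \<Longrightarrow> n \<ge> M1 \<Longrightarrow> rat_abs p (r m - r n) < e / 2"
      using rC[of "e / 2"] e by auto
    obtain M2 where M2: "\<And>n. n \<ge> M2 \<Longrightarrow> 1 / real (Suc n) < e" using ev[OF e] by blast
    have "NC p (X n - r) < e" if "n \<ge> max M1 M2" for n
    proof -
      have "NC p (const_seq (r n) - r) \<le> e / 2"
      proof (rule NC_le[OF KC_diff[OF KC_const rK]])
        fix k assume "M1 \<le> k"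
        thus "rat_abs p ((const_seq (r n) - r) k) \<le> e / 2" using M1[of n k] that by (simp add: const_seq_def)
      qed
      moreover have "X n - r = (X n - const_seq (r n)) + (const_seq (r n) - r)" by simp
      hence "NC p (X n - r) \<le> max (NC p (X n - const_seq (r n))) (NC p (const_seq (r n) - r))"
        using NC_add_max[OF KC_diff[OF X KC_const] KC_diff[OF KC_const rK]] by metis
      ultimately show ?thesis using r[of n] M2[of n] that e by simp
    qed
    thus "\<exists>M. \<forall>n\<ge>M. norm (NC p (X n - r) - 0) < e"
      using NC_nonneg[OF KC_diff[OF X rK]] by (intro exI[of _ "max M1 M2"]) simp
  qed
  thus ?thesis using rK by blast
qed

lemma padic_KC: "padic p (KC p) (NC p) const_seq"
  by unfold_locales
    (use pr KC_add KC_mult KC_const NC_const NC_nonneg NC_mult NC_add_max NC_dense NC_complete in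
      \<open>auto simp: const_seq_def fun_eq_iff\<close>)

interpretation padic p "KC p" "NC p" const_seq by (rule padic_KC)

section \<open>The quotient map onto the p-adic numbers\<close>

lemma null_seqs_iff: "X \<in> null_seqs p \<longleftrightarrow> X \<in> KC p \<and> NC p X = 0"
proof
  assume "X \<in> null_seqs p"
  hence lim: "(\<lambda>n. rat_abs p (X n)) \<longlonglongrightarrow> 0" by (simp add: null_seqs_def)
  have "padic_Cauchy p X" unfolding padic_Cauchy_def
  proof (intro allI impI)
    fix e :: real assume "e > 0"
    then obtain M where "\<forall>n\<ge>M. norm (rat_abs p (X n) - 0) < e" using LIMSEQ_D[OF lim] by blast
    hence M: "\<And>n. n \<ge> M \<Longrightarrow> rat_abs p (X n) < e" using rat_abs_nonneg by simp
    have "rat_abs p (X m - X n) < e" if "m \<ge> M" "n \<ge> M" for m n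
      using rat_abs_diff_max[of "X m" "X n"] M[OF that(1)] M[OF that(2)] by simp
    thus "\<exists>M. \<forall>m\<ge>M. \<forall>n\<ge>M. rat_abs p (X m - X n) < e" by blast
  qed
  thus "X \<in> KC p \<and> NC p X = 0" using NC_eqI lim by (simp add: KC_def)
next
  assume "X \<in> KC p \<and> NC p X = 0"
  thus "X \<in> null_seqs p" using NC_lim[of X] by (simp add: null_seqs_def)
qed

lemma Cauchy_ring_simps:
  "carrier (Cauchy_ring p) = KC p" "X \<oplus>\<^bsub>Cauchy_ring p\<^esub> Y = X + Y" "X \<otimes>\<^bsub>Cauchy_ring p\<^esub> Y = X * Y"
  "\<zero>\<^bsub>Cauchy_ring p\<^esub> = 0" "\<one>\<^bsub>Cauchy_ring p\<^esub> = 1"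
  by (simp_all add: Cauchy_ring_def KC_def fun_eq_iff)

lemma cring_Cauchy: "cring (Cauchy_ring p)"
proof (rule cringI)
  show "abelian_group (Cauchy_ring p)"
    by (rule abelian_groupI) (auto simp: Cauchy_ring_simps algebra_simps intro: exI[of _ "- _"] bexI[of _ "- _"])
  show "comm_monoid (Cauchy_ring p)"
    by (rule comm_monoidI) (auto simp: Cauchy_ring_simps algebra_simps)
qed (auto simp: Cauchy_ring_simps algebra_simps)

lemma a_inv_Cauchy: assumes "X \<in> KC p" shows "\<ominus>\<^bsub>Cauchy_ring p\<^esub> X = - X"
proof -
  interpret C: cring "Cauchy_ring p" by (rule cring_Cauchy)
  show ?thesis by (rule C.minus_equality) (use assms in \<open>auto simp: Cauchy_ring_simps\<close>)
qed

lemma ideal_null: "ideal (null_seqs p) (Cauchy_ring p)"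
proof -
  interpret C: cring "Cauchy_ring p" by (rule cring_Cauchy)
  show ?thesis
  proof (rule idealI[OF C.ring_axioms])
    show "subgroup (null_seqs p) (add_monoid (Cauchy_ring p))"
    proof (rule C.add.subgroupI)
      fix X Y assume "X \<in> null_seqs p" "Y \<in> null_seqs p"
      hence "X \<in> KC p" "Y \<in> KC p" "NC p X = 0" "NC p Y = 0" by (simp_all add: null_seqs_iff)
      moreover from this have "NC p (X + Y) = 0"
        using NC_add_max[of X Y] NC_nonneg[OF KC_add[of X Y]] by (intro antisym) simp_all
      ultimately show "X \<oplus>\<^bsub>Cauchy_ring p\<^esub> Y \<in> null_seqs p"
        by (simp add: null_seqs_iff Cauchy_ring_simps)
    next
      fix X assume "X \<in> null_seqs p"
      thus "\<ominus>\<^bsub>Cauchy_ring p\<^esub> X \<in> null_seqs p"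
        using a_inv_Cauchy[of X] by (auto simp: null_seqs_iff)
    next
      have "0 \<in> null_seqs p" by (simp add: null_seqs_iff)
      thus "null_seqs p \<noteq> {}" by blast
    qed (auto simp: null_seqs_iff Cauchy_ring_simps)
  qed (auto simp: null_seqs_iff Cauchy_ring_simps N_mult)
qed

definition cl :: "(nat \<Rightarrow> rat) \<Rightarrow> (nat \<Rightarrow> rat) set" where
  "cl X = null_seqs p +>\<^bsub>Cauchy_ring p\<^esub> X"

lemma cl_hom: "ring_hom_cring (Cauchy_ring p) (Qp p) cl"
  unfolding Qp_def cl_def using ideal.rcos_ring_hom_cring[OF ideal_null cring_Cauchy] by simp

lemma mem_cl: "X \<in> KC p \<Longrightarrow> Y \<in> cl X \<longleftrightarrow> Y \<in> KC p \<and> NC p (Y - X) = 0"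
proof -
  assume X: "X \<in> KC p"
  have "Y \<in> cl X \<longleftrightarrow> (\<exists>Z\<in>null_seqs p. Y = Z + X)"
    by (auto simp: cl_def a_r_coset_def' Cauchy_ring_simps)
  also have "\<dots> \<longleftrightarrow> Y - X \<in> null_seqs p" by (auto intro: bexI[of _ "Y - X"])
  also have "\<dots> \<longleftrightarrow> Y \<in> KC p \<and> NC p (Y - X) = 0"
    using X K_add[of "Y - X" X] by (auto simp: null_seqs_iff)
  finally show ?thesis .
qed

text \<open>The dictionary between equality in the quotient and the seminorm on
  representatives.\<close>

lemma cl_eq_iff: assumes "X \<in> KC p" "Y \<in> KC p" shows "cl X = cl Y \<longleftrightarrow> NC p (X - Y) = 0"
proof
  assume "cl X = cl Y"
  moreover have "X \<in> cl X" using assms by (simp add: mem_cl)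
  ultimately show "NC p (X - Y) = 0" using assms by (simp add: mem_cl)
next
  assume eq: "NC p (X - Y) = 0"
  have "NC p (Z - X) = NC p (Z - Y)" if "Z \<in> KC p" for Z
  proof (rule N_cong)
    have "(Z - X) - (Z - Y) = - (X - Y)" by simp
    thus "NC p (Z - X - (Z - Y)) = 0" using eq N_minus[OF K_diff[OF assms]] by (simp only:)
  qed (use assms that in auto)
  thus "cl X = cl Y" using assms by (auto simp: mem_cl)
qed

lemma carrier_Qp: "carrier (Qp p) = cl ` KC p"
  by (auto simp: Qp_def FactRing_def A_RCOSETS_def' cl_def Cauchy_ring_simps)

lemma cl_carrier [simp]: "X \<in> KC p \<Longrightarrow> cl X \<in> carrier (Qp p)"
  by (simp add: carrier_Qp)

lemma cl_add: "X \<in> KC p \<Longrightarrow> Y \<in> KC p \<Longrightarrow> cl X \<oplus>\<^bsub>Qp p\<^esub> cl Y = cl (X + Y)"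
  and cl_mult: "X \<in> KC p \<Longrightarrow> Y \<in> KC p \<Longrightarrow> cl X \<otimes>\<^bsub>Qp p\<^esub> cl Y = cl (X * Y)"
  and cl_0: "\<zero>\<^bsub>Qp p\<^esub> = cl 0"
proof -
  interpret h: ring_hom_cring "Cauchy_ring p" "Qp p" cl by (rule cl_hom)
  show "X \<in> KC p \<Longrightarrow> Y \<in> KC p \<Longrightarrow> cl X \<oplus>\<^bsub>Qp p\<^esub> cl Y = cl (X + Y)"
    "X \<in> KC p \<Longrightarrow> Y \<in> KC p \<Longrightarrow> cl X \<otimes>\<^bsub>Qp p\<^esub> cl Y = cl (X * Y)"
    using h.hom_add[of X Y] h.hom_mult[of X Y] by (simp_all add: Cauchy_ring_simps)
  show "\<zero>\<^bsub>Qp p\<^esub> = cl 0" using h.hom_zero by (simp add: Cauchy_ring_simps)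
qed

lemma cl_minus: assumes "X \<in> KC p" "Y \<in> KC p" shows "cl X \<ominus>\<^bsub>Qp p\<^esub> cl Y = cl (X - Y)"
proof -
  interpret h: ring_hom_cring "Cauchy_ring p" "Qp p" cl by (rule cl_hom)
  have "\<ominus>\<^bsub>Qp p\<^esub> cl Y = cl (- Y)"
    using h.hom_a_inv[of Y] assms by (simp add: Cauchy_ring_simps a_inv_Cauchy)
  thus ?thesis using assms by (simp add: a_minus_def cl_add)
qed

lemma cl_pow: assumes "X \<in> KC p" shows "cl X [^]\<^bsub>Qp p\<^esub> (n::nat) = cl (X ^ n)"
proof (induction n)
  case 0
  interpret h: ring_hom_cring "Cauchy_ring p" "Qp p" cl by (rule cl_hom)
  have "\<one>\<^bsub>Qp p\<^esub> = cl 1" using h.hom_one by (simp only: Cauchy_ring_simps)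
  thus ?case by (simp only: h.S.nat_pow_0 power_0)
next
  case (Suc n)
  interpret h: ring_hom_cring "Cauchy_ring p" "Qp p" cl by (rule cl_hom)
  have "cl X [^]\<^bsub>Qp p\<^esub> Suc n = cl (X ^ n) \<otimes>\<^bsub>Qp p\<^esub> cl X" by (simp only: h.S.nat_pow_Suc Suc)
  also have "\<dots> = cl (X ^ n * X)" by (intro cl_mult K_power assms)
  finally show ?case by (simp only: power_Suc2)
qed

lemma cl_sum:
  fixes n :: nat
  assumes "\<And>k. k < n \<Longrightarrow> X k \<in> KC p" shows "(\<Oplus>\<^bsub>Qp p\<^esub>k\<in>{..<n}. cl (X k)) = cl (\<Sum>k<n. X k)"
  using assms
proof (induction n)
  case 0
  interpret h: ring_hom_cring "Cauchy_ring p" "Qp p" cl by (rule cl_hom)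
  show ?case by (simp only: lessThan_0 h.S.finsum_empty cl_0 sum.empty)
next
  case (Suc n)
  interpret h: ring_hom_cring "Cauchy_ring p" "Qp p" cl by (rule cl_hom)
  have "(\<Oplus>\<^bsub>Qp p\<^esub>k\<in>{..<Suc n}. cl (X k)) = cl (X n) \<oplus>\<^bsub>Qp p\<^esub> (\<Oplus>\<^bsub>Qp p\<^esub>k\<in>{..<n}. cl (X k))"
    unfolding lessThan_Suc by (rule h.S.finsum_insert) (use Suc.prems in auto)
  also have "(\<Oplus>\<^bsub>Qp p\<^esub>k\<in>{..<n}. cl (X k)) = cl (\<Sum>k<n. X k)"
    using Suc.prems by (intro Suc.IH) simp
  also have "cl (X n) \<oplus>\<^bsub>Qp p\<^esub> cl (\<Sum>k<n. X k) = cl (X n + (\<Sum>k<n. X k))"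
    using Suc.prems by (intro cl_add K_sum) simp_all
  finally show ?case by (simp only: sum.lessThan_Suc add.commute)
qed

text \<open>All representatives of a class have the same limit of absolute values, so the definite
  description in \<open>Qp_norm\<close> denotes.\<close>

lemma Qp_norm_cl: assumes "X \<in> KC p" shows "Qp_norm p (cl X) = NC p X"
  unfolding Qp_norm_def
proof (rule the_equality)
  have "X \<in> cl X" using assms by (simp add: mem_cl)
  thus "\<exists>Y\<in>cl X. (\<lambda>n. rat_abs p (Y n)) \<longlonglongrightarrow> NC p X" using NC_lim[OF assms] by blast
next
  fix r assume "\<exists>Y\<in>cl X. (\<lambda>n. rat_abs p (Y n)) \<longlonglongrightarrow> r"
  then obtain Y where Y: "Y \<in> KC p" "NC p (Y - X) = 0" "(\<lambda>n. rat_abs p (Y n)) \<longlonglongrightarrow> r"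
    using assms by (auto simp: mem_cl)
  thus "r = NC p X" using NC_eqI[OF Y(1,3)] N_cong[OF Y(1) assms Y(2)] by simp
qed

lemma Qp_of_rat_cl: "Qp_of_rat p q = cl (const_seq q)"
  by (simp add: Qp_of_rat_def cl_def const_seq_def)

lemma Qp_val_cl: assumes "X \<in> KC p" "NC p X = P v" shows "Qp_val p (cl X) = v"
  unfolding Qp_val_def Qp_norm_cl[OF assms(1)] assms(2)
  using powi_inj[OF p_gt_1] by (intro the_equality) auto

definition rep :: "(nat \<Rightarrow> rat) set \<Rightarrow> nat \<Rightarrow> rat" where
  "rep x = (SOME X. X \<in> KC p \<and> cl X = x)"

lemma rep: assumes "x \<in> carrier (Qp p)" shows "rep x \<in> KC p" "cl (rep x) = x"
  using someI_ex[of "\<lambda>X. X \<in> KC p \<and> cl X = x"] assms unfolding rep_def carrier_Qp by blast+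

lemma cl_Zp: "X \<in> KC p \<Longrightarrow> cl X \<in> Zp p \<longleftrightarrow> X \<in> integers"
  by (auto simp: Zp_def Qp_norm_cl intro: integersI dest: integers_N)

lemma rep_Zp: "x \<in> Zp p \<Longrightarrow> rep x \<in> integers"
  using rep[of x] cl_Zp[of "rep x"] by (auto simp: Zp_def)

lemma Zp_carrier: "x \<in> Zp p \<Longrightarrow> x \<in> carrier (Qp p)"
  by (simp add: Zp_def)

lemma integers_cl_Zp: "X \<in> integers \<Longrightarrow> cl X \<in> Zp p"
  using cl_Zp by auto

lemma tendsto_cl:
  "(\<And>n. X n \<in> KC p) \<Longrightarrow> x \<in> KC p \<Longrightarrow> Qp_tendsto p (\<lambda>n. cl (X n)) (cl x) \<longleftrightarrow> (\<lambda>n. NC p (X n - x)) \<longlonglongrightarrow> 0"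
  by (simp add: Qp_tendsto_def cl_minus Qp_norm_cl)

section \<open>Analytic functions and multiplicities on representatives\<close>

definition lift :: "((nat \<Rightarrow> rat) set \<Rightarrow> (nat \<Rightarrow> rat) set) \<Rightarrow> (nat \<Rightarrow> rat) \<Rightarrow> nat \<Rightarrow> rat" where
  "lift f X = rep (f (cl X))"

lemma series_cl:
  "(\<And>k. a k \<in> KC p) \<Longrightarrow> X \<in> KC p \<Longrightarrow>
   (\<Oplus>\<^bsub>Qp p\<^esub>k\<in>{..<n}. cl (a k) \<otimes>\<^bsub>Qp p\<^esub> cl X [^]\<^bsub>Qp p\<^esub> (k::nat)) = cl (\<Sum>k<n. a k * X ^ k)"
  by (simp add: cl_pow cl_mult cl_sum)

lemma lift_analytic: assumes "Zp_analytic p f" shows "\<exists>c. analytic_with c (lift f)"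
proof -
  obtain a where a: "\<And>k. a k \<in> carrier (Qp p)"
    "\<And>x. x \<in> Zp p \<Longrightarrow> Qp_tendsto p (\<lambda>n. \<Oplus>\<^bsub>Qp p\<^esub>k\<in>{..<n}. a k \<otimes>\<^bsub>Qp p\<^esub> x [^]\<^bsub>Qp p\<^esub> (k::nat)) (f x)"
    using assms unfolding Zp_analytic_def by blast
  have f: "f x \<in> carrier (Qp p)" if "x \<in> Zp p" for x using assms that by (auto simp: Zp_analytic_def)
  define c where "c = (\<lambda>k. rep (a k))"
  have c: "c k \<in> KC p" "cl (c k) = a k" for k using rep[OF a(1)] by (simp_all add: c_def)
  have "lift f X \<in> KC p \<and> (\<lambda>n. NC p ((\<Sum>k<n. c k * X ^ k) - lift f X)) \<longlonglongrightarrow> 0" if X: "X \<in> integers" for X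
  proof -
    note fX = rep[OF f[OF integers_cl_Zp[OF X]]]
    have "Qp_tendsto p (\<lambda>n. cl (\<Sum>k<n. c k * X ^ k)) (cl (lift f X))"
      using a(2)[OF integers_cl_Zp[OF X]] series_cl[of c X] c fX X by (simp add: lift_def)
    thus ?thesis using fX c X by (subst (asm) tendsto_cl) (simp_all add: lift_def)
  qed
  thus ?thesis using c unfolding analytic_with_def by blast
qed

text \<open>The way back from representatives, which \<open>root_mult\<close> calls for: it
  quantifies over cofactors defined on \<open>Zp\<close> itself.\<close>

lemma analytic_descend: assumes "analytic_with c G" shows "Zp_analytic p (\<lambda>x. cl (G (rep x)))"
proof -
  note A = analytic_withD[OF assms]
  have "Qp_tendsto p (\<lambda>n. \<Oplus>\<^bsub>Qp p\<^esub>k\<in>{..<n}. cl (c k) \<otimes>\<^bsub>Qp p\<^esub> x [^]\<^bsub>Qp p\<^esub> (k::nat)) (cl (G (rep x)))"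
    if x: "x \<in> Zp p" for x
  proof -
    have "Qp_tendsto p (\<lambda>n. cl (\<Sum>k<n. c k * rep x ^ k)) (cl (G (rep x)))"
      using A rep_Zp[OF x] by (subst tendsto_cl) simp_all
    thus ?thesis using series_cl[OF A(1) integersD[OF rep_Zp[OF x]]] rep[OF Zp_carrier[OF x]] by simp
  qed
  thus ?thesis unfolding Zp_analytic_def using A(1) A(2)[OF rep_Zp]
    by (intro conjI exI[of _ "\<lambda>k. cl (c k)"] ballI allI) auto
qed

lemma cl_lift:
  assumes "Zp_analytic p f" "X \<in> integers" shows "cl (lift f X) = f (cl X)" "lift f X \<in> KC p"
  using rep[of "f (cl X)"] assms integers_cl_Zp by (auto simp: lift_def Zp_analytic_def)

lemma lift_zero_iff:
  assumes "Zp_analytic p f" "X \<in> integers" shows "NC p (lift f X) = 0 \<longleftrightarrow> f (cl X) = \<zero>\<^bsub>Qp p\<^esub>"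
  using cl_eq_iff[of "lift f X" 0] cl_lift[OF assms] by (simp add: cl_0)

text \<open>The given factorization descends to a witness for m. Conversely a factorization with
  exponent m' lifts to representatives, where \<open>multiplicity_le\<close> bounds m'.\<close>

lemma root_mult_eq:
  assumes f: "Zp_analytic p f" and th: "\<theta> \<in> integers" and G: "analytic_with c G" "NC p (G \<theta>) \<noteq> 0"
    and eq: "\<And>x. x \<in> integers \<Longrightarrow> NC p (lift f x - (x - \<theta>) ^ m * G x) = 0"
  shows "root_mult p f (cl \<theta>) = (m::nat)"
  unfolding root_mult_def
proof (rule Greatest_equality)
  have "f x = (x \<ominus>\<^bsub>Qp p\<^esub> cl \<theta>) [^]\<^bsub>Qp p\<^esub> m \<otimes>\<^bsub>Qp p\<^esub> cl (G (rep x))" if x: "x \<in> Zp p" for x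
  proof -
    note X = rep_Zp[OF x] rep(2)[OF Zp_carrier[OF x]]
    note K = integersD[OF X(1)] integersD[OF th] analytic_withD(2)[OF G(1) X(1)] cl_lift(2)[OF f X(1)]
    have "f x = cl (lift f (rep x))" using cl_lift(1)[OF f X(1)] X(2) by simp
    also have "\<dots> = cl ((rep x - \<theta>) ^ m * G (rep x))"
      using eq[OF X(1)] K by (subst cl_eq_iff) auto
    also have "\<dots> = (cl (rep x) \<ominus>\<^bsub>Qp p\<^esub> cl \<theta>) [^]\<^bsub>Qp p\<^esub> m \<otimes>\<^bsub>Qp p\<^esub> cl (G (rep x))"
      using K by (simp add: cl_minus cl_pow cl_mult)
    finally show ?thesis by (simp only: X(2))
  qed
  thus "\<exists>g. Zp_analytic p g \<and> (\<forall>x\<in>Zp p. f x = (x \<ominus>\<^bsub>Qp p\<^esub> cl \<theta>) [^]\<^bsub>Qp p\<^esub> m \<otimes>\<^bsub>Qp p\<^esub> g x)"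
    using analytic_descend[OF G(1)] by blast
next
  fix m' :: nat assume "\<exists>g. Zp_analytic p g \<and> (\<forall>x\<in>Zp p. f x = (x \<ominus>\<^bsub>Qp p\<^esub> cl \<theta>) [^]\<^bsub>Qp p\<^esub> m' \<otimes>\<^bsub>Qp p\<^esub> g x)"
  then obtain g where g: "Zp_analytic p g"
    "\<And>x. x \<in> Zp p \<Longrightarrow> f x = (x \<ominus>\<^bsub>Qp p\<^esub> cl \<theta>) [^]\<^bsub>Qp p\<^esub> m' \<otimes>\<^bsub>Qp p\<^esub> g x" by blast
  obtain c' where c': "analytic_with c' (lift g)" using lift_analytic[OF g(1)] by blast
  show "m' \<le> m"
  proof (rule multiplicity_le[OF G c' th])
    fix x assume x: "x \<in> integers"
    note K = integersD[OF x] integersD[OF th] analytic_withD(2)[OF G(1) x] cl_lift(2)[OF f x] cl_lift(2)[OF g(1) x]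
    have "cl ((x - \<theta>) ^ m * G x) = cl (lift f x)" using eq[OF x] K N_commute by (subst cl_eq_iff) auto
    also have "\<dots> = f (cl x)" by (rule cl_lift(1)[OF f x])
    also have "\<dots> = (cl x \<ominus>\<^bsub>Qp p\<^esub> cl \<theta>) [^]\<^bsub>Qp p\<^esub> m' \<otimes>\<^bsub>Qp p\<^esub> cl (lift g x)"
      using g(2)[OF integers_cl_Zp[OF x]] cl_lift(1)[OF g(1) x] by simp
    also have "\<dots> = cl ((x - \<theta>) ^ m' * lift g x)" using K by (simp add: cl_minus cl_pow cl_mult)
    finally show "NC p ((x - \<theta>) ^ m * G x - (x - \<theta>) ^ m' * lift g x) = 0"
      using K by (subst (asm) cl_eq_iff) auto
  qed
qed

text \<open>With M the modulus, the quotient (X - Y) / M is integral exactly under the norm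
  bound.\<close>

lemma Zp_cong_iff:
  assumes "X \<in> KC p" "Y \<in> KC p"
  shows "Zp_cong p ((p ^ l) ^ d) (cl X) (cl Y) \<longleftrightarrow> NC p (X - Y) \<le> P (int (l * d))"
proof
  define M where "M = (p ^ l) ^ d"
  have NM: "NC p (const_seq (of_nat M)) = P (int (l * d))"
  proof -
    have "NC p (const_seq (of_nat M)) = NC p (of_nat p ^ (l * d))"
      by (simp only: M_def power_mult of_nat_power iota_power iota_of_nat)
    also have "\<dots> = P 1 ^ (l * d)" using N_power[OF K_of_nat] N_of_nat_p by simp
    finally show ?thesis using P_mult_nat[of 1 "l * d"] by simp
  qed
  show "NC p (X - Y) \<le> P (int (l * d))" if "Zp_cong p ((p ^ l) ^ d) (cl X) (cl Y)"
  proof -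
    obtain z where z: "z \<in> Zp p" "cl X \<ominus>\<^bsub>Qp p\<^esub> cl Y = Qp_of_rat p (of_nat M) \<otimes>\<^bsub>Qp p\<^esub> z"
      using \<open>Zp_cong p ((p ^ l) ^ d) (cl X) (cl Y)\<close> unfolding Zp_cong_def M_def by blast
    note Z = rep_Zp[OF z(1)] rep(2)[OF Zp_carrier[OF z(1)]]
    have "cl (X - Y) = cl (const_seq (of_nat M) * rep z)"
      using z(2) Z assms by (metis Qp_of_rat_cl cl_minus cl_mult K_iota integersD)
    hence "NC p (X - Y) = NC p (const_seq (of_nat M) * rep z)"
      using assms Z by (metis K_iota K_mult K_diff Qp_norm_cl integersD)
    also have "\<dots> = P (int (l * d)) * NC p (rep z)" by (simp only: N_mult K_iota integersD[OF Z(1)] NM)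
    also have "\<dots> \<le> P (int (l * d))" using integers_N[OF Z(1)] by (intro mult_left_le) simp_all
    finally show ?thesis .
  qed
  show "Zp_cong p ((p ^ l) ^ d) (cl X) (cl Y)" if le: "NC p (X - Y) \<le> P (int (l * d))"
  proof -
    define z where "z = const_seq (1 / of_nat M) * (X - Y)"
    have M0: "M \<noteq> 0" using prime_gt_0_nat[OF pr] by (simp add: M_def)
    have zK: "z \<in> KC p" unfolding z_def by (intro K_mult K_iota K_diff assms)
    have "const_seq (of_nat M) * const_seq (1 / of_nat M) = 1"
      using M0 by (simp only: iota_mult[symmetric]) simp
    hence eq: "const_seq (of_nat M) * z = X - Y" unfolding z_def by (simp only: mult.assoc[symmetric] mult_1_left)
    hence "P (int (l * d)) * NC p z \<le> P (int (l * d)) * 1"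
      using le N_mult[OF K_iota zK] NM by (metis mult_1_right)
    hence "NC p z \<le> 1" using P_pos mult_le_cancel_left_pos by blast
    hence "cl z \<in> Zp p" using zK integersI integers_cl_Zp by blast
    moreover have "cl X \<ominus>\<^bsub>Qp p\<^esub> cl Y = Qp_of_rat p (of_nat M) \<otimes>\<^bsub>Qp p\<^esub> cl z"
      using assms zK eq by (metis Qp_of_rat_cl cl_minus cl_mult K_iota)
    ultimately show ?thesis unfolding Zp_cong_def M_def by blast
  qed
qed

end

section \<open>Periodic and automatic digit sequences\<close>

lemma has_period_cong:
  assumes "has_period a T" "[n = n'] (mod T)" shows "a n = a n'"
proof -
  have "a (n mod T + T * q) = a (n mod T)" for n q
  proof (induction q)
    case (Suc q)
    have "n mod T + T * Suc q = (n mod T + T * q) + T" by simp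
    thus ?case using assms(1) Suc by (simp only: has_period_def)
  qed simp
  hence "a n = a (n mod T)" for n by (metis mult.commute mod_div_mult_eq)
  thus ?thesis using assms(2) by (metis cong_def)
qed

text \<open>Sequences with a given period and a given bound form a finite set closed under n
  \<mapsto> k n + c.\<close>

lemma periodic_imp_k_automatic:
  fixes a :: "nat \<Rightarrow> nat"
  assumes "periodic a" "k \<ge> 2" shows "k_automatic k a"
proof -
  obtain T where T: "has_period a T" using assms(1) by (auto simp: periodic_def)
  hence T1: "T > 0" by (simp add: has_period_def)
  define B where "B = Suc (Max (a ` {..<T}))"
  have "a n < B" for n
  proof -
    have "a n = a (n mod T)" using has_period_cong[OF T] by (metis cong_def mod_mod_trivial)
    also have "\<dots> \<le> Max (a ` {..<T})" using T1 by (intro Max_ge) auto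
    finally show ?thesis by (simp add: B_def)
  qed
  hence aB: "a \<in> {h. (\<forall>n n'. [n = n'] (mod T) \<longrightarrow> h n = h n') \<and> (\<forall>n. h n < B)}"
    using has_period_cong[OF T] by blast
  have "finite (kernel k a)"
  proof (rule finite_kernelI[OF finite_mod_periodic[OF T1, of B] aB])
    fix h :: "nat \<Rightarrow> nat" and c
    assume h: "h \<in> {h. (\<forall>n n'. [n = n'] (mod T) \<longrightarrow> h n = h n') \<and> (\<forall>n. h n < B)}"
    have "[k * n + c = k * n' + c] (mod T)" if "[n = n'] (mod T)" for n n'
      using that by (intro cong_add cong_mult cong_refl)
    thus "(\<lambda>n. h (k * n + c)) \<in> {h. (\<forall>n n'. [n = n'] (mod T) \<longrightarrow> h n = h n') \<and> (\<forall>n. h n < B)}"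
      using h by blast
  qed (use assms(2) in simp)
  thus ?thesis using assms(2) by (simp add: k_automatic_def)
qed

text \<open>k and k + 1 are coprime. This provides an independent base in which to refute strictness
  for periodic sequences.\<close>

lemma mult_indep_Suc: "k \<ge> 2 \<Longrightarrow> mult_indep k (Suc k)"
proof -
  assume k: "k \<ge> 2"
  have "k ^ a \<noteq> Suc k ^ c" if "a \<ge> 1" "c \<ge> 1" for a c
  proof
    assume eq: "k ^ a = Suc k ^ c"
    have "coprime (k ^ a) (Suc k ^ c)" by simp
    hence "k ^ a = 1" using eq by (metis coprime_self nat_dvd_1_iff_1)
    thus False using k that by simp
  qed
  thus ?thesis by (simp add: mult_indep_def)
qed

text \<open>Level i = c q + r of the k-kernel arises from level q of the k^c-kernel by r < c further
  steps, which leaves finitely many possibilities.\<close>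

lemma k_automatic_power_iff:
  assumes "k \<ge> 2" "c \<ge> 1" shows "k_automatic (k ^ c) a \<longleftrightarrow> k_automatic k a"
proof
  assume "k_automatic k a"
  moreover have "kernel (k ^ c) a \<subseteq> kernel k a"
    unfolding kernel_def by (auto simp flip: power_mult)
  moreover have "k ^ c \<ge> 2" using assms self_le_power[of k c] by linarith
  ultimately show "k_automatic (k ^ c) a" using finite_subset by (auto simp: k_automatic_def)
next
  assume A: "k_automatic (k ^ c) a"
  define D where "D = (\<lambda>(h :: nat \<Rightarrow> 'a, r, j) n. h (k ^ r * n + j))"
  have "kernel k a \<subseteq> D ` (kernel (k ^ c) a \<times> (SIGMA r:{..<c}. {..<k ^ r}))"
  proof
    fix h assume "h \<in> kernel k a"
    then obtain i j where h: "h = (\<lambda>n. a (k ^ i * n + j))" "j \<le> k ^ i - 1" by (auto simp: kernel_def)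
    have kp: "k ^ x > 0" for x using assms(1) by simp
    define q r where "q = i div c" and "r = i mod c"
    have i: "i = c * q + r" "r < c" using assms(2) by (simp_all add: q_def r_def)
    define j1 j0 where "j1 = j div k ^ (c * q)" and "j0 = j mod k ^ (c * q)"
    have j: "j = k ^ (c * q) * j1 + j0" by (simp add: j1_def j0_def)
    have j0: "j0 < k ^ (c * q)" unfolding j0_def using kp by (rule mod_less_divisor)
    have "j < k ^ i" using h(2) kp[of i] by linarith
    hence "j < k ^ r * k ^ (c * q)" by (simp add: i(1) power_add mult.commute)
    hence "j1 < k ^ r" unfolding j1_def by (rule less_mult_imp_div_less)
    moreover have "(\<lambda>n. a ((k ^ c) ^ q * n + j0)) \<in> kernel (k ^ c) a"
    proof -
      have "j0 \<le> (k ^ c) ^ q - 1" using j0 unfolding power_mult by linarith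
      thus ?thesis unfolding kernel_def by blast
    qed
    moreover have "h = D ((\<lambda>n. a ((k ^ c) ^ q * n + j0)), r, j1)"
      unfolding h(1) D_def j i(1) prod.case power_mult[symmetric] by (simp add: power_add algebra_simps)
    ultimately show "h \<in> D ` (kernel (k ^ c) a \<times> (SIGMA r:{..<c}. {..<k ^ r}))" using i(2) by blast
  qed
  moreover have "finite (kernel (k ^ c) a \<times> (SIGMA r:{..<c}. {..<k ^ r}))"
    using A by (auto simp: k_automatic_def)
  ultimately show "k_automatic k a" using assms(1) finite_surj by (auto simp: k_automatic_def)
qed

declare One_nat_def [simp del]

context
  fixes s :: nat and p l :: "nat \<Rightarrow> nat"
    and f :: "nat \<Rightarrow> (nat \<Rightarrow> rat) set \<Rightarrow> (nat \<Rightarrow> rat) set"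
  assumes s2: "s \<ge> 2"
    and prime: "\<And>i. i \<in> {1..s} \<Longrightarrow> prime (p i)"
    and inj: "inj_on p {1..s}"
    and l1: "\<And>i. i \<in> {1..s} \<Longrightarrow> l i \<ge> 1"
    and ana: "\<And>i. i \<in> {1..s} \<Longrightarrow> Zp_analytic (p i) (f i)"
    and nz: "\<And>i. i \<in> {1..s} \<Longrightarrow> \<exists>x\<in>Zp (p i). f i x \<noteq> \<zero>\<^bsub>Qp (p i)\<^esub>"
begin

interpretation fam: padic_family "{1..s}" p l "\<lambda>i. KC (p i)" "\<lambda>i. NC (p i)" const_seq
  by (rule padic_family.intro) (use inj l1 padic_KC[OF prime] in auto)

section \<open>Translation of the digit functions into the relational form\<close>

lemma base_eq: "base s p l = fam.b"
  unfolding base_def fam.b_def ..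

text \<open>Comparisons with the rounded valuations become bounds on the seminorm; the two halves of
  \<open>isnu\<close> then say that v is a lower bound and that it is attained.\<close>

lemma nu_b_eq:
  assumes X: "\<And>i. i \<in> {1..s} \<Longrightarrow> X i \<in> KC (p i)" and v: "fam.isnu X v"
  shows "nu_b s p l (\<lambda>i\<in>{1..s}. cl (p i) (X i)) = v"
proof -
  define J where "J = {i\<in>{1..s}. NC (p i) (X i) \<noteq> 0}"
  have J: "{i\<in>{1..s}. (\<lambda>i\<in>{1..s}. cl (p i) (X i)) i \<noteq> \<zero>\<^bsub>Qp (p i)\<^esub>} = J"
  proof -
    have "cl (p i) (X i) = \<zero>\<^bsub>Qp (p i)\<^esub> \<longleftrightarrow> NC (p i) (X i) = 0" if i: "i \<in> {1..s}" for i
      using cl_eq_iff[OF prime[OF i] X[OF i] padic.K_0[OF padic_KC[OF prime[OF i]]]] cl_0[OF prime[OF i]] by simp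
    thus ?thesis by (auto simp: J_def)
  qed
  have val: "(v' \<le> Qp_val (p i) (cl (p i) (X i)) div int (l i)) \<longleftrightarrow> NC (p i) (X i) \<le> real (p i) powi (- (int (l i) * v'))"
    if "i \<in> J" for i v'
  proof -
    have i: "i \<in> {1..s}" "NC (p i) (X i) \<noteq> 0" using that by (auto simp: J_def)
    interpret padic "p i" "KC (p i)" "NC (p i)" const_seq by (rule padic_KC[OF prime[OF i(1)]])
    obtain u where u: "NC (p i) (X i) = P u" using N_values[OF X[OF i(1)] i(2)] by blast
    show ?thesis unfolding Qp_val_cl[OF prime[OF i(1)] X[OF i(1)] u] u P_le
      using l1[OF i(1)] by (intro int_le_div_iff) simp
  qed
  have "nu_b s p l (\<lambda>i\<in>{1..s}. cl (p i) (X i)) = Min ((\<lambda>i. Qp_val (p i) (cl (p i) (X i)) div int (l i)) ` J)"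
    unfolding nu_b_def J by (intro arg_cong[of _ _ Min] image_cong) (auto simp: J_def)
  also have "\<dots> = v"
  proof (rule Min_eqI)
    show "finite ((\<lambda>i. Qp_val (p i) (cl (p i) (X i)) div int (l i)) ` J)" by (simp add: J_def)
    fix y assume "y \<in> (\<lambda>i. Qp_val (p i) (cl (p i) (X i)) div int (l i)) ` J"
    then obtain i where i: "i \<in> J" "y = Qp_val (p i) (cl (p i) (X i)) div int (l i)" by blast
    show "v \<le> y" unfolding i(2) val[OF i(1)] using v i(1) by (auto simp: fam.isnu_def J_def)
  next
    obtain i where i: "i \<in> {1..s}" "real (p i) powi (- (int (l i) * (v + 1))) < NC (p i) (X i)"
      using v by (auto simp: fam.isnu_def)
    hence iJ: "i \<in> J" using fam.PP_pos[OF i(1), of "int (l i) * (v + 1)"] by (auto simp: J_def simp del: fam.PP_pos)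
    have "\<not> v + 1 \<le> Qp_val (p i) (cl (p i) (X i)) div int (l i)" unfolding val[OF iJ] using i(2) by simp
    moreover have "v \<le> Qp_val (p i) (cl (p i) (X i)) div int (l i)"
      unfolding val[OF iJ] using v i(1) by (auto simp: fam.isnu_def)
    ultimately have "v = Qp_val (p i) (cl (p i) (X i)) div int (l i)" by linarith
    thus "v \<in> (\<lambda>i. Qp_val (p i) (cl (p i) (X i)) div int (l i)) ` J" using iJ by blast
  qed
  finally show ?thesis .
qed

lemma Zb_mod_cl:
  assumes Y: "\<And>i. i \<in> {1..s} \<Longrightarrow> Y i \<in> KC (p i)"
    and y: "y < fam.b ^ d" "\<And>i. i \<in> {1..s} \<Longrightarrow> NC (p i) (of_nat y - Y i) \<le> real (p i) powi (- int (l i * d))"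
  shows "Zb_mod s p l d (\<lambda>i\<in>{1..s}. cl (p i) (Y i)) = y"
proof -
  have iff: "Zp_cong (p i) ((p i ^ l i) ^ d) (Qp_of_rat (p i) (of_nat y)) ((\<lambda>i\<in>{1..s}. cl (p i) (Y i)) i)
      \<longleftrightarrow> NC (p i) (of_nat y - Y i) \<le> real (p i) powi (- int (l i * d))" if i: "i \<in> {1..s}" for i y
  proof -
    interpret padic "p i" "KC (p i)" "NC (p i)" const_seq by (rule padic_KC[OF prime[OF i]])
    show ?thesis
      using i Zp_cong_iff[OF prime[OF i] K_of_nat Y[OF i], of "l i" d y]
      unfolding Qp_of_rat_cl[OF prime[OF i]] iota_of_nat by simp
  qed
  show ?thesis unfolding Zb_mod_def base_eq
  proof (rule the_equality)
    show "y < fam.b ^ d \<and> (\<forall>i\<in>{1..s}. Zp_cong (p i) ((p i ^ l i) ^ d) (Qp_of_rat (p i) (of_nat y))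
        ((\<lambda>i\<in>{1..s}. cl (p i) (Y i)) i))" using iff y by blast
  next
    fix z assume z: "z < fam.b ^ d \<and> (\<forall>i\<in>{1..s}. Zp_cong (p i) ((p i ^ l i) ^ d) (Qp_of_rat (p i) (of_nat z))
        ((\<lambda>i\<in>{1..s}. cl (p i) (Y i)) i))"
    have "[z = y] (mod (p i ^ (l i * d)))" if i: "i \<in> {1..s}" for i
    proof -
      interpret padic "p i" "KC (p i)" "NC (p i)" const_seq by (rule padic_KC[OF prime[OF i]])
      have "NC (p i) (of_nat z - Y i) \<le> P (int (l i * d))" using z iff i by blast
      moreover have "NC (p i) (Y i - of_nat y) \<le> P (int (l i * d))"
        using y(2)[OF i] N_commute[OF K_of_nat Y[OF i]] by metis
      ultimately have "NC (p i) (of_nat z - of_nat y) \<le> P (int (l i * d))"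
        using N_trans[OF K_of_nat Y[OF i] K_of_nat] by blast
      thus ?thesis unfolding N_of_nat_diff_le .
    qed
    hence "[z = y] (mod (fam.b ^ d))" by (rule fam.cong_base_power)
    thus "z = y" using z y(1) by (simp add: cong_less_modulus_unique_nat)
  qed
qed

text \<open>\<open>isdig_exists\<close> supplies some y, and the definite descriptions behind
  \<open>ell_b\<close> are then evaluated to that y.\<close>

lemma ell_isdig:
  assumes X: "\<And>i. i \<in> {1..s} \<Longrightarrow> X i \<in> KC (p i)"
  shows "fam.isdig d X (ell_b s p l d (\<lambda>i\<in>{1..s}. cl (p i) (X i)))" (is "fam.isdig d X (ell_b s p l d ?x)")
proof -
  obtain y where y: "fam.isdig d X y" using fam.isdig_exists[of X d] X by blast
  have cl0: "cl (p i) (X i) = Qp_of_rat (p i) 0 \<longleftrightarrow> NC (p i) (X i) = 0" if i: "i \<in> {1..s}" for i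
  proof -
    interpret padic "p i" "KC (p i)" "NC (p i)" const_seq by (rule padic_KC[OF prime[OF i]])
    show ?thesis using cl_eq_iff[OF prime[OF i] X[OF i] K_0] unfolding Qp_of_rat_cl[OF prime[OF i]] iota_0 by simp
  qed
  have zero: "?x = Qb_of_rat s p 0 \<longleftrightarrow> (\<forall>i\<in>{1..s}. NC (p i) (X i) = 0)"
    unfolding Qb_of_rat_def using cl0 by (auto simp: fun_eq_iff restrict_def)
  have "ell_b s p l d ?x = y"
  proof (cases "\<forall>i\<in>{1..s}. NC (p i) (X i) = 0")
    case True
    hence y0: "y = 0" using fam.isdig_zero[OF y] by blast
    have "L_b s p l ?x = (\<lambda>i\<in>{1..s}. cl (p i) 0)"
    proof -
      have "Qp_of_rat (p i) 0 = cl (p i) 0" if i: "i \<in> {1..s}" for i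
      proof -
        interpret padic "p i" "KC (p i)" "NC (p i)" const_seq by (rule padic_KC[OF prime[OF i]])
        show ?thesis unfolding Qp_of_rat_cl[OF prime[OF i]] iota_0 ..
      qed
      thus ?thesis using True zero by (auto simp: L_b_def Qb_of_rat_def restrict_def fun_eq_iff)
    qed
    moreover have "Zb_mod s p l d (\<lambda>i\<in>{1..s}. cl (p i) 0) = 0"
    proof (rule Zb_mod_cl)
      fix i assume i: "i \<in> {1..s}"
      interpret padic "p i" "KC (p i)" "NC (p i)" const_seq by (rule padic_KC[OF prime[OF i]])
      show "0 \<in> KC (p i)" by (rule K_0)
      have "NC (p i) (of_nat 0 - 0) = 0" by (simp only: of_nat_0 diff_self N_0)
      thus "NC (p i) (of_nat 0 - 0) \<le> real (p i) powi (- int (l i * d))" using P_pos[of "int (l i * d)"] by linarith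
    qed (use fam.b_pos in simp)
    ultimately show ?thesis unfolding ell_b_def y0 by simp
  next
    case False
    then obtain v where v: "fam.isnu X v" using fam.ex_isnu[of X] X by blast
    have "L_b s p l ?x = (\<lambda>i\<in>{1..s}. cl (p i) (fam.scal (- v) * X i))"
    proof -
      have "Qp_of_rat (p i) (of_nat (base s p l) powi (- v)) \<otimes>\<^bsub>Qp (p i)\<^esub> cl (p i) (X i) = cl (p i) (fam.scal (- v) * X i)"
        if i: "i \<in> {1..s}" for i
        unfolding Qp_of_rat_cl[OF prime[OF i]] base_eq fam.scal_def
        by (rule cl_mult[OF prime[OF i] KC_const[OF prime[OF i]] X[OF i]])
      thus ?thesis using False zero nu_b_eq[OF X v] by (auto simp: L_b_def restrict_def fun_eq_iff)
    qed
    moreover have "Zb_mod s p l d (\<lambda>i\<in>{1..s}. cl (p i) (fam.scal (- v) * X i)) = y"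
    proof (rule Zb_mod_cl)
      show "y < fam.b ^ d" using y by (simp add: fam.isdig_def)
      fix i assume i: "i \<in> {1..s}"
      show "fam.scal (- v) * X i \<in> KC (p i)" by (intro KC_mult prime i fam.scal_K X)
      show "NC (p i) (of_nat y - fam.scal (- v) * X i) \<le> real (p i) powi (- int (l i * d))"
        using y v fam.isnu_unique[OF v] fam.isnu_nonzero[OF v] i unfolding fam.isdig_def by blast
    qed
    ultimately show ?thesis unfolding ell_b_def by simp
  qed
  thus ?thesis using y by simp
qed

lemma ex_coeffs: "\<exists>co. \<forall>i\<in>{1..s}. padic.analytic_with (KC (p i)) (NC (p i)) (co i) (lift (p i) (f i))"
  using lift_analytic[OF prime ana] by (intro bchoice) blast

lemma digit_seq_isdig: "fam.isdig d (\<lambda>i. lift (p i) (f i) (of_nat n)) (digit_seq s p l d f n)"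
proof -
  have *: "f i (Qp_of_rat (p i) (of_nat n)) = cl (p i) (lift (p i) (f i) (of_nat n))
      \<and> lift (p i) (f i) (of_nat n) \<in> KC (p i)" if i: "i \<in> {1..s}" for i
  proof -
    interpret padic "p i" "KC (p i)" "NC (p i)" const_seq by (rule padic_KC[OF prime[OF i]])
    show ?thesis unfolding Qp_of_rat_cl[OF prime[OF i]] iota_of_nat
      using cl_lift[OF prime[OF i] ana[OF i] integers_of_nat] by simp
  qed
  have "eval_nat s p f n = (\<lambda>i\<in>{1..s}. cl (p i) (lift (p i) (f i) (of_nat n)))"
    unfolding eval_nat_def using * by (intro restrict_ext) blast
  thus ?thesis unfolding digit_seq_def using ell_isdig * by simp
qed

lemma ex_analytic_family:
  assumes "d \<ge> 1"
  shows "\<exists>co. analytic_family {1..s} p l (\<lambda>i. KC (p i)) (\<lambda>i. NC (p i)) const_seq (\<lambda>i. lift (p i) (f i)) co d (digit_seq s p l d f)"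
proof -
  obtain co where "\<forall>i\<in>{1..s}. padic.analytic_with (KC (p i)) (NC (p i)) (co i) (lift (p i) (f i))"
    using ex_coeffs by blast
  hence "analytic_family {1..s} p l (\<lambda>i. KC (p i)) (\<lambda>i. NC (p i)) const_seq (\<lambda>i. lift (p i) (f i)) co d (digit_seq s p l d f)"
    by (intro analytic_family.intro fam.padic_family_axioms analytic_family_axioms.intro assms digit_seq_isdig) blast
  thus ?thesis by (rule exI[of _ co])
qed

lemma lift_root_iff:
  assumes "i \<in> {1..s}" "x \<in> padic.integers (KC (p i)) (NC (p i))"
  shows "NC (p i) (lift (p i) (f i) x) = 0 \<longleftrightarrow> cl (p i) x \<in> Zp_roots (p i) (f i)"
  using lift_zero_iff[OF prime[OF assms(1)] ana[OF assms(1)] assms(2)] integers_cl_Zp[OF prime[OF assms(1)] assms(2)]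
  by (simp add: Zp_roots_def)

lemma no_roots_periodic:
  assumes "Zb_roots s p f = {}" "d \<ge> 1" shows "\<exists>e. has_period (digit_seq s p l d f) (base s p l ^ e)"
proof -
  obtain co where "analytic_family {1..s} p l (\<lambda>i. KC (p i)) (\<lambda>i. NC (p i)) const_seq (\<lambda>i. lift (p i) (f i)) co d (digit_seq s p l d f)"
    by (rule exE[OF ex_analytic_family[OF assms(2)]])
  then interpret A: analytic_family "{1..s}" p l "\<lambda>i. KC (p i)" "\<lambda>i. NC (p i)" const_seq "\<lambda>i. lift (p i) (f i)" co d "digit_seq s p l d f" .
  obtain j where "j \<in> {1..s}" "Zp_roots (p j) (f j) = {}"
    using assms(1) unfolding Zb_roots_def PiE_eq_empty_iff by blast
  thus ?thesis using A.periodic_if_no_root[of j] lift_root_iff[of j] by (simp add: base_eq)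
qed

section \<open>Consequences of automaticity for the set of common roots\<close>

lemma root_factor:
  assumes i: "i \<in> {1..s}" and th: "\<theta> \<in> padic.integers (KC (p i)) (NC (p i))" and root: "cl (p i) \<theta> \<in> Zp_roots (p i) (f i)"
  shows "\<exists>c G. padic.analytic_with (KC (p i)) (NC (p i)) c G \<and> NC (p i) (G \<theta>) \<noteq> 0 \<and>
    0 < root_mult (p i) (f i) (cl (p i) \<theta>) \<and>
    (\<forall>x\<in>padic.integers (KC (p i)) (NC (p i)).
       NC (p i) (lift (p i) (f i) x - (x - \<theta>) ^ root_mult (p i) (f i) (cl (p i) \<theta>) * G x) = 0)"
proof -
  interpret padic "p i" "KC (p i)" "NC (p i)" const_seq by (rule padic_KC[OF prime[OF i]])
  obtain co where co: "analytic_with co (lift (p i) (f i))" using lift_analytic[OF prime[OF i] ana[OF i]] by blast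
  obtain x where x: "x \<in> Zp (p i)" "f i x \<noteq> \<zero>\<^bsub>Qp (p i)\<^esub>" using nz[OF i] by blast
  note X = rep_Zp[OF prime[OF i] x(1)] rep(2)[OF prime[OF i] Zp_carrier[OF prime[OF i] x(1)]]
  have "NC (p i) (lift (p i) (f i) (rep (p i) x)) \<noteq> 0"
    using lift_zero_iff[OF prime[OF i] ana[OF i] X(1)] X(2) x(2) by simp
  then obtain M where M: "strassmann_index co M" using ex_strassmann_index[OF co X(1)] by blast
  have "NC (p i) (lift (p i) (f i) \<theta>) = 0" using lift_root_iff[OF i th] root by simp
  note fac = factor_root[OF co M th this]
  obtain m c G where G: "analytic_with c G" "m > 0" "NC (p i) (G \<theta>) \<noteq> 0"
    "\<And>x. x \<in> integers \<Longrightarrow> NC (p i) (lift (p i) (f i) x - (x - \<theta>) ^ m * G x) = 0"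
    by (rule fac) (rule that)
  have "root_mult (p i) (f i) (cl (p i) \<theta>) = m"
    by (rule root_mult_eq[OF prime[OF i] ana[OF i] th G(1,3,4)])
  thus ?thesis using G by blast
qed

lemma automatic_imp_rational_root:
  assumes root: "\<Theta> \<in> Zb_roots s p f" and d: "d \<ge> 1" and aut: "k_automatic g (digit_seq s p l d f)"
  shows "\<exists>q e. \<Theta> = Qb_of_rat s p q \<and> g = (\<Prod>i\<in>{1..s}. p i ^ e i) \<and>
    (\<forall>i\<in>{1..s}. \<forall>j\<in>{1..s}. e i * root_mult (p i) (f i) (\<Theta> i) * l j = e j * root_mult (p j) (f j) (\<Theta> j) * l i)"
proof -
  obtain co where "analytic_family {1..s} p l (\<lambda>i. KC (p i)) (\<lambda>i. NC (p i)) const_seq (\<lambda>i. lift (p i) (f i)) co d (digit_seq s p l d f)"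
    by (rule exE[OF ex_analytic_family[OF d]])
  then interpret A: analytic_family "{1..s}" p l "\<lambda>i. KC (p i)" "\<lambda>i. NC (p i)" const_seq "\<lambda>i. lift (p i) (f i)" co d "digit_seq s p l d f" .
  define th where "th = (\<lambda>i. rep (p i) (\<Theta> i))"
  have \<Theta>: "\<Theta> i \<in> Zp (p i)" "\<Theta> i \<in> Zp_roots (p i) (f i)" if "i \<in> {1..s}" for i
    using root that by (auto simp: Zb_roots_def Zp_roots_def)
  have th: "th i \<in> padic.integers (KC (p i)) (NC (p i))" "cl (p i) (th i) = \<Theta> i" if i: "i \<in> {1..s}" for i
    using rep_Zp[OF prime[OF i] \<Theta>(1)[OF i]] rep(2)[OF prime[OF i] Zp_carrier[OF prime[OF i] \<Theta>(1)[OF i]]]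
    by (simp_all add: th_def)
  define mu where "mu = (\<lambda>i. root_mult (p i) (f i) (\<Theta> i))"
  have "\<forall>i\<in>{1..s}. \<exists>c G. padic.analytic_with (KC (p i)) (NC (p i)) c G \<and> NC (p i) (G (th i)) \<noteq> 0 \<and> 0 < mu i \<and>
    (\<forall>x\<in>padic.integers (KC (p i)) (NC (p i)). NC (p i) (lift (p i) (f i) x - (x - th i) ^ mu i * G x) = 0)"
    using root_factor[OF _ th(1)] th(2) \<Theta>(2) by (simp add: mu_def)
  then obtain ch where "\<forall>i\<in>{1..s}. \<exists>G. padic.analytic_with (KC (p i)) (NC (p i)) (ch i) G \<and> NC (p i) (G (th i)) \<noteq> 0 \<and> 0 < mu i \<and>
    (\<forall>x\<in>padic.integers (KC (p i)) (NC (p i)). NC (p i) (lift (p i) (f i) x - (x - th i) ^ mu i * G x) = 0)"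
    by (rule exE[OF bchoice])
  then obtain H where H: "\<forall>i\<in>{1..s}. padic.analytic_with (KC (p i)) (NC (p i)) (ch i) (H i) \<and> NC (p i) (H i (th i)) \<noteq> 0 \<and> 0 < mu i \<and>
    (\<forall>x\<in>padic.integers (KC (p i)) (NC (p i)). NC (p i) (lift (p i) (f i) x - (x - th i) ^ mu i * H i x) = 0)"
    by (rule exE[OF bchoice])
  have two: "\<exists>j\<in>{1..s}. j \<noteq> i" if "i \<in> {1..s}" for i
    using s2 by (cases "i = 1") (auto intro: bexI[of _ 2] bexI[of _ 1])
  have nz': "\<exists>x\<in>padic.integers (KC (p i)) (NC (p i)). NC (p i) (lift (p i) (f i) x) \<noteq> 0" if i: "i \<in> {1..s}" for i
  proof -
    obtain x where x: "x \<in> Zp (p i)" "f i x \<noteq> \<zero>\<^bsub>Qp (p i)\<^esub>" using nz[OF i] by blast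
    note X = rep_Zp[OF prime[OF i] x(1)] rep(2)[OF prime[OF i] Zp_carrier[OF prime[OF i] x(1)]]
    thus ?thesis using lift_zero_iff[OF prime[OF i] ana[OF i] X(1)] x(2) by auto
  qed
  interpret B: automatic_root "{1..s}" p l "\<lambda>i. KC (p i)" "\<lambda>i. NC (p i)" const_seq "\<lambda>i. lift (p i) (f i)" co d "digit_seq s p l d f" th mu H ch g
    by unfold_locales (use two s2 th(1) H aut nz' in \<open>auto simp: k_automatic_def\<close>)
  obtain q where q: "\<And>i. i \<in> {1..s} \<Longrightarrow> NC (p i) (th i - const_seq q) = 0" using B.root_rational by blast
  have "\<Theta> i = Qp_of_rat (p i) q" if i: "i \<in> {1..s}" for i
  proof -
    interpret padic "p i" "KC (p i)" "NC (p i)" const_seq by (rule padic_KC[OF prime[OF i]])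
    show ?thesis using cl_eq_iff[OF prime[OF i] integersD[OF th(1)[OF i]] K_iota, of q] q[OF i] th(2)[OF i]
      unfolding Qp_of_rat_cl[OF prime[OF i]] by simp
  qed
  hence "\<Theta> = Qb_of_rat s p q" using root unfolding Zb_roots_def Qb_of_rat_def
    by (intro extensionalityI[of _ "{1..s}"]) (auto simp: PiE_def)
  moreover have "g = (\<Prod>i\<in>{1..s}. p i ^ B.ex i)" using B.g_eq by (simp add: B.gb_def)
  ultimately show ?thesis using B.exponents_eq unfolding mu_def by blast
qed

lemma Qp_of_rat_inj: assumes i: "i \<in> {1..s}" shows "Qp_of_rat (p i) q = Qp_of_rat (p i) r \<longleftrightarrow> q = r"
proof -
  interpret padic "p i" "KC (p i)" "NC (p i)" const_seq by (rule padic_KC[OF prime[OF i]])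
  have "cl (p i) (const_seq q) = cl (p i) (const_seq r) \<longleftrightarrow> NC (p i) (const_seq q - const_seq r) = 0"
    by (rule cl_eq_iff[OF prime[OF i] K_iota K_iota])
  also have "\<dots> \<longleftrightarrow> q = r" unfolding iota_diff[symmetric] N_iota rat_abs_eq_0[OF prime_p] by simp
  finally show ?thesis unfolding Qp_of_rat_cl[OF prime[OF i]] .
qed

text \<open>The common roots form a product set, and automaticity puts each of them on the diagonal.
  Mixing the coordinates of two of them gives a third one, whose rational must equal both.\<close>

lemma automatic_imp_single_root:
  assumes "\<Theta> \<in> Zb_roots s p f" "d \<ge> 1" "k_automatic g (digit_seq s p l d f)"
  shows "\<exists>q. Qb_of_rat s p q \<in> Zb s p \<and> Zb_roots s p f = {Qb_of_rat s p q}"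
proof -
  have rat: "\<exists>q. \<Theta> = Qb_of_rat s p q" if "\<Theta> \<in> Zb_roots s p f" for \<Theta>
    using automatic_imp_rational_root[OF that assms(2,3)] by blast
  obtain q where q: "\<Theta> = Qb_of_rat s p q" using rat[OF assms(1)] by blast
  have "\<Theta>' = \<Theta>" if \<Theta>': "\<Theta>' \<in> Zb_roots s p f" for \<Theta>'
  proof -
    obtain q' where q': "\<Theta>' = Qb_of_rat s p q'" using rat[OF \<Theta>'] by blast
    \<comment> \<open>Coordinate 1 is taken from \<Theta>', the others from \<Theta>; as s \<ge> 2,
      coordinate 2 remembers \<Theta>.\<close>
    define M where "M = (\<lambda>i. if i = 1 then \<Theta>' i else \<Theta> i)"
    have "M \<in> Zb_roots s p f" using assms(1) \<Theta>' s2 by (auto simp: M_def Zb_roots_def PiE_def Pi_def extensional_def)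
    then obtain r where r: "M = Qb_of_rat s p r" using rat by blast
    have I: "1 \<in> {1..s}" "2 \<in> {1..s}" using s2 by auto
    have "r = q'" using fun_cong[OF r, of 1] I(1) Qp_of_rat_inj[OF I(1)] by (simp add: M_def q' Qb_of_rat_def)
    moreover have "r = q" using fun_cong[OF r, of 2] I(2) Qp_of_rat_inj[OF I(2)] by (simp add: M_def q Qb_of_rat_def)
    ultimately show ?thesis by (simp add: q q')
  qed
  hence "Zb_roots s p f = {\<Theta>}" using assms(1) by blast
  moreover have "\<Theta> \<in> Zb s p" using assms(1) by (auto simp: Zb_roots_def Zb_def Zp_roots_def)
  ultimately show ?thesis using q by blast
qed

section \<open>A single common root, which is rational\<close>

context
  fixes \<theta> :: rat
  assumes single: "Zb_roots s p f = {Qb_of_rat s p \<theta>}"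
begin

text \<open>Replacing the i-th coordinate of the only tuple by any root of f_i gives a tuple of
  roots again.\<close>

lemma single_root: "i \<in> {1..s} \<Longrightarrow> Zp_roots (p i) (f i) = {Qp_of_rat (p i) \<theta>}"
proof -
  assume i: "i \<in> {1..s}"
  have mem: "Qb_of_rat s p \<theta> \<in> Zb_roots s p f" using single by blast
  have "x = Qp_of_rat (p i) \<theta>" if x: "x \<in> Zp_roots (p i) (f i)" for x
  proof -
    have "(Qb_of_rat s p \<theta>)(i := x) \<in> Zb_roots s p f" using mem x i by (auto simp: Zb_roots_def PiE_def Pi_def extensional_def)
    hence "((Qb_of_rat s p \<theta>)(i := x)) i = Qb_of_rat s p \<theta> i" using single by simp
    thus ?thesis using i by (simp add: Qb_of_rat_def)
  qed
  moreover have "Qp_of_rat (p i) \<theta> \<in> Zp_roots (p i) (f i)"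
    using mem i by (auto simp: Zb_roots_def Qb_of_rat_def PiE_def Pi_def)
  ultimately show ?thesis by blast
qed

abbreviation (input) "rmult i \<equiv> root_mult (p i) (f i) (Qp_of_rat (p i) \<theta>)"

lemma theta_int: assumes i: "i \<in> {1..s}" shows "const_seq \<theta> \<in> padic.integers (KC (p i)) (NC (p i))"
  using single_root[OF i] cl_Zp[OF prime[OF i] KC_const[OF prime[OF i]], of \<theta>]
  unfolding Qp_of_rat_cl[OF prime[OF i]] by (auto simp: Zp_roots_def)

lemma mult_pos: assumes i: "i \<in> {1..s}" shows "0 < rmult i"
  using root_factor[OF i theta_int[OF i]] single_root[OF i] unfolding Qp_of_rat_cl[OF prime[OF i]] by blast

text \<open>Strictness: the exponents of every base of automaticity are proportional to l_i / m_i,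
  where m_i is the multiplicity. So are the exponents l_i w_i of k, hence the two bases have a
  common power.\<close>

lemma single_root_strictly_automatic:
  assumes d: "d \<ge> 1" and w: "\<And>i. i \<in> {1..s} \<Longrightarrow> w i \<ge> 1"
    and wm: "\<And>i j. i \<in> {1..s} \<Longrightarrow> j \<in> {1..s} \<Longrightarrow> w i * rmult i = w j * rmult j"
  shows "strictly_automatic (\<Prod>i\<in>{1..s}. (p i ^ l i) ^ w i) (digit_seq s p l d f)"
proof -
  define k where "k = (\<Prod>i\<in>{1..s}. (p i ^ l i) ^ w i)"
  have I1: "1 \<in> {1..s}" using s2 by auto
  define W where "W = w 1 * rmult 1"
  have W: "w i * rmult i = W" if "i \<in> {1..s}" for i unfolding W_def by (rule wm[OF that I1])
  have k2: "k \<ge> 2"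
  proof -
    have "p 1 dvd (p 1 ^ l 1) ^ w 1" using l1[OF I1] w[OF I1] by (simp add: dvd_power flip: power_mult)
    also have "\<dots> dvd k" unfolding k_def using I1 by (intro dvd_prodI) auto
    finally have "p 1 dvd k" .
    moreover have "k > 0" unfolding k_def using prime prime_gt_0_nat by (intro prod_pos) auto
    ultimately have "p 1 \<le> k" by (rule dvd_imp_le)
    thus ?thesis using prime_ge_2_nat[OF prime[OF I1]] by linarith
  qed
  obtain co where "analytic_family {1..s} p l (\<lambda>i. KC (p i)) (\<lambda>i. NC (p i)) const_seq (\<lambda>i. lift (p i) (f i)) co d (digit_seq s p l d f)"
    by (rule exE[OF ex_analytic_family[OF d]])
  then interpret A: analytic_family "{1..s}" p l "\<lambda>i. KC (p i)" "\<lambda>i. NC (p i)" const_seq "\<lambda>i. lift (p i) (f i)" co d "digit_seq s p l d f" .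
  have "\<forall>i\<in>{1..s}. \<exists>c G. padic.analytic_with (KC (p i)) (NC (p i)) c G \<and> NC (p i) (G (const_seq \<theta>)) \<noteq> 0 \<and>
    (\<forall>x\<in>padic.integers (KC (p i)) (NC (p i)). NC (p i) (lift (p i) (f i) x - (x - const_seq \<theta>) ^ rmult i * G x) = 0)"
  proof
    fix i assume i: "i \<in> {1..s}"
    have "cl (p i) (const_seq \<theta>) \<in> Zp_roots (p i) (f i)"
      using single_root[OF i] unfolding Qp_of_rat_cl[OF prime[OF i]] by simp
    from root_factor[OF i theta_int[OF i] this]
    show "\<exists>c G. padic.analytic_with (KC (p i)) (NC (p i)) c G \<and> NC (p i) (G (const_seq \<theta>)) \<noteq> 0 \<and>
      (\<forall>x\<in>padic.integers (KC (p i)) (NC (p i)). NC (p i) (lift (p i) (f i) x - (x - const_seq \<theta>) ^ rmult i * G x) = 0)"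
      unfolding Qp_of_rat_cl[OF prime[OF i]] by (elim exE conjE) (intro exI conjI)
  qed
  then obtain cg where "\<forall>i\<in>{1..s}. \<exists>G. padic.analytic_with (KC (p i)) (NC (p i)) (cg i) G \<and> NC (p i) (G (const_seq \<theta>)) \<noteq> 0 \<and>
    (\<forall>x\<in>padic.integers (KC (p i)) (NC (p i)). NC (p i) (lift (p i) (f i) x - (x - const_seq \<theta>) ^ rmult i * G x) = 0)"
    by (rule exE[OF bchoice])
  then obtain G where G: "\<forall>i\<in>{1..s}. padic.analytic_with (KC (p i)) (NC (p i)) (cg i) (G i) \<and> NC (p i) (G i (const_seq \<theta>)) \<noteq> 0 \<and>
    (\<forall>x\<in>padic.integers (KC (p i)) (NC (p i)). NC (p i) (lift (p i) (f i) x - (x - const_seq \<theta>) ^ rmult i * G i x) = 0)"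
    by (rule exE[OF bchoice])
  \<comment> \<open>A zero of G_i would be a root of f_i and so represent \<theta>, where G_i does
    not vanish. The Lipschitz bound compares the two values, as x and \<theta> agree only up to
    seminorm zero.\<close>
  have Gnz: "NC (p i) (G i x) \<noteq> 0" if i: "i \<in> {1..s}" and x: "x \<in> padic.integers (KC (p i)) (NC (p i))" for i x
  proof
    assume G0: "NC (p i) (G i x) = 0"
    interpret padic "p i" "KC (p i)" "NC (p i)" const_seq by (rule padic_KC[OF prime[OF i]])
    have Gi: "analytic_with (cg i) (G i)" "NC (p i) (G i (const_seq \<theta>)) \<noteq> 0"
      "NC (p i) (lift (p i) (f i) x - (x - const_seq \<theta>) ^ rmult i * G i x) = 0" using G i x by blast+
    note GK = analytic_withD(2)[OF Gi(1)]
    note K = integersD[OF x] K_iota[of \<theta>] GK[OF x] GK[OF theta_int[OF i]] cl_lift(2)[OF prime[OF i] ana[OF i] x]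
    have "NC (p i) (lift (p i) (f i) x) = NC (p i) ((x - const_seq \<theta>) ^ rmult i * G i x)"
      by (intro N_cong K_mult K_power K_diff K Gi(3))
    also have "\<dots> = NC (p i) ((x - const_seq \<theta>) ^ rmult i) * NC (p i) (G i x)"
      by (intro N_mult K_power K_diff K)
    finally have "NC (p i) (lift (p i) (f i) x) = 0" using G0 by simp
    hence "cl (p i) x = cl (p i) (const_seq \<theta>)"
      using lift_root_iff[OF i x] single_root[OF i] unfolding Qp_of_rat_cl[OF prime[OF i]] by simp
    hence x\<theta>: "NC (p i) (x - const_seq \<theta>) = 0" using cl_eq_iff[OF prime[OF i] K(1,2)] by simp
    obtain C where "NC (p i) (G i x - G i (const_seq \<theta>)) \<le> C * NC (p i) (x - const_seq \<theta>)"
      using analytic_Lipschitz[OF Gi(1)] x theta_int[OF i] by blast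
    hence "NC (p i) (G i x - G i (const_seq \<theta>)) = 0"
      using x\<theta> N_nonneg[OF K_diff[OF K(3,4)]] by simp
    thus False using N_cong[OF K(3,4)] G0 Gi(2) by simp
  qed
  have \<theta>1: "rat_abs (p i) \<theta> \<le> 1" if i: "i \<in> {1..s}" for i
    using padic.integers_N[OF padic_KC[OF prime[OF i]] theta_int[OF i]] NC_const[OF prime[OF i]] by simp
  interpret B: rational_root "{1..s}" p l "\<lambda>i. KC (p i)" "\<lambda>i. NC (p i)" const_seq "\<lambda>i. lift (p i) (f i)" co d "digit_seq s p l d f"
    \<theta> "\<lambda>i. rmult i" w W G cg
    by unfold_locales (use \<theta>1 w W G Gnz in auto)
  have "B.k = k" by (simp add: B.k_def k_def power_mult)
  hence aut: "k_automatic k (digit_seq s p l d f)" using B.finite_kernel k2 by (simp add: k_automatic_def)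
  have "\<not> k_automatic g (digit_seq s p l d f)" if ind: "mult_indep k g" for g
  proof
    assume g: "k_automatic g (digit_seq s p l d f)"
    hence g2: "g \<ge> 2" by (simp add: k_automatic_def)
    obtain e where e: "g = (\<Prod>i\<in>{1..s}. p i ^ e i)"
      "\<And>i j. i \<in> {1..s} \<Longrightarrow> j \<in> {1..s} \<Longrightarrow> e i * rmult i * l j = e j * rmult j * l i"
      using automatic_imp_rational_root[OF _ d g, of "Qb_of_rat s p \<theta>"] single by (auto simp: Qb_of_rat_def)
    \<comment> \<open>The exponents of p_i in the two powers that are to coincide: multiply the
      proportionality of i and 1 by w_i and use w_i m_i = W.\<close>
    have "e i * (W * l 1) = l i * w i * (e 1 * rmult 1)" if i: "i \<in> {1..s}" for i
    proof -
      have "e i * (W * l 1) = (e i * rmult i * l 1) * w i" unfolding W[OF i, symmetric] by simp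
      also have "\<dots> = (e 1 * rmult 1 * l i) * w i" unfolding e(2)[OF i I1] ..
      finally show ?thesis by simp
    qed
    hence "g ^ (W * l 1) = k ^ (e 1 * rmult 1)"
      unfolding e(1) k_def prod_power_distrib by (intro prod.cong refl) (simp flip: power_mult)
    moreover have "W * l 1 \<ge> 1" using mult_pos[OF I1] w[OF I1] l1[OF I1] by (simp add: W_def One_nat_def Suc_le_eq)
    \<comment> \<open>Were this exponent zero, proportionality would make every e_i zero and g =
      1.\<close>
    moreover have "e 1 * rmult 1 \<ge> 1"
    proof (rule ccontr)
      assume "\<not> e 1 * rmult 1 \<ge> 1"
      hence "e 1 * rmult 1 = 0" by linarith
      hence "e i * rmult i * l 1 = 0" if "i \<in> {1..s}" for i using e(2)[OF that I1] by simp
      hence "e i = 0" if "i \<in> {1..s}" for i using mult_pos[OF that] l1[OF I1] that by fastforce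
      hence "g = 1" unfolding e(1) by simp
      thus False using g2 by simp
    qed
    ultimately show False using ind unfolding mult_indep_def by metis
  qed
  thus ?thesis using aut unfolding strictly_automatic_def k_def by blast
qed

text \<open>Let w_i be the product of the multiplicities of the other components. Then all w_i m_i
  are equal, and the resulting base does not involve d.\<close>

lemma ex_common_strict_base: "\<exists>k\<ge>2. \<forall>d\<ge>1. strictly_automatic k (digit_seq s p l d f)"
proof -
  define w where "w = (\<lambda>i. \<Prod>j\<in>{1..s}-{i}. rmult j)"
  have w: "w i \<ge> 1" for i unfolding w_def Suc_le_eq One_nat_def using mult_pos by (intro prod_pos) auto
  have wm: "w i * rmult i = (\<Prod>j\<in>{1..s}. rmult j)" if "i \<in> {1..s}" for i
    unfolding w_def using that by (simp add: prod.remove[of _ i] mult.commute)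
  have "strictly_automatic (\<Prod>i\<in>{1..s}. (p i ^ l i) ^ w i) (digit_seq s p l d f)" if "d \<ge> 1" for d
    by (rule single_root_strictly_automatic[OF that w]) (simp only: wm)
  thus ?thesis by (auto simp: strictly_automatic_def k_automatic_def)
qed

end

text \<open>Two strict bases of one sequence have a common power, and automaticity passes between
  bases with a common power. So sequences sharing one strict base share all of them.\<close>

lemma strictly_automatic_transfer:
  assumes "k0 \<ge> 2" "strictly_automatic k0 (a :: nat \<Rightarrow> nat)" "strictly_automatic k0 (a' :: nat \<Rightarrow> nat)"
    and "k \<ge> 2" "strictly_automatic k a"
  shows "strictly_automatic k a'"
proof -
  have "\<not> mult_indep k k0" using assms by (auto simp: strictly_automatic_def)
  then obtain x y where xy: "x \<ge> 1" "y \<ge> 1" "k ^ x = k0 ^ y" by (auto simp: mult_indep_def)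
  have "k_automatic k0 a'" using assms(3) by (simp add: strictly_automatic_def)
  hence "k_automatic (k ^ x) a'" using k_automatic_power_iff[OF assms(1) xy(2)] xy(3) by metis
  hence "k_automatic k a'" using k_automatic_power_iff[OF assms(4) xy(1)] by blast
  moreover have "\<not> k_automatic m a'" if m: "m \<ge> 2" "mult_indep k m" for m
  proof
    assume "k_automatic m a'"
    hence "\<not> mult_indep k0 m" using assms(3) m(1) by (auto simp: strictly_automatic_def)
    then obtain u v where uv: "u \<ge> 1" "v \<ge> 1" "k0 ^ u = m ^ v" by (auto simp: mult_indep_def)
    have "k ^ (x * u) = m ^ (v * y)" using xy(3) uv(3) by (metis power_mult mult.commute)
    moreover have "x * u \<ge> 1" "v * y \<ge> 1" using xy uv by (simp_all add: One_nat_def Suc_le_eq)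
    ultimately show False using m(2) unfolding mult_indep_def by blast
  qed
  ultimately show ?thesis by (simp add: strictly_automatic_def)
qed

text \<open>A periodic sequence is automatic in every base, in particular in base k + 1.\<close>

lemma strictly_automatic_imp_not_periodic:
  assumes "strictly_automatic k (a :: nat \<Rightarrow> nat)" shows "\<not> periodic a"
proof
  assume "periodic a"
  have "k \<ge> 2" using assms by (simp add: strictly_automatic_def k_automatic_def)
  thus False using periodic_imp_k_automatic[OF \<open>periodic a\<close>, of "Suc k"] mult_indep_Suc[of k] assms
    by (auto simp: strictly_automatic_def)
qed

text \<open>The root set decides for all d at once: without common roots every sequence is periodic,
  with a single rational one all share a strict base, and otherwise none is automatic. Only one
  implication is proved, since d and d' are interchangeable.\<close>

lemma independent_of_d:
  assumes "d \<ge> 1" "d' \<ge> 1"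
  shows "(periodic (digit_seq s p l d f) \<longrightarrow> periodic (digit_seq s p l d' f)) \<and>
    (\<forall>k\<ge>2. strictly_automatic k (digit_seq s p l d f) \<longrightarrow> strictly_automatic k (digit_seq s p l d' f)) \<and>
    (automatic (digit_seq s p l d f) \<longrightarrow> automatic (digit_seq s p l d' f))"
proof (cases "Zb_roots s p f = {}")
  case True
  have per: "periodic (digit_seq s p l d f)" if "d \<ge> 1" for d using no_roots_periodic[OF True that] by (auto simp: periodic_def)
  hence "automatic (digit_seq s p l d' f)" using periodic_imp_k_automatic[OF per, of d' 2] assms by (auto simp: automatic_def)
  thus ?thesis using per assms strictly_automatic_imp_not_periodic by blast
next
  case False
  then obtain \<Theta> where \<Theta>: "\<Theta> \<in> Zb_roots s p f" by blast
  show ?thesis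
  proof (cases "automatic (digit_seq s p l d f)")
    case True
    then obtain g where "k_automatic g (digit_seq s p l d f)" by (auto simp: automatic_def)
    then obtain q where "Zb_roots s p f = {Qb_of_rat s p q}"
      using automatic_imp_single_root[OF \<Theta> assms(1)] by blast
    then obtain k0 where k0: "k0 \<ge> 2" "\<And>d. d \<ge> 1 \<Longrightarrow> strictly_automatic k0 (digit_seq s p l d f)"
      using ex_common_strict_base by blast
    have "automatic (digit_seq s p l d' f)" using k0 assms(2) by (auto simp: automatic_def strictly_automatic_def)
    thus ?thesis
      using strictly_automatic_transfer[OF k0(1) k0(2)[OF assms(1)] k0(2)[OF assms(2)]]
        strictly_automatic_imp_not_periodic[OF k0(2)[OF assms(1)]] by blast
  next
    case False
    hence "\<not> periodic (digit_seq s p l d f)" "\<not> strictly_automatic k (digit_seq s p l d f)" if "k \<ge> 2" for k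
      using periodic_imp_k_automatic[of "digit_seq s p l d f" 2] that by (auto simp: automatic_def strictly_automatic_def)
    thus ?thesis using False by blast
  qed
qed

end

theorem theorem2p8:
  fixes s d :: nat and p l :: "nat \<Rightarrow> nat"
    and f :: "nat \<Rightarrow> (nat \<Rightarrow> rat) set \<Rightarrow> (nat \<Rightarrow> rat) set"
  assumes "s \<ge> 2"
    and "\<forall>i\<in>{1..s}. prime (p i)"
    and "inj_on p {1..s}"
    and "\<forall>i\<in>{1..s}. l i \<ge> 1"
    and "\<forall>i\<in>{1..s}. Zp_analytic (p i) (f i)"
    and "\<forall>i\<in>{1..s}. \<exists>x\<in>Zp (p i). f i x \<noteq> \<zero>\<^bsub>Qp (p i)\<^esub>"
    and "d \<ge> 1"
  shows "(Zb_roots s p f = {} \<longrightarrow>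
           periodic (digit_seq s p l d f) \<and>
           (\<exists>e. has_period (digit_seq s p l d f) (base s p l ^ e))) \<and>
         (\<forall>\<theta>::rat. Qb_of_rat s p \<theta> \<in> Zb s p \<and> Zb_roots s p f = {Qb_of_rat s p \<theta>} \<longrightarrow>
           (\<forall>w::nat \<Rightarrow> nat.
             (\<forall>i\<in>{1..s}. w i \<ge> 1) \<and>
             (\<forall>i\<in>{1..s}. \<forall>j\<in>{1..s}.
                w i * root_mult (p i) (f i) (Qp_of_rat (p i) \<theta>)
                = w j * root_mult (p j) (f j) (Qp_of_rat (p j) \<theta>)) \<longrightarrow>
             strictly_automatic (\<Prod>i\<in>{1..s}. (p i ^ l i) ^ w i) (digit_seq s p l d f))) \<and>
         (Zb_roots s p f \<noteq> {} \<and>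
           \<not> (\<exists>\<theta>::rat. Qb_of_rat s p \<theta> \<in> Zb s p \<and> Zb_roots s p f = {Qb_of_rat s p \<theta>}) \<longrightarrow>
           \<not> automatic (digit_seq s p l d f)) \<and>
         (\<forall>d'\<ge>1.
           (periodic (digit_seq s p l d f) \<longleftrightarrow> periodic (digit_seq s p l d' f)) \<and>
           (\<forall>k\<ge>2. strictly_automatic k (digit_seq s p l d f)
                  \<longleftrightarrow> strictly_automatic k (digit_seq s p l d' f)) \<and>
           (automatic (digit_seq s p l d f) \<longleftrightarrow> automatic (digit_seq s p l d' f)))"
proof -
  note hyps = assms(1) bspec[OF assms(2)] assms(3) bspec[OF assms(4)] bspec[OF assms(5)] bspec[OF assms(6)]
  have a: "Zb_roots s p f = {} \<Longrightarrow> \<exists>e. has_period (digit_seq s p l d f) (base s p l ^ e)"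
    by (rule no_roots_periodic[OF hyps]) (use assms(7) in auto)
  have b: "strictly_automatic (\<Prod>i\<in>{1..s}. (p i ^ l i) ^ w i) (digit_seq s p l d f)"
    if "Zb_roots s p f = {Qb_of_rat s p \<theta>}" "\<forall>i\<in>{1..s}. w i \<ge> 1"
      "\<forall>i\<in>{1..s}. \<forall>j\<in>{1..s}. w i * root_mult (p i) (f i) (Qp_of_rat (p i) \<theta>)
         = w j * root_mult (p j) (f j) (Qp_of_rat (p j) \<theta>)" for \<theta> w
    by (rule single_root_strictly_automatic[OF hyps that(1) assms(7)]) (use that(2,3) in blast)+
  \<comment> \<open>The contrapositive of (c): automaticity together with a common root leads back
    to case (b).\<close>
  have c: "\<exists>q. Qb_of_rat s p q \<in> Zb s p \<and> Zb_roots s p f = {Qb_of_rat s p q}"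
    if ne: "Zb_roots s p f \<noteq> {}" and aut: "automatic (digit_seq s p l d f)"
  proof -
    obtain \<Theta> g where root: "\<Theta> \<in> Zb_roots s p f" and g: "k_automatic g (digit_seq s p l d f)"
      using ne aut by (auto simp: automatic_def)
    show ?thesis
      by (rule automatic_imp_single_root[OF assms(1) _ assms(3) _ _ _ root assms(7) g]) (use assms in blast)+
  qed
  have dd: "(periodic (digit_seq s p l d1 f) \<longrightarrow> periodic (digit_seq s p l d2 f)) \<and>
    (\<forall>k\<ge>2. strictly_automatic k (digit_seq s p l d1 f) \<longrightarrow> strictly_automatic k (digit_seq s p l d2 f)) \<and>
    (automatic (digit_seq s p l d1 f) \<longrightarrow> automatic (digit_seq s p l d2 f))" if "d1 \<ge> 1" "d2 \<ge> 1" for d1 d2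
    by (rule independent_of_d[OF hyps that])
  show ?thesis
  proof (intro conjI)
    show "Zb_roots s p f = {} \<longrightarrow> periodic (digit_seq s p l d f) \<and>
           (\<exists>e. has_period (digit_seq s p l d f) (base s p l ^ e))"
      using a unfolding periodic_def by blast
  qed (use b c dd[OF assms(7)] dd[OF _ assms(7)] in blast)+
qed

end
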